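(* Assume H1 and that at least one of H2, H3 holds. Let $\bar\kappa > 1 \ge \underline{\kappa} > 1/2$, and let $\bar\gamma < 2/(\mathtt{m}+L)$ if H2 holds and $\bar\gamma<2/L$ if H3 holds. Let $W=W_q$ for some $q\in\mathbb{N}^*$ if H2 holds and $W=W_\alpha$ for some $\alpha<\underline{\kappa}\eta/4$ if H3 holds. Then for any $a\in(0,1]$ there exist $A_{2,a}\ge0$ and $\rho_a\in(0,1)$ such that for any $\theta\in\Theta$, $\kappa\in[\underline{\kappa},\bar\kappa]$, $\gamma\in(0,\bar\gamma]$, the kernels $S^\kappa_{\gamma,\theta}$ and $\bar S^\kappa_{\gamma,\theta}$ admit invariant probability measures $\pi_{\gamma,\theta}$ and $\bar\pi_{\gamma,\theta}$ respectively, and for any $x,y\in\mathbb{R}^d$ and $n\in\mathbb{N}$, $$\max\big(\|\delta_x (S^\kappa_{\gamma,\theta})^n-\pi_{\gamma,\theta}\|_{W^a},\|\delta_x (\bar S^\kappa_{\gamma,\theta})^n-\bar\pi_{\gamma,\theta}\|_{W^a}\big)\le A_{2,a}\rho_a^{\gamma n}W^a(x),$$ $$\max\big(\|\delta_x (S^\kappa_{\gamma,\theta})^n-\delta_y (S^\kappa_{\gamma,\theta})^n\|_{W^a},\|\delta_x (\bar S^\kappa_{\gamma,\theta})^n-\delta_y (\bar S^\kappa_{\gamma,\theta})^n\|_{W^a}\big)\le A_{2,a}\rho_a^{\gamma n}\{W^a(x)+W^a(y)\}.$$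
   Context: Let $d,d_\Theta\ge1$ and $\Theta\subset\mathbb{R}^{d_\Theta}$ nonempty; $\|\cdot\|$ Euclidean. For convex lsc $U$ and $\lambda>0$, $\mathrm{prox}^\lambda_U(x)=\arg\min_{\tilde x}\{U(\tilde x)+\|x-\tilde x\|^2/(2\lambda)\}$. $V$ is $\mathtt{m}$-convex if $V(tx+(1-t)y)\le tV(x)+(1-t)V(y)-(\mathtt{m}/2)t(1-t)\|x-y\|^2$. H1: for every $\theta\in\Theta$ there are convex $V_\theta,\bar V_\theta,U_\theta,\bar U_\theta:\mathbb{R}^d\to[0,\infty)$ with (a) $\pi_\theta\propto e^{-V_\theta-U_\theta}$, $\bar\pi_\theta\propto e^{-\bar V_\theta-\bar U_\theta}$ probability densities, and $\min(\inf_\theta\int e^{-V_\theta-U_\theta},\inf_\theta\int e^{-\bar V_\theta-\bar U_\theta})>0$; (b) $V_\theta,\bar V_\theta$ are $C^1$ with $L$-Lipschitz gradients ($L$ independent of $\theta$), and there are $R_{V,1},R_{V,2}\ge0$ and, for each $\theta$, minimizers $x^*_\theta$ of $V_\theta$, $\bar x^*_\theta$ of $\bar V_\theta$ with norm $\le R_{V,1}$ and values in $[-R_{V,2},R_{V,2}]$; (c) $U_\theta,\bar U_\theta$ are $M$-Lipschitz ($M$ independent of $\theta$) and there are $R_{U,1},R_{U,2}\ge0$ and points $x^\sharp_\theta,\bar x^\sharp_\theta$ of norm $\le R_{U,1}$ with $|U_\theta(x^\sharp_\theta)|,|\bar U_\theta(\bar x^\sharp_\theta)|\le R_{U,2}$.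 H2: there is $\mathtt{m}>0$ with $V_\theta,\bar V_\theta$ $\mathtt{m}$-convex for all $\theta$. H3: there are $\eta>0,c\ge0$ with $\min(U_\theta(x),\bar U_\theta(x))\ge\eta\|x\|-c$ for all $\theta,x$. PULA kernels: for $\kappa,\gamma>0$, $\theta\in\Theta$, $S^\kappa_{\gamma,\theta}(x,\cdot)$ is the Gaussian law with mean $p-\gamma\nabla V_\theta(p)$, $p=\mathrm{prox}^{\gamma\kappa}_{U_\theta}(x)$, and covariance $2\gamma I_d$; $\bar S^\kappa_{\gamma,\theta}$ is the same with $\bar V_\theta,\bar U_\theta$. $W_q(x)=1+\|x\|^{2q}$, $W_\alpha(x)=\exp[\alpha\sqrt{1+\|x\|^2}]$. For $W\ge1$, $\|\xi\|_W=\sup\{|\int f d\xi|:\sup_x|f(x)|/W(x)\le1\}$. $\delta_xK^n$ is the law after $n$ steps of $K$ from $x$. *)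

theory Defs
  imports "HOL-Analysis.Analysis" "HOL-Probability.Probability"
begin

definition prox :: "real \<Rightarrow> ('a::euclidean_space \<Rightarrow> real) \<Rightarrow> 'a \<Rightarrow> 'a" where
  "prox lam U x = (THE p. \<forall>z. U p + (norm (x - p))^2 / (2 * lam) \<le> U z + (norm (x - z))^2 / (2 * lam))"

definition m_convex :: "real \<Rightarrow> ('a::euclidean_space \<Rightarrow> real) \<Rightarrow> bool" where
  "m_convex m V \<longleftrightarrow> (\<forall>x y t. 0 \<le> t \<and> t \<le> 1 \<longrightarrow>
      V (t *\<^sub>R x + (1 - t) *\<^sub>R y) \<le> t * V x + (1 - t) * V y - (m / 2) * t * (1 - t) * (norm (x - y))^2)"

definition gaussian :: "'a::euclidean_space \<Rightarrow> real \<Rightarrow> 'a measure" where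
  "gaussian mu s = density lborel
     (\<lambda>y. ennreal ((2 * pi * s) powr (- real DIM('a) / 2) * exp (- ((norm (y - mu))^2) / (2 * s))))"

(* PULA kernel S^kappa_{gamma,theta}, given V (through its gradient gV) and U *)
definition pula_kernel :: "('a::euclidean_space \<Rightarrow> 'a) \<Rightarrow> ('a \<Rightarrow> real) \<Rightarrow> real \<Rightarrow> real \<Rightarrow> 'a \<Rightarrow> 'a measure" where
  "pula_kernel gV U \<kappa> \<gamma> x = (let p = prox (\<gamma> * \<kappa>) U x in gaussian (p - \<gamma> *\<^sub>R gV p) (2 * \<gamma>))"

primrec kiter :: "('a::euclidean_space \<Rightarrow> 'a measure) \<Rightarrow> nat \<Rightarrow> 'a \<Rightarrow> 'a measure" where
  "kiter K 0 x = return borel x"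
| "kiter K (Suc n) x = bind (kiter K n x) K"

definition invariant_prob :: "('a::euclidean_space \<Rightarrow> 'a measure) \<Rightarrow> 'a measure \<Rightarrow> bool" where
  "invariant_prob K \<pi> \<longleftrightarrow> prob_space \<pi> \<and> sets \<pi> = sets borel \<and> bind \<pi> K = \<pi>"

definition wnorm :: "('a::euclidean_space \<Rightarrow> real) \<Rightarrow> 'a measure \<Rightarrow> 'a measure \<Rightarrow> ereal" where
  "wnorm W \<mu> \<nu> = (if integrable \<mu> W \<and> integrable \<nu> W then
      (SUP f \<in> {f. f \<in> borel_measurable borel \<and> (\<forall>x. \<bar>f x\<bar> \<le> W x)}.
          ereal \<bar>(\<integral>x. f x \<partial>\<mu>) - (\<integral>x. f x \<partial>\<nu>)\<bar>)
    else \<infinity>)"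

definition W_poly :: "nat \<Rightarrow> 'a::euclidean_space \<Rightarrow> real" where
  "W_poly q x = 1 + (norm x) ^ (2 * q)"

definition W_exp :: "real \<Rightarrow> 'a::euclidean_space \<Rightarrow> real" where
  "W_exp \<alpha> x = exp (\<alpha> * sqrt (1 + (norm x)^2))"

definition H1_family :: "'p set \<Rightarrow> ('p \<Rightarrow> 'a::euclidean_space \<Rightarrow> real) \<Rightarrow> ('p \<Rightarrow> 'a \<Rightarrow> 'a)
     \<Rightarrow> ('p \<Rightarrow> 'a \<Rightarrow> real) \<Rightarrow> real \<Rightarrow> real \<Rightarrow> bool" where
  "H1_family \<Theta> V gV U L M \<longleftrightarrow>
     (\<forall>\<theta>\<in>\<Theta>. convex_on UNIV (V \<theta>) \<and> convex_on UNIV (U \<theta>)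
        \<and> (\<forall>x. V \<theta> x \<ge> 0) \<and> (\<forall>x. U \<theta> x \<ge> 0))
   \<and> (\<forall>\<theta>\<in>\<Theta>. integrable lborel (\<lambda>x. exp (- (V \<theta> x + U \<theta> x))))
   \<and> (\<exists>c>0. \<forall>\<theta>\<in>\<Theta>. c \<le> (\<integral>x. exp (- (V \<theta> x + U \<theta> x)) \<partial>lborel))
   \<and> (\<forall>\<theta>\<in>\<Theta>. (\<forall>x. (V \<theta> has_derivative (\<lambda>h. gV \<theta> x \<bullet> h)) (at x))
        \<and> L-lipschitz_on UNIV (gV \<theta>))
   \<and> (\<exists>R1 R2. R1 \<ge> 0 \<and> R2 \<ge> 0 \<and> (\<forall>\<theta>\<in>\<Theta>. \<exists>xs. (\<forall>z. V \<theta> xs \<le> V \<theta> z)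
        \<and> norm xs \<le> R1 \<and> \<bar>V \<theta> xs\<bar> \<le> R2))
   \<and> (\<forall>\<theta>\<in>\<Theta>. M-lipschitz_on UNIV (U \<theta>))
   \<and> (\<exists>R1 R2. R1 \<ge> 0 \<and> R2 \<ge> 0 \<and> (\<forall>\<theta>\<in>\<Theta>. \<exists>xs. norm xs \<le> R1 \<and> \<bar>U \<theta> xs\<bar> \<le> R2))"

end

theory Submission
  imports Defs
begin

text \<open>
  The PULA kernel is \<open>x \<mapsto> N(\<Phi> x, 2 \<gamma>)\<close> with \<open>\<Phi>\<close> a gradient step after a proximal step, and \<open>\<Phi>\<close> is
  nonexpansive as soon as \<open>\<gamma> L \<le> 2\<close>. For such chains Wang's dimension-free Harnack inequality
  \<open>(P\<^sup>n f x)\<^sup>2 \<le> exp (|x - y|\<^sup>2 / (2 \<gamma> n)) P\<^sup>n (f\<^sup>2) y\<close> holds: push the two trajectories together at constant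
  speed and pay for each shift with Cauchy-Schwarz. Hence after time \<open>\<gamma> n \<ge> 1\<close> balls are small sets, with constants
  that do not depend on \<open>\<gamma>\<close>. A drift condition \<open>P W \<le> exp (- \<delta> \<gamma>) W + b \<gamma>\<close> then gives a contraction in
  the weighted oscillation norm (Hairer and Mattingly's proof of Harris' theorem), uniformly in the parameters.
  The drift comes from strong convexity for the polynomial weights, and from the linear growth of \<open>U\<close>, which makes
  the proximal step move inwards at a fixed speed, for the exponential ones. The invariant measure is the
  limit in total variation of the laws started at the origin.
\<close>

subsection \<open>Proximal and gradient steps\<close>

text \<open>The requirement that shapes the estimates is uniformity as \<gamma> tends to 0. A unit
  of time then has about 1/\<gamma> steps, so a step may contribute an error of order \<gamma> only,
  whereas its noise has size of order sqrt \<gamma>. Hence terms linear in the noise must cancel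
  exactly: by symmetry for powers of the norm, and through explicit Gaussian integrals of
  exponentials of quadratics for the exponential weights. The same requirement decides how the
  exponent \<open>a\<close> is treated. A power of an exponential weight is an exponential weight
  with a smaller parameter. For a polynomial weight the finished drift inequality is raised to the
  power \<open>a\<close> by tangent lines of the concave power function, because its subadditivity
  would leave the error \<open>(b * \<gamma>) powr a\<close>, too large for small \<gamma>. Test
  functions dominated by \<open>W\<close> may be unbounded. The contraction is therefore proved for
  bounded test functions, with constants that do not see the bound, and truncation comes
  last.\<close>

definition is_prox :: "real \<Rightarrow> ('a::euclidean_space \<Rightarrow> real) \<Rightarrow> 'a \<Rightarrow> 'a \<Rightarrow> bool" where
  "is_prox lam U x p \<longleftrightarrow> (\<forall>z. U p + (norm (x - p))^2 / (2 * lam) \<le> U z + (norm (x - z))^2 / (2 * lam))"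

text \<open>Outside the ball of radius \<open>sqrt (2 * lam * U x)\<close> the penalty alone exceeds
  \<open>U x\<close>, the value of the objective at \<open>z = x\<close>, because \<open>U\<close>
  is nonnegative. So a minimiser over this compact ball is a global one.\<close>

lemma is_prox_exists:
  fixes U :: "'a::euclidean_space \<Rightarrow> real"
  assumes cont: "continuous_on UNIV U" and nn: "\<And>x. 0 \<le> U x" and lam: "lam > 0"
  shows "\<exists>p. is_prox lam U x p"
proof -
  let ?F = "\<lambda>z. U z + (norm (x - z))^2 / (2 * lam)"
  let ?r = "sqrt (2 * lam * U x)"
  have r0: "0 \<le> ?r" using lam nn[of x] by simp
  have "continuous_on (cball x ?r) U" by (rule continuous_on_subset[OF cont]) simp
  then have "continuous_on (cball x ?r) ?F"
    by (intro continuous_intros) (use lam in auto)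
  moreover have "compact (cball x ?r)" "cball x ?r \<noteq> {}" using r0 by auto
  ultimately obtain p where p: "p \<in> cball x ?r" "\<forall>z\<in>cball x ?r. ?F p \<le> ?F z"
    using continuous_attains_inf[of "cball x ?r" ?F] by blast
  have "?F p \<le> ?F z" for z
  proof (cases "z \<in> cball x ?r")
    case False
    then have "?r < norm (x - z)" by (simp add: dist_norm)
    then have "?r ^ 2 < (norm (x - z))^2" using r0 by (intro power_strict_mono) auto
    then have "2 * lam * U x < (norm (x - z))^2" using lam nn[of x] by simp
    then have "U x \<le> (norm (x - z))^2 / (2 * lam)" using lam by (simp add: field_simps)
    then have "U x \<le> ?F z" using nn[of z] by linarith
    moreover have "?F p \<le> ?F x" using p(2)[rule_format, of x] r0 by (simp only: mem_cball) simp
    ultimately show ?thesis by simp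
  qed (use p in auto)
  then show ?thesis by (auto simp: is_prox_def)
qed

text \<open>The optimality condition that \<open>(x - p) / lam\<close> is a subgradient of
  \<open>U\<close> at \<open>p\<close>, obtained without subgradients: compare \<open>p\<close> with
  \<open>p + t *\<^sub>R (z - p)\<close>, use convexity on the segment, divide by \<open>t\<close>
  and take \<open>t\<close> small.\<close>

lemma is_prox_variational:
  fixes U :: "'a::euclidean_space \<Rightarrow> real"
  assumes conv: "convex_on UNIV U" and lam: "lam > 0" and p: "is_prox lam U x p"
  shows "(x - p) \<bullet> (z - p) \<le> lam * (U z - U p)"
proof -
  let ?a = "(x - p) \<bullet> (z - p) - lam * (U z - U p)"
  have key: "?a \<le> t * (norm (z - p))^2 / 2" if t: "0 < t" "t \<le> 1" for t
  proof -
    have "U ((1 - t) *\<^sub>R p + t *\<^sub>R z) \<le> (1 - t) * U p + t * U z"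
      using conv t by (auto simp: convex_on_def)
    moreover have "(1 - t) *\<^sub>R p + t *\<^sub>R z = p + t *\<^sub>R (z - p)" by (simp add: algebra_simps)
    ultimately have 1: "U (p + t *\<^sub>R (z - p)) \<le> U p + t * (U z - U p)" by (simp add: algebra_simps)
    have 2: "(norm (x - (p + t *\<^sub>R (z - p))))^2
       = (norm (x - p))^2 - 2 * t * ((x - p) \<bullet> (z - p)) + t^2 * (norm (z - p))^2"
      unfolding power2_norm_eq_inner by (simp add: inner_simps algebra_simps power2_eq_square inner_commute)
    have "U p + (norm (x - p))^2 / (2 * lam)
       \<le> U p + t * (U z - U p) + ((norm (x - p))^2 - 2 * t * ((x - p) \<bullet> (z - p)) + t^2 * (norm (z - p))^2) / (2 * lam)"
      using p[unfolded is_prox_def, rule_format, of "p + t *\<^sub>R (z - p)"] 1 2 by simp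
    then have "0 \<le> (2 * lam * t * (U z - U p) - 2 * t * ((x - p) \<bullet> (z - p)) + t^2 * (norm (z - p))^2) / (2 * lam)"
      using lam by (simp add: add_divide_distrib diff_divide_distrib)
    then have "2 * lam * t * (U z - U p) - 2 * t * ((x - p) \<bullet> (z - p)) + t^2 * (norm (z - p))^2 \<ge> 0"
      using lam by (simp add: zero_le_divide_iff)
    then have "t * (2 * ?a) \<le> t * (t * (norm (z - p))^2)"
      by (simp add: algebra_simps power2_eq_square)
    then show ?thesis using t by (simp)
  qed
  have "?a \<le> 0"
  proof (rule ccontr)
    assume "\<not> ?a \<le> 0"
    then have a: "?a > 0" by simp
    let ?n = "(norm (z - p))^2"
    \<comment> \<open>Small enough that the quadratic error \<open>t * ?n / 2\<close> is at most
      half of \<open>?a\<close>; the \<open>+ 1\<close> covers \<open>?n = 0\<close>.\<close>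
    define t where "t = min 1 (?a / (?n + 1))"
    have n0: "?n \<ge> 0" by simp
    have "0 < t" "t \<le> 1" using a n0 by (auto simp: t_def add_nonneg_pos)
    from key[OF this] have "?a \<le> t * ?n / 2" .
    also have "t * ?n \<le> ?a / (?n + 1) * ?n" using n0 by (intro mult_right_mono) (auto simp: t_def)
    also have "\<dots> = ?a * (?n / (?n + 1))" by simp
    also have "\<dots> \<le> ?a * 1" using a n0 by (intro mult_left_mono) (auto simp: divide_le_eq_1 add_nonneg_pos)
    finally show False using a by simp
  qed
  then show ?thesis by simp
qed

text \<open>Test the variational inequality of each proximal point with the other one and add: the
  values of \<open>U\<close> cancel, and firm nonexpansiveness remains.\<close>

lemma is_prox_nonexpansive:
  fixes U :: "'a::euclidean_space \<Rightarrow> real"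
  assumes conv: "convex_on UNIV U" and lam: "lam > 0" and p: "is_prox lam U x p" "is_prox lam U y q"
  shows "norm (p - q) \<le> norm (x - y)"
proof -
  have "(x - p) \<bullet> (q - p) + (y - q) \<bullet> (p - q) \<le> 0"
    using is_prox_variational[OF conv lam p(1), of q] is_prox_variational[OF conv lam p(2), of p]
    by (simp add: algebra_simps)
  then have "(norm (p - q))^2 \<le> (x - y) \<bullet> (p - q)"
    unfolding power2_norm_eq_inner by (simp add: inner_simps algebra_simps inner_commute)
  also have "\<dots> \<le> norm (x - y) * norm (p - q)" by (rule norm_cauchy_schwarz)
  finally have "norm (p - q) * norm (p - q) \<le> norm (x - y) * norm (p - q)" by (simp add: power2_eq_square)
  then show ?thesis by (cases "norm (p - q) = 0") (auto simp: mult_le_cancel_right)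
qed

text \<open>Turns the definite description in \<open>prox\<close> into a usable minimiser;
  nonexpansiveness with equal arguments supplies the uniqueness.\<close>

lemma is_prox_prox:
  fixes U :: "'a::euclidean_space \<Rightarrow> real"
  assumes conv: "convex_on UNIV U" and cont: "continuous_on UNIV U" and nn: "\<And>x. 0 \<le> U x" and lam: "lam > 0"
  shows "is_prox lam U x (prox lam U x)"
proof -
  obtain p where p: "is_prox lam U x p" using is_prox_exists[OF cont nn lam] by metis
  have "prox lam U x = p" unfolding prox_def
  proof (rule the_equality)
    fix q assume "\<forall>z. U q + (norm (x - q))\<^sup>2 / (2 * lam) \<le> U z + (norm (x - z))\<^sup>2 / (2 * lam)"
    then have "is_prox lam U x q" by (simp add: is_prox_def)
    from is_prox_nonexpansive[OF conv lam this p] show "q = p" by simp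
  qed (use p in \<open>simp add: is_prox_def\<close>)
  with p show ?thesis by simp
qed

text \<open>Testing with \<open>z = x\<close> bounds the move by O(\<open>lam\<close>). With
  \<open>lam = \<gamma> * \<kappa>\<close>, passing between \<open>x\<close> and its proximal point
  costs only O(\<gamma>).\<close>

lemma is_prox_displacement:
  fixes U :: "'a::euclidean_space \<Rightarrow> real"
  assumes conv: "convex_on UNIV U" and lam: "lam > 0" and p: "is_prox lam U x p"
    and lip: "M-lipschitz_on UNIV U"
  shows "norm (x - p) \<le> lam * M"
proof -
  have "(norm (x - p))^2 \<le> lam * (U x - U p)"
    using is_prox_variational[OF conv lam p, of x] by (simp add: power2_norm_eq_inner)
  also have "\<dots> \<le> lam * (M * norm (x - p))"
    using lipschitz_onD[OF lip, of x p] lam by (intro mult_left_mono) (auto simp: dist_norm)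
  finally have "norm (x - p) * norm (x - p) \<le> (lam * M) * norm (x - p)" by (simp add: power2_eq_square algebra_simps)
  then show ?thesis
    using lam lipschitz_on_nonneg[OF lip]
    by (cases "norm (x - p) = 0") (auto simp: mult_le_cancel_right)
qed

text \<open>The law of cosines at \<open>p\<close>, with the square of \<open>norm (x - p)\<close>
  dropped. The gain in \<open>U\<close> is what later drives the exponential weights
  inwards.\<close>

lemma is_prox_three_point:
  fixes U :: "'a::euclidean_space \<Rightarrow> real"
  assumes conv: "convex_on UNIV U" and lam: "lam > 0" and p: "is_prox lam U x p"
  shows "(norm (p - z))^2 \<le> (norm (x - z))^2 - 2 * lam * (U p - U z)"
proof -
  have "(norm (x - z))^2 = (norm (x - p))^2 + (norm (p - z))^2 - 2 * ((x - p) \<bullet> (z - p))"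
    unfolding power2_norm_eq_inner by (simp add: inner_simps algebra_simps inner_commute)
  moreover have "0 \<le> (norm (x - p))^2" by simp
  moreover have "2 * lam * (U p - U z) = - 2 * (lam * (U z - U p))" by (simp add: algebra_simps)
  ultimately show ?thesis using is_prox_variational[OF conv lam p, of z] by linarith
qed

section \<open>Convex functions with Lipschitz gradient\<close>

lemma convex_on_gradient_ge:
  fixes V :: "'a::euclidean_space \<Rightarrow> real"
  assumes conv: "convex_on UNIV V" and der: "(V has_derivative (\<lambda>h. g \<bullet> h)) (at x)"
  shows "V y \<ge> V x + g \<bullet> (y - x)"
proof -
  let ?f = "\<lambda>t::real. V (x + t *\<^sub>R (y - x))"
  have d: "(?f has_real_derivative g \<bullet> (y - x)) (at 0)"
  proof -
    have "(?f has_derivative (\<lambda>t. g \<bullet> (t *\<^sub>R (y - x)))) (at 0)"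
      by (rule has_derivative_compose[where g=V and f="\<lambda>t. x + t *\<^sub>R (y - x)"])
         (use der in \<open>auto intro!: derivative_eq_intros\<close>)
    then show ?thesis by (simp add: has_field_derivative_def mult.commute[of _ "g \<bullet> (y - x)"])
  qed
  have "((\<lambda>t. (?f t - ?f 0) / (t - 0)) \<longlongrightarrow> g \<bullet> (y - x)) (at 0)"
    using d by (simp add: has_field_derivative_iff)
  then have lim: "((\<lambda>t. (?f t - V x) / t) \<longlongrightarrow> g \<bullet> (y - x)) (at_right 0)"
    by (auto intro: filterlim_mono[OF _ order_refl] at_within_le_at)
  have "eventually (\<lambda>t. (?f t - V x) / t \<le> V y - V x) (at_right 0)"
  proof (rule eventually_at_rightI[of 0 1])
    fix t :: real assume t: "t \<in> {0<..<1}"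
    have "V ((1 - t) *\<^sub>R x + t *\<^sub>R y) \<le> (1 - t) * V x + t * V y"
      using conv t by (auto simp: convex_on_def)
    moreover have "(1 - t) *\<^sub>R x + t *\<^sub>R y = x + t *\<^sub>R (y - x)" by (simp add: algebra_simps)
    ultimately have "?f t \<le> V x + t * (V y - V x)" by (simp add: algebra_simps)
    then show "(?f t - V x) / t \<le> V y - V x" using t by (simp add: field_simps)
  qed simp
  from tendsto_upperbound[OF lim this] show ?thesis by simp
qed

text \<open>Subtract the linear part and the parabola along the segment: what is left has a
  nonpositive derivative by Cauchy-Schwarz and the Lipschitz bound.\<close>

lemma descent_lemma:
  fixes V :: "'a::euclidean_space \<Rightarrow> real"
  assumes conv: "convex_on UNIV V" and der: "\<And>x. (V has_derivative (\<lambda>h. g x \<bullet> h)) (at x)"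
    and lip: "L-lipschitz_on UNIV g"
  shows "V y \<le> V x + g x \<bullet> (y - x) + L / 2 * (norm (y - x))^2"
proof -
  let ?f = "\<lambda>t::real. V (x + t *\<^sub>R (y - x)) - t * (g x \<bullet> (y - x)) - L / 2 * t^2 * (norm (y - x))^2"
  have d: "(?f has_real_derivative (g (x + t *\<^sub>R (y - x)) \<bullet> (y - x) - g x \<bullet> (y - x) - L * t * (norm (y - x))^2)) (at t)" for t
  proof -
    have "((\<lambda>t. V (x + t *\<^sub>R (y - x))) has_derivative (\<lambda>s. g (x + t *\<^sub>R (y - x)) \<bullet> (s *\<^sub>R (y - x)))) (at t)"
      by (rule has_derivative_compose[where g=V and f="\<lambda>t. x + t *\<^sub>R (y - x)"])
         (use der in \<open>auto intro!: derivative_eq_intros\<close>)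
    then have "((\<lambda>t. V (x + t *\<^sub>R (y - x))) has_real_derivative g (x + t *\<^sub>R (y - x)) \<bullet> (y - x)) (at t)"
      by (simp add: has_field_derivative_def mult.commute[of _ "g (x + t *\<^sub>R (y - x)) \<bullet> (y - x)"])
    then show ?thesis by (auto intro!: derivative_eq_intros)
  qed
  have "?f 1 \<le> ?f 0"
  proof (rule DERIV_nonpos_imp_nonincreasing[of 0 1 ?f])
    fix t :: real assume t: "0 \<le> t" "t \<le> 1"
    have "(g (x + t *\<^sub>R (y - x)) - g x) \<bullet> (y - x) \<le> norm (g (x + t *\<^sub>R (y - x)) - g x) * norm (y - x)"
      by (rule norm_cauchy_schwarz)
    also have "\<dots> \<le> (L * norm (t *\<^sub>R (y - x))) * norm (y - x)"
      using lipschitz_onD[OF lip, of "x + t *\<^sub>R (y - x)" x] by (intro mult_right_mono) (auto simp: dist_norm)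
    also have "\<dots> = L * t * (norm (y - x))^2" using t by (simp add: power2_eq_square)
    finally show "\<exists>y'. (?f has_real_derivative y') (at t) \<and> y' \<le> 0"
      using d[of t] by (auto simp: inner_diff_left intro!: exI)
  qed simp
  then show ?thesis by simp
qed

text \<open>Baillon-Haddad inequality. At \<open>x - e\<close> the tangent at \<open>y\<close> lies
  below \<open>V\<close> and the parabola at \<open>x\<close> above it; \<open>e\<close> makes this
  comparison as strong as possible. Adding the same estimate with \<open>x\<close> and
  \<open>y\<close> exchanged gives cocoercivity.\<close>

lemma gradient_cocoercive:
  fixes V :: "'a::euclidean_space \<Rightarrow> real"
  assumes conv: "convex_on UNIV V" and der: "\<And>x. (V has_derivative (\<lambda>h. g x \<bullet> h)) (at x)"
    and lip: "L-lipschitz_on UNIV g" and L: "L > 0"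
  shows "(norm (g x - g y))^2 \<le> L * ((g x - g y) \<bullet> (x - y))"
proof -
  have half: "V x - V y \<ge> g y \<bullet> (x - y) + (norm (g x - g y))^2 / (2 * L)" for x y
  proof -
    define e where "e = (1 / L) *\<^sub>R (g x - g y)"
    have 1: "V y + g y \<bullet> ((x - e) - y) \<le> V (x - e)" by (rule convex_on_gradient_ge[OF conv der])
    have 2: "V (x - e) \<le> V x + g x \<bullet> ((x - e) - x) + L / 2 * (norm ((x - e) - x))^2"
      by (rule descent_lemma[OF conv der lip])
    have 3: "(g x - g y) \<bullet> e = (norm (g x - g y))^2 / L"
      by (simp add: e_def power2_norm_eq_inner)
    have 4: "L / 2 * (norm ((x - e) - x))^2 = (norm (g x - g y))^2 / (2 * L)"
    proof -
      have "norm ((x - e) - x) = norm (g x - g y) / L" using L by (simp add: e_def)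
      then show ?thesis using L by (simp add: power_divide power2_eq_square[of L])
    qed
    have 5: "(norm (g x - g y))^2 / L = 2 * ((norm (g x - g y))^2 / (2 * L))" by simp
    have 6: "(g x - g y) \<bullet> e = g x \<bullet> e - g y \<bullet> e" by (rule inner_diff_left)
    have 7: "g y \<bullet> ((x - e) - y) = g y \<bullet> (x - y) - g y \<bullet> e" "g x \<bullet> ((x - e) - x) = - (g x \<bullet> e)"
      by (simp_all add: inner_diff_right)
    show ?thesis using 1 2 unfolding 4 7 using 3 5 6 by linarith
  qed
  have "(g x - g y) \<bullet> (x - y) \<ge> (norm (g x - g y))^2 / L"
  proof -
    have "(norm (g x - g y))^2 / L = 2 * ((norm (g x - g y))^2 / (2 * L))" by simp
    then show ?thesis using half[of x y] half[of y x]
      by (simp add: norm_minus_commute[of "g y"] inner_diff_left inner_diff_right)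
  qed
  then show ?thesis using L by (simp add: field_simps)
qed

text \<open>Cocoercivity turns the second order term into a multiple of the monotonicity product.
  That product stays in the bound because it is used in three ways: as nonnegative for
  nonexpansiveness, bounded below by strong convexity, and bounded below by the squared
  gradient.\<close>

lemma gradient_step_bound:
  fixes V :: "'a::euclidean_space \<Rightarrow> real"
  assumes conv: "convex_on UNIV V" and der: "\<And>x. (V has_derivative (\<lambda>h. g x \<bullet> h)) (at x)"
    and lip: "L-lipschitz_on UNIV g" and L: "L > 0" and gam: "\<gamma> \<ge> 0"
  shows "(norm ((x - \<gamma> *\<^sub>R g x) - (y - \<gamma> *\<^sub>R g y)))^2
    \<le> (norm (x - y))^2 - \<gamma> * (2 - \<gamma> * L) * ((g x - g y) \<bullet> (x - y))"
proof -
  have "(norm ((x - \<gamma> *\<^sub>R g x) - (y - \<gamma> *\<^sub>R g y)))^2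
     = (norm (x - y))^2 - 2 * \<gamma> * ((g x - g y) \<bullet> (x - y)) + \<gamma>^2 * (norm (g x - g y))^2"
    unfolding power2_norm_eq_inner by (simp add: inner_simps algebra_simps power2_eq_square inner_commute)
  also have "\<dots> \<le> (norm (x - y))^2 - 2 * \<gamma> * ((g x - g y) \<bullet> (x - y)) + \<gamma>^2 * (L * ((g x - g y) \<bullet> (x - y)))"
    using gradient_cocoercive[OF conv der lip L, of x y] by (simp add: mult_left_mono)
  finally show ?thesis by (simp add: algebra_simps power2_eq_square)
qed

lemma gradient_monotone:
  fixes V :: "'a::euclidean_space \<Rightarrow> real"
  assumes conv: "convex_on UNIV V" and der: "\<And>x. (V has_derivative (\<lambda>h. g x \<bullet> h)) (at x)"
  shows "0 \<le> (g x - g y) \<bullet> (x - y)"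
  using convex_on_gradient_ge[OF conv der[of x], of y] convex_on_gradient_ge[OF conv der[of y], of x]
  by (simp add: inner_diff_left inner_diff_right)

text \<open>The defect in m-convexity is exactly that of \<open>m / 2 * (norm x)^2\<close>.
  Subtracting this function leaves a convex one, whose gradient is monotone.\<close>

lemma gradient_strongly_monotone:
  fixes V :: "'a::euclidean_space \<Rightarrow> real"
  assumes conv: "m_convex m V" and der: "\<And>x. (V has_derivative (\<lambda>h. g x \<bullet> h)) (at x)"
  shows "m * (norm (x - y))^2 \<le> (g x - g y) \<bullet> (x - y)"
proof -
  let ?h = "\<lambda>x. V x - m / 2 * (norm x)^2"
  have "convex_on UNIV ?h"
  proof (rule convex_onI)
    fix t :: real and x y :: 'a assume t: "0 < t" "t < 1"
    have "V (t *\<^sub>R y + (1 - t) *\<^sub>R x) \<le> t * V y + (1 - t) * V x - (m / 2) * t * (1 - t) * (norm (y - x))^2"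
      using conv t unfolding m_convex_def by (metis less_eq_real_def)
    moreover have "(norm (t *\<^sub>R y + (1 - t) *\<^sub>R x))^2 = t * (norm y)^2 + (1 - t) * (norm x)^2 - t * (1 - t) * (norm (y - x))^2"
      unfolding power2_norm_eq_inner by (simp add: inner_simps algebra_simps power2_eq_square inner_commute)
    ultimately have "?h (t *\<^sub>R y + (1 - t) *\<^sub>R x) \<le> t * V y + (1 - t) * V x - (m / 2) * t * (1 - t) * (norm (y - x))^2
       - m / 2 * (t * (norm y)^2 + (1 - t) * (norm x)^2 - t * (1 - t) * (norm (y - x))^2)"
      by simp
    also have "\<dots> = (1 - t) * ?h x + t * ?h y" by (simp add: field_simps)
    finally show "?h ((1 - t) *\<^sub>R x + t *\<^sub>R y) \<le> (1 - t) * ?h x + t * ?h y"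
      by (simp add: add.commute)
  qed simp
  moreover have "(?h has_derivative (\<lambda>h. (g x - m *\<^sub>R x) \<bullet> h)) (at x)" for x
    unfolding power2_norm_eq_inner
    by (rule derivative_eq_intros der refl | simp add: inner_simps inner_commute algebra_simps)+
  ultimately have "0 \<le> ((g x - m *\<^sub>R x) - (g y - m *\<^sub>R y)) \<bullet> (x - y)"
    by (rule gradient_monotone)
  then show ?thesis unfolding power2_norm_eq_inner by (simp add: inner_simps algebra_simps)
qed

subsection \<open>Gaussian chains and the Harnack inequality\<close>

abbreviation markov_kernel :: "('a::topological_space \<Rightarrow> 'b::topological_space measure) \<Rightarrow> bool" where
  "markov_kernel K \<equiv> K \<in> borel \<rightarrow>\<^sub>M prob_algebra borel"

lemma kiter_measurable:
  fixes K :: "'a::euclidean_space \<Rightarrow> 'a measure"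
  assumes K: "K \<in> borel \<rightarrow>\<^sub>M prob_algebra borel"
  shows "kiter K n \<in> borel \<rightarrow>\<^sub>M prob_algebra borel"
proof (induction n)
  case 0
  then show ?case by simp
next
  case (Suc n)
  show ?case unfolding kiter.simps
    by (rule measurable_bind_prob_space[OF Suc K])
qed

lemma kernel_space:
  assumes K: "K \<in> borel \<rightarrow>\<^sub>M prob_algebra (borel :: 'a::topological_space measure)"
  shows "K x \<in> space (prob_algebra borel)" "prob_space (K x)" "sets (K x) = sets borel" "space (K x) = UNIV"
proof -
  show *: "K x \<in> space (prob_algebra borel)" using measurable_space[OF K, of x] by simp
  then show "prob_space (K x)" "sets (K x) = sets borel" by (auto simp: space_prob_algebra)
  then show "space (K x) = UNIV" using sets_eq_imp_space_eq[of "K x" borel] by simp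
qed

lemma nn_integral_prob_bind:
  assumes M: "M \<in> space (prob_algebra borel)" and K: "K \<in> borel \<rightarrow>\<^sub>M prob_algebra borel"
    and f: "f \<in> borel_measurable borel"
  shows "(\<integral>\<^sup>+y. f y \<partial>bind M K) = (\<integral>\<^sup>+u. \<integral>\<^sup>+y. f y \<partial>K u \<partial>M)"
proof (rule nn_integral_bind[OF f])
  have "sets M = sets borel" using M by (simp add: space_prob_algebra)
  then show "K \<in> M \<rightarrow>\<^sub>M subprob_algebra borel"
    using measurable_prob_algebraD[OF K] by (simp cong: measurable_cong_sets)
qed

lemma integral_prob_bind:
  fixes f :: "'a::topological_space \<Rightarrow> real"
  assumes M: "M \<in> space (prob_algebra borel)" and K: "K \<in> borel \<rightarrow>\<^sub>M prob_algebra borel"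
    and f: "f \<in> borel_measurable borel" and b: "\<And>x. \<bar>f x\<bar> \<le> B"
  shows "(\<integral>y. f y \<partial>bind M K) = (\<integral>u. \<integral>y. f y \<partial>K u \<partial>M)"
proof (rule integral_bind[OF f, where B'=1])
  have s: "sets M = sets borel" and p: "prob_space M" using M by (auto simp: space_prob_algebra)
  show "K \<in> M \<rightarrow>\<^sub>M subprob_algebra borel"
    using measurable_prob_algebraD[OF K] s by (simp cong: measurable_cong_sets)
  show "finite_measure M" using p by (simp add: prob_space.finite_measure)
  show "AE x in M. emeasure (K x) (space (K x)) \<le> ennreal 1"
    using kernel_space(2)[OF K] by (simp add: prob_space.emeasure_space_1)
qed (use b in auto)

lemma measurable_kernel_nn_integral:
  assumes K: "K \<in> borel \<rightarrow>\<^sub>M prob_algebra borel" and f: "f \<in> borel_measurable borel"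
  shows "(\<lambda>x. \<integral>\<^sup>+y. f y \<partial>K x) \<in> borel_measurable borel"
  using measurable_compose[OF measurable_prob_algebraD[OF K] nn_integral_measurable_subprob_algebra[OF f]] by simp

lemma measurable_kernel_integral:
  fixes f :: "'a::topological_space \<Rightarrow> real"
  assumes K: "K \<in> borel \<rightarrow>\<^sub>M prob_algebra borel" and f: "f \<in> borel_measurable borel"
  shows "(\<lambda>x. \<integral>y. f y \<partial>K x) \<in> borel_measurable borel"
  using measurable_compose[OF measurable_prob_algebraD[OF K] integral_measurable_subprob_algebra[OF f]] by simp

lemma bind_prob_assoc:
  assumes M: "M \<in> space (prob_algebra borel)" and K: "K \<in> borel \<rightarrow>\<^sub>M prob_algebra borel"
    and N: "N \<in> borel \<rightarrow>\<^sub>M prob_algebra borel"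
  shows "bind (bind M K) N = bind M (\<lambda>x. bind (K x) N)"
proof (rule bind_assoc)
  have "sets M = sets borel" using M by (simp add: space_prob_algebra)
  then show "K \<in> M \<rightarrow>\<^sub>M subprob_algebra borel"
    using measurable_prob_algebraD[OF K] by (simp cong: measurable_cong_sets)
qed (rule measurable_prob_algebraD[OF N])

lemma kiter_add:
  fixes K :: "'a::euclidean_space \<Rightarrow> 'a measure"
  assumes K: "K \<in> borel \<rightarrow>\<^sub>M prob_algebra borel"
  shows "kiter K (n + m) x = bind (kiter K n x) (kiter K m)"
proof (induction m)
  case 0
  have "kiter K n x \<bind> return borel = kiter K n x"
    by (rule bind_return'') (simp add: kernel_space(3)[OF kiter_measurable[OF K]])
  moreover have "kiter K 0 = return borel" by (rule ext) simp
  ultimately show ?case by simp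
next
  case (Suc m)
  have "kiter K (Suc m) = (\<lambda>x. bind (kiter K m x) K)" by (rule ext) simp
  then show ?case
    using Suc bind_prob_assoc[OF kernel_space(1)[OF kiter_measurable[OF K]] kiter_measurable[OF K] K, of n x m]
    by simp
qed

lemma kiter_1:
  fixes K :: "'a::euclidean_space \<Rightarrow> 'a measure"
  assumes K: "K \<in> borel \<rightarrow>\<^sub>M prob_algebra borel"
  shows "kiter K (Suc 0) x = K x"
  using bind_return[OF measurable_prob_algebraD[OF K], of x] by simp

section \<open>Gaussian measures on Euclidean space\<close>

definition gdens :: "'a::euclidean_space \<Rightarrow> real \<Rightarrow> 'a \<Rightarrow> real" where
  "gdens mu s y = (2 * pi * s) powr (- real DIM('a) / 2) * exp (- ((norm (y - mu))^2) / (2 * s))"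

lemma gaussian_eq_gdens: "gaussian mu s = density lborel (\<lambda>y. ennreal (gdens mu s y))"
  by (simp add: gaussian_def gdens_def)

lemma gdens_pos: "s > 0 \<Longrightarrow> gdens mu s y > 0"
  by (simp add: gdens_def)

lemma gdens_measurable [measurable]: "gdens mu s \<in> borel_measurable borel"
  unfolding gdens_def by measurable

lemma sets_gaussian [simp, measurable_cong]: "sets (gaussian mu s) = sets borel"
  by (simp add: gaussian_def)

text \<open>Reduces the normalisation in dimension \<open>DIM('a)\<close> to the one-dimensional
  normal density.\<close>

lemma gdens_prod:
  fixes mu :: "'a::euclidean_space"
  assumes s: "s > 0"
  shows "gdens mu s y = (\<Prod>b\<in>Basis. normal_density (mu \<bullet> b) (sqrt s) (y \<bullet> b))"
proof -
  have n: "(norm (y - mu))^2 = (\<Sum>b\<in>Basis. (y \<bullet> b - mu \<bullet> b)^2)"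
    unfolding power2_norm_eq_inner by (subst euclidean_inner) (simp add: inner_diff_left power2_eq_square)
  have a: "2 * pi * s > 0" using s by simp
  have "1 / sqrt (2 * pi * s) = (2 * pi * s) powr (- (1/2))"
    unfolding powr_minus using a by (subst powr_half_sqrt) (auto simp: inverse_eq_divide)
  then have "(1 / sqrt (2 * pi * s)) ^ DIM('a) = ((2 * pi * s) powr (- (1/2))) powr real DIM('a)"
    using powr_realpow[of "(2 * pi * s) powr (- (1/2))" "DIM('a)"] a
    by (simp only: powr_gt_zero)
  also have "\<dots> = (2 * pi * s) powr (- real DIM('a) / 2)"
    unfolding powr_powr by simp
  finally have c: "(1 / sqrt (2 * pi * s)) ^ DIM('a) = (2 * pi * s) powr (- real DIM('a) / 2)" .
  have "(\<Prod>b\<in>(Basis::'a set). normal_density (mu \<bullet> b) (sqrt s) (y \<bullet> b))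
     = (1 / sqrt (2 * pi * s)) ^ DIM('a) * (\<Prod>b\<in>Basis. exp (- ((y \<bullet> b - mu \<bullet> b)^2) / (2 * s)))"
    using s by (simp add: normal_density_def prod.distrib prod_dividef power_divide)
  also have "(\<Prod>b\<in>Basis. exp (- ((y \<bullet> b - mu \<bullet> b)^2) / (2 * s))) = exp (- ((norm (y - mu))^2) / (2 * s))"
    unfolding n by (simp add: exp_sum[symmetric] sum_negf sum_divide_distrib)
  finally show ?thesis unfolding c gdens_def by simp
qed

lemma nn_integral_gdens:
  fixes mu :: "'a::euclidean_space"
  assumes s: "s > 0"
  shows "(\<integral>\<^sup>+y. ennreal (gdens mu s y) \<partial>lborel) = 1"
proof -
  have 1: "(\<integral>\<^sup>+t. ennreal (normal_density (mu \<bullet> b) (sqrt s) t) \<partial>lborel) = 1" for b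
  proof -
    interpret prob_space "density lborel (normal_density (mu \<bullet> b) (sqrt s))"
      using s by (intro prob_space_normal_density) simp
    from emeasure_space_1 show ?thesis by (simp add: emeasure_density)
  qed
  have "(\<integral>\<^sup>+y. ennreal (gdens mu s y) \<partial>lborel)
     = (\<integral>\<^sup>+y. (\<Prod>b\<in>Basis. ennreal (normal_density (mu \<bullet> b) (sqrt s) (y \<bullet> b))) \<partial>lborel)"
    by (simp add: gdens_prod[OF s] prod_ennreal normal_density_nonneg)
  also have "\<dots> = (\<Prod>b\<in>(Basis::'a set). (\<integral>\<^sup>+t. ennreal (normal_density (mu \<bullet> b) (sqrt s) t) \<partial>lborel))"
    by (rule nn_integral_lborel_prod) auto
  finally show ?thesis by (simp add: 1)
qed

lemma prob_space_gaussian: "s > 0 \<Longrightarrow> prob_space (gaussian mu s)"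
  by (rule prob_spaceI) (simp add: gaussian_eq_gdens emeasure_density nn_integral_gdens)

lemma nn_integral_gaussian:
  "f \<in> borel_measurable borel \<Longrightarrow> (\<integral>\<^sup>+y. f y \<partial>gaussian mu s) = (\<integral>\<^sup>+y. ennreal (gdens mu s y) * f y \<partial>lborel)"
  unfolding gaussian_eq_gdens by (subst nn_integral_density) auto

lemma nn_integral_lborel_translate:
  fixes c :: "'a::euclidean_space"
  assumes [measurable]: "f \<in> borel_measurable borel"
  shows "(\<integral>\<^sup>+y. f y \<partial>lborel) = (\<integral>\<^sup>+y. f (c + y) \<partial>lborel)"
  by (subst lborel_distr_plus[of c, symmetric]) (simp add: nn_integral_distr)

lemma gaussian_eq_distr:
  fixes mu :: "'a::euclidean_space"
  shows "gaussian mu s = distr (gaussian 0 s) borel (\<lambda>z. mu + z)"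
proof (rule measure_eqI)
  fix A assume "A \<in> sets (gaussian mu s)"
  then have [measurable]: "A \<in> sets borel" by simp
  have "emeasure (gaussian mu s) A = (\<integral>\<^sup>+y. ennreal (gdens mu s y) * indicator A y \<partial>lborel)"
    by (simp add: gaussian_eq_gdens emeasure_density)
  also have "\<dots> = (\<integral>\<^sup>+z. ennreal (gdens mu s (mu + z)) * indicator A (mu + z) \<partial>lborel)"
    by (subst nn_integral_lborel_translate[of _ mu]) auto
  also have "\<dots> = (\<integral>\<^sup>+z. ennreal (gdens 0 s z) * indicator ((\<lambda>z. mu + z) -` A) z \<partial>lborel)"
    by (simp add: gdens_def indicator_def)
  also have "\<dots> = emeasure (gaussian 0 s) ((\<lambda>z. mu + z) -` A)"
    by (simp add: gaussian_eq_gdens emeasure_density measurable_sets_borel[of "\<lambda>z. mu + z" borel])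
  also have "\<dots> = emeasure (distr (gaussian 0 s) borel (\<lambda>z. mu + z)) A"
    by (subst emeasure_distr) (auto simp: gaussian_def)
  finally show "emeasure (gaussian mu s) A = emeasure (distr (gaussian 0 s) borel (\<lambda>z. mu + z)) A" .
qed simp

text \<open>Every Gaussian is a translate of the centred one, so the kernel is a push-forward of a
  fixed measure under a jointly measurable map.\<close>

lemma gaussian_kernel_measurable:
  fixes \<Phi> :: "'a::euclidean_space \<Rightarrow> 'a"
  assumes s: "s > 0" and [measurable]: "\<Phi> \<in> borel_measurable borel"
  shows "(\<lambda>x. gaussian (\<Phi> x) s) \<in> borel \<rightarrow>\<^sub>M prob_algebra borel"
  unfolding gaussian_eq_distr[of "\<Phi> _"]
  by (rule measurable_distr_prob_space2[where M=borel])
     (auto simp: space_prob_algebra prob_space_gaussian[OF s])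

text \<open>Completing the square: tilting by the exponential of a quadratic gives, up to the stated
  constant, another Gaussian, with variance \<open>s * v\<close> and mean shifted by
  \<open>(s * v) *\<^sub>R w\<close>. The critical coefficient is \<open>r = 1 / (2 * s)\<close>,
  where \<open>v\<close> blows up.\<close>

lemma nn_integral_gaussian_exp_quadratic:
  fixes mu w :: "'a::euclidean_space"
  assumes s: "s > 0" and r: "2 * r * s < 1"
  defines "v \<equiv> 1 / (1 - 2 * r * s)"
  shows "(\<integral>\<^sup>+y. ennreal (exp (w \<bullet> (y - mu) + r * (norm (y - mu))^2)) \<partial>gaussian mu s)
     = ennreal (v powr (real DIM('a) / 2) * exp (v * s * (norm w)^2 / 2))"
proof -
  have v: "v > 0" using r by (simp add: v_def)
  have r': "r = (1 - 1 / v) / (2 * s)" using s r by (simp add: v_def)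
  have pt: "gdens mu s y * exp (w \<bullet> (y - mu) + r * (norm (y - mu))^2)
    = (v powr (real DIM('a) / 2) * exp (v * s * (norm w)^2 / 2)) * gdens (mu + (s * v) *\<^sub>R w) (s * v) y" for y
  proof -
    let ?h = "y - mu"
    have n: "(norm (y - (mu + (s * v) *\<^sub>R w)))^2 = (norm ?h)^2 - 2 * (s * v) * (w \<bullet> ?h) + (s * v)^2 * (norm w)^2"
    proof -
      have "y - (mu + (s * v) *\<^sub>R w) = ?h - (s * v) *\<^sub>R w" by simp
      then show ?thesis unfolding power2_norm_eq_inner
        by (simp only:) (simp add: inner_simps inner_commute power2_eq_square algebra_simps del: diff_diff_eq)
    qed
    have e: "- ((norm ?h)^2) / (2 * s) + (w \<bullet> ?h + r * (norm ?h)^2)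
        = v * s * (norm w)^2 / 2 + - ((norm (y - (mu + (s * v) *\<^sub>R w)))^2) / (2 * (s * v))"
      unfolding n r' using s v by (simp add: field_simps power2_eq_square)
    have "(2 * pi * (s * v)) powr (- real DIM('a) / 2) = (2 * pi * s) powr (- real DIM('a) / 2) * v powr (- real DIM('a) / 2)"
      using s v by (simp add: powr_mult[symmetric] mult.assoc)
    then have B: "v powr (real DIM('a) / 2) * (2 * pi * (s * v)) powr (- real DIM('a) / 2) = (2 * pi * s) powr (- real DIM('a) / 2)"
      using v by (simp add: powr_minus)
    have E: "exp (- ((norm ?h)^2) / (2 * s)) * exp (w \<bullet> ?h + r * (norm ?h)^2)
       = exp (v * s * (norm w)^2 / 2) * exp (- ((norm (y - (mu + (s * v) *\<^sub>R w)))^2) / (2 * (s * v)))"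
      unfolding exp_add[symmetric] e ..
    have alg: "b * e1 * e2 = p * e3 * (a * e4)" if "p * a = b" "e1 * e2 = e3 * e4" for a b p e1 e2 e3 e4 :: real
    proof -
      have "b * (e1 * e2) = (p * a) * (e3 * e4)" using that by simp
      then show ?thesis by (simp only: mult_ac)
    qed
    show ?thesis unfolding gdens_def by (rule alg[OF B E])
  qed
  have "(\<integral>\<^sup>+y. ennreal (exp (w \<bullet> (y - mu) + r * (norm (y - mu))^2)) \<partial>gaussian mu s)
     = (\<integral>\<^sup>+y. ennreal (gdens mu s y * exp (w \<bullet> (y - mu) + r * (norm (y - mu))^2)) \<partial>lborel)"
    by (simp add: nn_integral_gaussian ennreal_mult'[OF less_imp_le[OF gdens_pos[OF s]]])
  also have "\<dots> = (\<integral>\<^sup>+y. ennreal (v powr (real DIM('a) / 2) * exp (v * s * (norm w)^2 / 2)) * ennreal (gdens (mu + (s * v) *\<^sub>R w) (s * v) y) \<partial>lborel)"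
    unfolding pt using v by (simp add: ennreal_mult')
  also have "\<dots> = ennreal (v powr (real DIM('a) / 2) * exp (v * s * (norm w)^2 / 2))"
    using s v by (simp add: nn_integral_cmult nn_integral_gdens)
  finally show ?thesis .
qed

text \<open>Of the discrepancy \<open>mu - nu\<close> of the two means the fraction \<open>1 - t\<close> is passed on to the integrands
through \<open>HG\<close>; the fraction \<open>t\<close> is removed at once by comparing the densities of the Gaussians centred at
\<open>nu + t (mu - nu)\<close> and \<open>nu\<close> with Cauchy-Schwarz, at the price \<open>t\<^sup>2 |mu - nu|\<^sup>2 / s\<close> in the exponent.\<close>

lemma gaussian_harnack:
  fixes mu nu :: "'a::euclidean_space"
  assumes s: "s > 0" and [measurable]: "H \<in> borel_measurable borel" "G \<in> borel_measurable borel"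
    and HG: "\<And>u. (H u)^2 \<le> ennreal (exp c) * G (u - (1 - t) *\<^sub>R (mu - nu))"
  shows "(\<integral>\<^sup>+u. H u \<partial>gaussian mu s)^2 \<le> ennreal (exp (c + t^2 * (norm (mu - nu))^2 / s)) * (\<integral>\<^sup>+u. G u \<partial>gaussian nu s)"
proof -
  define k where "k = t *\<^sub>R (mu - nu)"
  define d where "d = (1 - t) *\<^sub>R (mu - nu)"
  have dk: "d + nu + k = mu" by (simp add: d_def k_def algebra_simps)
  \<comment> \<open>Splits the translated density so that \<open>f\<close> squared is integrated
    against the Gaussian at \<open>nu\<close>, while \<open>g\<close> carries the density ratio. By
    \<open>g2\<close> the square of \<open>g\<close> is a multiple of the Gaussian density centred
    at \<open>nu + 2 *\<^sub>R k\<close>, so it integrates to exactly the price of the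
    shift.\<close>
  define f where "f = (\<lambda>v. H (d + v) * ennreal (sqrt (gdens nu s v)))"
  define g where "g = (\<lambda>v. ennreal (gdens (nu + k) s v / sqrt (gdens nu s v)))"
  have [measurable]: "f \<in> borel_measurable lborel" "g \<in> borel_measurable lborel"
    unfolding f_def g_def by measurable
  have fg: "ennreal (gdens mu s (d + v)) * H (d + v) = f v * g v" for v
  proof -
    have "gdens mu s (d + v) = gdens (nu + k) s v"
      unfolding gdens_def by (simp add: dk[symmetric] algebra_simps)
    also have "\<dots> = sqrt (gdens nu s v) * (gdens (nu + k) s v / sqrt (gdens nu s v))"
      using gdens_pos[OF s, of nu v] by simp
    finally have E: "gdens mu s (d + v) = sqrt (gdens nu s v) * (gdens (nu + k) s v / sqrt (gdens nu s v))" .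
    have "ennreal (gdens mu s (d + v)) = ennreal (sqrt (gdens nu s v)) * ennreal (gdens (nu + k) s v / sqrt (gdens nu s v))"
      unfolding E using gdens_pos[OF s, of nu v] by (intro ennreal_mult') simp
    then show ?thesis unfolding f_def g_def by (simp only: mult_ac)
  qed
  have f2: "f v ^ 2 \<le> ennreal (exp c) * (ennreal (gdens nu s v) * G v)" for v
  proof -
    have "f v ^ 2 = H (d + v) ^ 2 * ennreal (gdens nu s v)"
      using gdens_pos[OF s, of nu v] by (simp add: f_def power_mult_distrib ennreal_power)
    also have "\<dots> \<le> (ennreal (exp c) * G v) * ennreal (gdens nu s v)"
      using HG[of "d + v"] by (intro mult_right_mono) (auto simp: d_def)
    finally show ?thesis by (simp add: mult_ac)
  qed
  have g2: "g v ^ 2 = ennreal (exp ((norm k)^2 / s)) * ennreal (gdens (nu + 2 *\<^sub>R k) s v)" for v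
  proof -
    let ?C = "(2 * pi * s) powr (- real DIM('a) / 2)"
    have C: "?C > 0" using s by simp
    have n1: "(norm (v - (nu + k)))^2 = (norm (v - nu))^2 - 2 * (k \<bullet> (v - nu)) + (norm k)^2"
      unfolding power2_norm_eq_inner diff_diff_eq[symmetric]
      by (simp add: inner_diff_left inner_diff_right inner_commute)
    have n2: "(norm (v - (nu + 2 *\<^sub>R k)))^2 = (norm (v - nu))^2 - 4 * (k \<bullet> (v - nu)) + 4 * (norm k)^2"
      unfolding power2_norm_eq_inner diff_diff_eq[symmetric]
      by (simp add: inner_diff_left inner_diff_right inner_commute)
    have "(gdens (nu + k) s v)^2 = exp ((norm k)^2 / s) * gdens (nu + 2 *\<^sub>R k) s v * gdens nu s v"
    proof -
      have "exp (- ((norm (v - (nu + k)))^2) / (2 * s)) * exp (- ((norm (v - (nu + k)))^2) / (2 * s))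
        = exp ((norm k)^2 / s) * exp (- ((norm (v - (nu + 2 *\<^sub>R k)))^2) / (2 * s)) * exp (- ((norm (v - nu))^2) / (2 * s))"
        unfolding exp_add[symmetric] n1 n2 using s by (simp add: field_simps)
      then show ?thesis unfolding gdens_def power2_eq_square[of "_ * _"] by (simp only: mult_ac)
    qed
    then have "(gdens (nu + k) s v / sqrt (gdens nu s v))^2 = exp ((norm k)^2 / s) * gdens (nu + 2 *\<^sub>R k) s v"
      using gdens_pos[OF s, of nu v] by (simp add: power_divide)
    moreover have "0 \<le> gdens (nu + k) s v / sqrt (gdens nu s v)"
      using gdens_pos[OF s, of "nu + k" v] gdens_pos[OF s, of nu v] by simp
    ultimately show ?thesis unfolding g_def by (simp add: ennreal_power ennreal_mult')
  qed
  have "(\<integral>\<^sup>+u. H u \<partial>gaussian mu s) = (\<integral>\<^sup>+v. f v * g v \<partial>lborel)"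
    by (simp add: nn_integral_gaussian fg[symmetric] nn_integral_lborel_translate[of "\<lambda>y. ennreal (gdens mu s y) * H y" d])
  then have "(\<integral>\<^sup>+u. H u \<partial>gaussian mu s)^2 \<le> (\<integral>\<^sup>+v. f v ^ 2 \<partial>lborel) * (\<integral>\<^sup>+v. g v ^ 2 \<partial>lborel)"
    using Cauchy_Schwarz_nn_integral[of f lborel g] by simp
  also have "(\<integral>\<^sup>+v. f v ^ 2 \<partial>lborel) \<le> ennreal (exp c) * (\<integral>\<^sup>+u. G u \<partial>gaussian nu s)"
  proof -
    have "(\<integral>\<^sup>+v. f v ^ 2 \<partial>lborel) \<le> (\<integral>\<^sup>+v. ennreal (exp c) * (ennreal (gdens nu s v) * G v) \<partial>lborel)"
      by (intro nn_integral_mono f2)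
    then show ?thesis by (simp add: nn_integral_gaussian nn_integral_cmult)
  qed
  also have "(\<integral>\<^sup>+v. g v ^ 2 \<partial>lborel) = ennreal (exp ((norm k)^2 / s))"
    unfolding g2 using s by (simp add: nn_integral_cmult nn_integral_gdens)
  also have "ennreal (exp c) * (\<integral>\<^sup>+u. G u \<partial>gaussian nu s) * ennreal (exp ((norm k)^2 / s))
     = ennreal (exp (c + t^2 * (norm (mu - nu))^2 / s)) * (\<integral>\<^sup>+u. G u \<partial>gaussian nu s)"
    by (simp add: k_def power_mult_distrib exp_add ennreal_mult' mult_ac)
  finally show ?thesis by (simp add: mult_right_mono)
qed

text \<open>Split off the first step. The induction hypothesis is used for \<open>u\<close> and
  \<open>u - (1 - t) *\<^sub>R (\<Phi> x - \<Phi> y)\<close>, whose distance does not depend on the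
  random \<open>u\<close>, so the cost is deterministic. At least one step is required: distinct
  point masses at time 0 admit no comparison.\<close>

lemma kiter_harnack:
  fixes \<Phi> :: "'a::euclidean_space \<Rightarrow> 'a"
  assumes s: "s > 0" and ne: "\<And>x y. norm (\<Phi> x - \<Phi> y) \<le> norm (x - y)"
    and K: "K = (\<lambda>x. gaussian (\<Phi> x) s)" "K \<in> borel \<rightarrow>\<^sub>M prob_algebra borel"
    and f: "f \<in> borel_measurable borel"
  shows "(\<integral>\<^sup>+u. f u \<partial>kiter K (Suc n) x)^2
     \<le> ennreal (exp ((norm (x - y))^2 / (s * real (Suc n)))) * (\<integral>\<^sup>+u. (f u)^2 \<partial>kiter K (Suc n) y)"
proof (induction n arbitrary: x y)
  have [measurable]: "f \<in> borel_measurable borel" by fact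
  case 0
  have "(\<integral>\<^sup>+u. f u \<partial>gaussian (\<Phi> x) s)^2
      \<le> ennreal (exp (0 + 1^2 * (norm (\<Phi> x - \<Phi> y))^2 / s)) * (\<integral>\<^sup>+u. (f u)^2 \<partial>gaussian (\<Phi> y) s)"
    by (rule gaussian_harnack[OF s]) auto
  also have "\<dots> \<le> ennreal (exp ((norm (x - y))^2 / s)) * (\<integral>\<^sup>+u. (f u)^2 \<partial>gaussian (\<Phi> y) s)"
    using s ne[of x y] by (intro mult_right_mono ennreal_leI) (auto simp: divide_right_mono)
  finally show ?case unfolding kiter_1[OF K(2)] unfolding K(1) by simp
next
  have [measurable]: "f \<in> borel_measurable borel" by fact
  case (Suc n)
  define N where "N = real (Suc n)"
  have N: "N > 0" "real (Suc (Suc n)) = N + 1" by (auto simp: N_def)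
  \<comment> \<open>spreads the discrepancy evenly over the steps: the costs add up to \<open>1 / (N + 1)\<close>\<close>
  define t where "t = 1 / (N + 1)"
  have t1: "1 - t = N / (N + 1)" using N by (simp add: t_def field_simps)
  define c where "c = (1 - t)^2 * (norm (\<Phi> x - \<Phi> y))^2 / (s * N)"
  define H where "H = (\<lambda>u. \<integral>\<^sup>+z. f z \<partial>kiter K (Suc n) u)"
  define G where "G = (\<lambda>u. \<integral>\<^sup>+z. (f z)^2 \<partial>kiter K (Suc n) u)"
  have m: "H \<in> borel_measurable borel" "G \<in> borel_measurable borel"
    unfolding H_def G_def by (intro measurable_kernel_nn_integral kiter_measurable K(2); measurable)+
  have eq: "(\<integral>\<^sup>+u. h u \<partial>kiter K (Suc (Suc n)) x) = (\<integral>\<^sup>+u. \<integral>\<^sup>+z. h z \<partial>kiter K (Suc n) u \<partial>gaussian (\<Phi> x) s)"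
    if "h \<in> borel_measurable borel" for h x
    using kiter_add[OF K(2), of "Suc 0" "Suc n" x] nn_integral_prob_bind[OF kernel_space(1)[OF K(2)] kiter_measurable[OF K(2)] that, of x "Suc n"]
    unfolding kiter_1[OF K(2)] by (simp add: K(1))
  have HG: "(H u)^2 \<le> ennreal (exp c) * G (u - (1 - t) *\<^sub>R (\<Phi> x - \<Phi> y))" for u
  proof -
    have "(norm (u - (u - (1 - t) *\<^sub>R (\<Phi> x - \<Phi> y))))^2 / (s * real (Suc n)) = c"
      by (simp add: c_def N_def power_mult_distrib)
    then show ?thesis using Suc.IH[of u "u - (1 - t) *\<^sub>R (\<Phi> x - \<Phi> y)"] by (simp add: H_def G_def)
  qed
  have "(\<integral>\<^sup>+u. H u \<partial>gaussian (\<Phi> x) s)^2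
      \<le> ennreal (exp (c + t^2 * (norm (\<Phi> x - \<Phi> y))^2 / s)) * (\<integral>\<^sup>+u. G u \<partial>gaussian (\<Phi> y) s)"
    by (rule gaussian_harnack[OF s m HG])
  also have "c + t^2 * (norm (\<Phi> x - \<Phi> y))^2 / s = (norm (\<Phi> x - \<Phi> y))^2 / (s * (N + 1))"
  proof -
    have "(1 - t)^2 / N + t^2 = 1 / (N + 1)"
    proof -
      have "(1 - t)^2 / N = N / (N + 1)^2" unfolding t1 using N(1) by (simp add: power_divide power2_eq_square[of N])
      moreover have "t^2 = 1 / (N + 1)^2" by (simp add: t_def power_divide)
      ultimately have "(1 - t)^2 / N + t^2 = (N + 1) / (N + 1)^2" by (simp add: add_divide_distrib)
      then show ?thesis using N(1) by (simp add: power2_eq_square)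
    qed
    then have "((1 - t)^2 / N + t^2) * ((norm (\<Phi> x - \<Phi> y))^2 / s) = 1 / (N + 1) * ((norm (\<Phi> x - \<Phi> y))^2 / s)" by simp
    then show ?thesis by (simp add: c_def add_divide_distrib distrib_left distrib_right mult_ac)
  qed
  also have "ennreal (exp \<dots>) * (\<integral>\<^sup>+u. G u \<partial>gaussian (\<Phi> y) s)
     \<le> ennreal (exp ((norm (x - y))^2 / (s * (N + 1)))) * (\<integral>\<^sup>+u. G u \<partial>gaussian (\<Phi> y) s)"
    using s N ne[of x y] by (intro mult_right_mono ennreal_leI) (auto simp: divide_right_mono)
  finally show ?case unfolding N(2) by (simp add: eq H_def G_def del: kiter.simps)
qed

subsection \<open>Harris contraction\<close>

lemma prob_space_kiter:
  fixes K :: "'a::euclidean_space \<Rightarrow> 'a measure"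
  assumes K: "K \<in> borel \<rightarrow>\<^sub>M prob_algebra borel"
  shows "prob_space (kiter K n x)" "sets (kiter K n x) = sets borel" "space (kiter K n x) = UNIV"
  using kernel_space[OF kiter_measurable[OF K]] by auto

lemma (in prob_space) integrable_bounded:
  fixes f :: "'a \<Rightarrow> real"
  assumes "f \<in> borel_measurable M" "\<And>x. \<bar>f x\<bar> \<le> C"
  shows "integrable M f"
  by (rule integrable_const_bound[of _ C]) (use assms in auto)

lemma (in prob_space) abs_integral_le:
  fixes f g :: "'a \<Rightarrow> real"
  assumes f: "f \<in> borel_measurable M" and g: "integrable M g" and le: "\<And>x. \<bar>f x\<bar> \<le> g x" and G: "(\<integral>x. g x \<partial>M) \<le> G"
  shows "\<bar>\<integral>x. f x \<partial>M\<bar> \<le> G"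
proof -
  have "\<bar>\<integral>x. f x \<partial>M\<bar> \<le> (\<integral>x. \<bar>f x\<bar> \<partial>M)" by (rule integral_abs_bound)
  also have "\<dots> \<le> (\<integral>x. g x \<partial>M)"
  proof (rule integral_mono)
    show "integrable M (\<lambda>x. \<bar>f x\<bar>)"
      by (rule Bochner_Integration.integrable_bound[OF g]) (use f order_trans[OF le abs_ge_self] in auto)
  qed (use g le in auto)
  finally show ?thesis using G by simp
qed

lemma (in prob_space) abs_integral_le_const:
  fixes f :: "'a \<Rightarrow> real"
  assumes f: "f \<in> borel_measurable M" and le: "\<And>x. \<bar>f x\<bar> \<le> C"
  shows "\<bar>\<integral>x. f x \<partial>M\<bar> \<le> C"
  by (rule abs_integral_le[OF f, of "\<lambda>_. C"]) (use le in \<open>auto simp: prob_space\<close>)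

lemma
  fixes K :: "'a::euclidean_space \<Rightarrow> 'a measure" and f :: "'a \<Rightarrow> real"
  assumes K: "markov_kernel K" and f: "f \<in> borel_measurable borel" "\<And>x. \<bar>f x\<bar> \<le> D"
  shows kiter_integral_measurable: "(\<lambda>u. \<integral>v. f v \<partial>kiter K n u) \<in> borel_measurable borel"
    and kiter_integral_bound: "\<bar>\<integral>v. f v \<partial>kiter K n x\<bar> \<le> D"
    and kiter_integral_add: "(\<integral>u. f u \<partial>kiter K (n + m) x) = (\<integral>u. \<integral>v. f v \<partial>kiter K m u \<partial>kiter K n x)"
proof -
  show "(\<lambda>u. \<integral>v. f v \<partial>kiter K n u) \<in> borel_measurable borel"
    by (rule measurable_kernel_integral[OF kiter_measurable[OF K] f(1)])
  show "\<bar>\<integral>v. f v \<partial>kiter K n x\<bar> \<le> D"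
    by (rule prob_space.abs_integral_le_const[OF prob_space_kiter(1)[OF K]])
       (use f prob_space_kiter(2)[OF K] in \<open>simp_all cong: measurable_cong_sets\<close>)
  show "(\<integral>u. f u \<partial>kiter K (n + m) x) = (\<integral>u. \<integral>v. f v \<partial>kiter K m u \<partial>kiter K n x)"
    using integral_prob_bind[OF kernel_space(1)[OF kiter_measurable[OF K]] kiter_measurable[OF K] f, of n x m]
    by (simp add: kiter_add[OF K])
qed

text \<open>The duality between weighted oscillation and weighted sup norm modulo constants: a
  number above all \<open>f x - w x\<close> and below all \<open>f y + w y\<close> serves as
  \<open>c\<close>, and the oscillation bound leaves room for one. The bound \<open>D\<close> makes
  the supremum finite.\<close>

lemma weighted_oscillation_shift:
  fixes f w :: "'a \<Rightarrow> real"
  assumes bd: "\<And>x. \<bar>f x\<bar> \<le> D" and w: "\<And>x. 0 \<le> w x" and osc: "\<And>x y. \<bar>f x - f y\<bar> \<le> w x + w y"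
  shows "\<exists>c. \<forall>x. \<bar>f x - c\<bar> \<le> w x"
proof -
  define c where "c = (SUP x. f x - w x)"
  have bdd: "bdd_above (range (\<lambda>x. f x - w x))"
  proof (rule bdd_aboveI2)
    fix x show "f x - w x \<le> D" using bd[of x] w[of x] by linarith
  qed
  have "f x - c \<le> w x" for x
    using cSUP_upper[OF _ bdd, of x] by (simp add: c_def)
  moreover have "c \<le> f y + w y" for y
    unfolding c_def
  proof (rule cSUP_least)
    fix x show "f x - w x \<le> f y + w y" using osc[of x y] by linarith
  qed simp
  ultimately show ?thesis by (intro exI[of _ c]) (auto simp: abs_le_iff algebra_simps)
qed

text \<open>The weighted oscillation with weight \<open>1 + \<beta> W\<close> contracts for two different reasons: where \<open>W x + W y\<close> is
large the drift alone suffices, and on the small set the part of the test function cut off at level \<open>C\<close>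
contracts by \<open>small\<close> while the remainder is dominated by \<open>C \<beta> W\<close>.\<close>

lemma harris_contraction:
  fixes Q :: "'a::topological_space \<Rightarrow> 'a measure" and W f :: "'a \<Rightarrow> real"
  assumes Q: "Q \<in> borel \<rightarrow>\<^sub>M prob_algebra borel" and Wm: "W \<in> borel_measurable borel" and W0: "\<And>x. 0 \<le> W x"
    and lb: "0 \<le> lam" "lam < 1" and B: "0 \<le> B"
    and drift: "\<And>x. integrable (Q x) W" "\<And>x. (\<integral>u. W u \<partial>Q x) \<le> lam * W x + B"
    and small: "\<And>x y g. W x + W y \<le> R \<Longrightarrow> g \<in> borel_measurable borel \<Longrightarrow> (\<And>u. 0 \<le> g u \<and> g u \<le> 1) \<Longrightarrow>
       (\<integral>u. g u \<partial>Q x) - (\<integral>u. g u \<partial>Q y) \<le> 1 - \<epsilon>"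
    and R: "4 * B \<le> (1 - lam) * R" "0 < R" and \<beta>: "0 < \<beta>" "2 * \<beta> * B \<le> \<epsilon>"
    and \<alpha>: "1 - \<epsilon> / 2 \<le> \<alpha>" "lam \<le> \<alpha>" "2 + \<beta> * ((1 + lam) / 2) * R \<le> \<alpha> * (2 + \<beta> * R)" "(1 + lam) / 2 \<le> \<alpha>"
    and f: "f \<in> borel_measurable borel" "\<And>x. \<bar>f x\<bar> \<le> D" and C: "C > 0"
    and osc: "\<And>x y. \<bar>f x - f y\<bar> \<le> C * (2 + \<beta> * W x + \<beta> * W y)"
  shows "\<bar>(\<integral>u. f u \<partial>Q x) - (\<integral>u. f u \<partial>Q y)\<bar> \<le> \<alpha> * C * (2 + \<beta> * W x + \<beta> * W y)"
proof -
  note [measurable] = Wm f(1)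
  have [measurable_cong]: "sets (Q z) = sets borel" for z using kernel_space(3)[OF Q] .
  have ps: "prob_space (Q z)" for z using kernel_space(2)[OF Q] .
  have "\<exists>c. \<forall>x. \<bar>f x - c\<bar> \<le> C * (1 + \<beta> * W x)"
    by (rule weighted_oscillation_shift[OF f(2)]) (use C \<beta> W0 osc in \<open>auto simp: algebra_simps\<close>)
  then obtain c where c: "\<And>x. \<bar>f x - c\<bar> \<le> C * (1 + \<beta> * W x)" by blast
  define h where "h = (\<lambda>x. f x - c)"
  have hm [measurable]: "h \<in> borel_measurable borel" unfolding h_def by measurable
  have hb: "\<bar>h x\<bar> \<le> D + \<bar>c\<bar>" for x using f(2)[of x] by (simp add: h_def)
  have hW: "\<bar>h x\<bar> \<le> C * (1 + \<beta> * W x)" for x using c by (simp add: h_def)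
  have hint: "integrable (Q z) h" for z
    by (rule prob_space.integrable_bounded[OF ps, of _ _ "D + \<bar>c\<bar>"]) (use hb in auto)
  have fh: "(\<integral>u. f u \<partial>Q z) = (\<integral>u. h u \<partial>Q z) + c" for z
  proof -
    interpret prob_space "Q z" by (rule ps)
    have "(\<integral>u. h u + c \<partial>Q z) = (\<integral>u. h u \<partial>Q z) + c" using hint[of z] by (simp add: prob_space)
    then show ?thesis by (simp add: h_def)
  qed
  let ?S = "W x + W y"
  have S0: "0 \<le> ?S" using W0[of x] W0[of y] by simp
  have b1: "\<bar>\<integral>u. h u \<partial>Q z\<bar> \<le> C * (1 + \<beta> * (lam * W z + B))" for z
  proof (rule prob_space.abs_integral_le[OF ps _ _ hW])
    interpret prob_space "Q z" by (rule ps)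
    show "integrable (Q z) (\<lambda>x. C * (1 + \<beta> * W x))" using drift(1) by simp
    have "(\<integral>x. C * (1 + \<beta> * W x) \<partial>Q z) = C * (1 + \<beta> * (\<integral>u. W u \<partial>Q z))"
      using drift(1)[of z] by (simp add: prob_space)
    also have "\<dots> \<le> C * (1 + \<beta> * (lam * W z + B))"
      using C \<beta> drift(2)[of z] by (intro mult_left_mono add_left_mono) auto
    finally show "(\<integral>x. C * (1 + \<beta> * W x) \<partial>Q z) \<le> C * (1 + \<beta> * (lam * W z + B))" .
  qed simp
  have "\<bar>(\<integral>u. h u \<partial>Q x) - (\<integral>u. h u \<partial>Q y)\<bar> \<le> C * (\<alpha> * (2 + \<beta> * ?S))"
  proof (cases "R \<le> ?S")
    case True
    define q where "q = (1 + lam) / 2"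
    have "\<bar>(\<integral>u. h u \<partial>Q x) - (\<integral>u. h u \<partial>Q y)\<bar> \<le> C * (2 + \<beta> * (lam * ?S + 2 * B))"
      using b1[of x] b1[of y] by (simp add: algebra_simps)
    also have "\<dots> \<le> C * (\<alpha> * (2 + \<beta> * ?S))"
    proof (rule mult_left_mono)
      \<comment> \<open>Half of the drift gain \<open>(1 - lam) * ?S\<close> pays for the additive
        \<open>2 * B\<close>.\<close>
      have "4 * B \<le> (1 - lam) * ?S" using R(1) mult_left_mono[OF True, of "1 - lam"] lb by linarith
      then have "lam * ?S + 2 * B \<le> q * ?S" by (simp add: q_def algebra_simps)
      then have "2 + \<beta> * (lam * ?S + 2 * B) \<le> 2 + \<beta> * (q * ?S)" using \<beta> by simp
      \<comment> \<open>The ratio of \<open>2 + \<beta> * (q * s)\<close> to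
        \<open>2 + \<beta> * s\<close> decreases in \<open>s\<close>, so the worst case is
        \<open>s = R\<close>: the third bound on \<alpha> is used there, and
        \<open>q \<le> \<alpha>\<close> for the excess over \<open>R\<close>.\<close>
      also have "\<dots> = (2 + \<beta> * q * R) + q * (\<beta> * (?S - R))" by (simp add: algebra_simps)
      also have "\<dots> \<le> \<alpha> * (2 + \<beta> * R) + \<alpha> * (\<beta> * (?S - R))"
        using \<alpha>(3,4) True \<beta> unfolding q_def by (intro add_mono mult_right_mono) auto
      also have "\<dots> = \<alpha> * (2 + \<beta> * ?S)" by (simp add: algebra_simps)
      finally show "2 + \<beta> * (lam * ?S + 2 * B) \<le> \<alpha> * (2 + \<beta> * ?S)" .
    qed (use C in simp)
    finally show ?thesis .
  next
    case False
    define h1 where "h1 = (\<lambda>x. max (- C) (min C (h x)))"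
    define h2 where "h2 = (\<lambda>x. h x - h1 x)"
    have [measurable]: "h1 \<in> borel_measurable borel" "h2 \<in> borel_measurable borel"
      unfolding h1_def h2_def by measurable
    have h1b: "\<bar>h1 u\<bar> \<le> C" for u using C by (auto simp: h1_def)
    have h1i: "integrable (Q z) h1" for z
      by (rule prob_space.integrable_bounded[OF ps, of _ _ C]) (use h1b in auto)
    have h2b: "\<bar>h2 u\<bar> \<le> C * \<beta> * W u" for u
    proof -
      have "0 \<le> C * \<beta> * W u" using C \<beta> W0 by simp
      then show ?thesis using hW[of u] C by (auto simp: h2_def h1_def algebra_simps max_def min_def)
    qed
    have b2: "\<bar>\<integral>u. h2 u \<partial>Q z\<bar> \<le> C * \<beta> * (lam * W z + B)" for z
    proof (rule prob_space.abs_integral_le[OF ps _ _ h2b])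
      show "(\<integral>u. C * \<beta> * W u \<partial>Q z) \<le> C * \<beta> * (lam * W z + B)"
        using C \<beta> drift(2)[of z] by simp
    qed (use drift(1) in auto)
    have one: "(\<integral>u. h1 u \<partial>Q x) - (\<integral>u. h1 u \<partial>Q y) \<le> 2 * C * (1 - \<epsilon>)" if "W x + W y < R" for x y
    proof -
      \<comment> \<open>Rescales the range of \<open>h1\<close> from \<open>[- C, C]\<close> to
        \<open>[0, 1]\<close>; this is the origin of the factor \<open>2 * C\<close>.\<close>
      define g where "g = (\<lambda>u. (h1 u + C) / (2 * C))"
      have [measurable]: "g \<in> borel_measurable borel" unfolding g_def by measurable
      have "0 \<le> g u \<and> g u \<le> 1" for u using h1b[of u] C by (auto simp: g_def field_simps abs_le_iff)
      then have "(\<integral>u. g u \<partial>Q x) - (\<integral>u. g u \<partial>Q y) \<le> 1 - \<epsilon>"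
        using that by (intro small) auto
      moreover have "(\<integral>u. g u \<partial>Q z) = ((\<integral>u. h1 u \<partial>Q z) + C) / (2 * C)" for z
      proof -
        interpret prob_space "Q z" by (rule ps)
        show ?thesis using h1i[of z] by (simp add: g_def prob_space)
      qed
      ultimately have "((\<integral>u. h1 u \<partial>Q x) - (\<integral>u. h1 u \<partial>Q y)) / (2 * C) \<le> 1 - \<epsilon>"
        by (simp add: diff_divide_distrib add_divide_distrib)
      then show ?thesis using C by (simp add: pos_divide_le_eq mult.commute)
    qed
    have h12: "(\<integral>u. h u \<partial>Q z) = (\<integral>u. h1 u \<partial>Q z) + (\<integral>u. h2 u \<partial>Q z)" for z
      using h1i[of z] hint[of z] by (simp add: h2_def)
    have "\<bar>(\<integral>u. h1 u \<partial>Q x) - (\<integral>u. h1 u \<partial>Q y)\<bar> \<le> 2 * C * (1 - \<epsilon>)"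
      using one[of x y] one[of y x] False by (simp add: abs_le_iff add.commute)
    then have "\<bar>(\<integral>u. h u \<partial>Q x) - (\<integral>u. h u \<partial>Q y)\<bar> \<le> 2 * C * (1 - \<epsilon>) + C * \<beta> * (lam * W x + B) + C * \<beta> * (lam * W y + B)"
      unfolding h12 using b2[of x] b2[of y] by linarith
    also have "\<dots> = C * (2 * (1 - \<epsilon>) + 2 * \<beta> * B + lam * (\<beta> * ?S))" by (simp add: algebra_simps)
    \<comment> \<open>Since \<open>2 * \<beta> * B \<le> \<epsilon>\<close>, the constant part is at
      most \<open>2 * (1 - \<epsilon> / 2)\<close>: half of the gain on the small set pays for the
      drift constant.\<close>
    also have "\<dots> \<le> C * (\<alpha> * (2 + \<beta> * ?S))"
    proof (rule mult_left_mono)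
      have "lam * (\<beta> * ?S) \<le> \<alpha> * (\<beta> * ?S)" using \<alpha>(2) \<beta> S0 by (intro mult_right_mono) auto
      then show "2 * (1 - \<epsilon>) + 2 * \<beta> * B + lam * (\<beta> * ?S) \<le> \<alpha> * (2 + \<beta> * ?S)"
        using \<alpha>(1) \<beta>(2) by (simp add: algebra_simps)
    qed (use C in simp)
    finally show ?thesis .
  qed
  then show ?thesis unfolding fh by (simp add: algebra_simps)
qed

section \<open>Total variation limits and the weighted norm\<close>

lemma abs_integral_diff_le_sets:
  fixes f :: "'a \<Rightarrow> real"
  assumes M: "prob_space M" and N: "prob_space N" and s: "sets M = sets N"
    and f: "f \<in> borel_measurable M" and f01: "\<And>x. 0 \<le> f x \<and> f x \<le> 1"
    and e: "\<And>A. A \<in> sets M \<Longrightarrow> \<bar>measure M A - measure N A\<bar> \<le> e"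
  shows "\<bar>(\<integral>x. f x \<partial>M) - (\<integral>x. f x \<partial>N)\<bar> \<le> e"
proof -
  have f': "f \<in> borel_measurable N" using f s by (simp cong: measurable_cong_sets)
  have sp: "space M = space N" using s by (rule sets_eq_imp_space_eq)
  have e0: "0 \<le> e" using e[of "{}"] by simp
  \<comment> \<open>layer cake: \<open>n f\<close> is within 1 of the number of \<open>i \<le> n\<close> with \<open>i \<le> n f\<close>\<close>
  have approx: "\<bar>(\<integral>x. f x \<partial>M) - (\<integral>x. f x \<partial>N)\<bar> \<le> e + 2 / real n" if n: "n > 0" for n :: nat
  proof -
    define A where "A = (\<lambda>i::nat. {x \<in> space M. real i \<le> real n * f x})"
    have Am: "A i \<in> sets M" for i unfolding A_def using f by measurable
    define g where "g = (\<lambda>x. \<Sum>i\<in>{1..n}. indicat_real (A i) x)"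
    have gf: "\<bar>real n * f x - g x\<bar> \<le> 1" if "x \<in> space M" for x
    proof -
      let ?k = "nat \<lfloor>real n * f x\<rfloor>"
      have nf: "0 \<le> real n * f x" "real n * f x \<le> real n" using f01[of x] n by (auto simp: mult_le_cancel_left1)
      have "g x = real (card {i\<in>{1..n}. x \<in> A i})"
        unfolding g_def indicator_def by (simp add: sum.If_cases Int_def)
      also have "{i\<in>{1..n}. x \<in> A i} = {1..?k}"
        using nf that by (auto simp: A_def le_nat_iff le_floor_iff)
      finally have "g x = real ?k" by simp
      then show ?thesis using nf by simp linarith
    qed
    have D: "\<bar>(\<integral>x. real n * f x \<partial>L) - (\<Sum>i\<in>{1..n}. measure L (A i))\<bar> \<le> 1"
      if L: "prob_space L" "sets L = sets M" for L
    proof -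
      interpret prob_space L by (rule L)
      have fL: "f \<in> borel_measurable L" using f L by (simp cong: measurable_cong_sets)
      have AL: "A i \<in> sets L" for i using Am L by simp
      have sL: "space L = space M" using L by (intro sets_eq_imp_space_eq) simp
      have i1: "integrable L (\<lambda>x. real n * f x)"
        by (intro integrable_mult_right integrable_bounded[of _ 1]) (use fL f01 in auto)
      have i2: "integrable L g" unfolding g_def using AL by (intro Bochner_Integration.integrable_sum) (simp add: emeasure_eq_measure)
      have ig: "(\<integral>x. g x \<partial>L) = (\<Sum>i\<in>{1..n}. measure L (A i))"
        unfolding g_def using AL by (subst Bochner_Integration.integral_sum) (auto simp: emeasure_eq_measure)
      have "\<bar>\<integral>x. real n * f x - g x \<partial>L\<bar> \<le> (\<integral>x. \<bar>real n * f x - g x\<bar> \<partial>L)" by (rule integral_abs_bound)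
      also have "\<dots> \<le> (\<integral>x. 1 \<partial>L)"
        by (rule integral_mono) (use i1 i2 gf sL in auto)
      finally show ?thesis using i1 i2 ig by (simp add: prob_space)
    qed
    have "\<bar>(\<Sum>i\<in>{1..n}. measure M (A i)) - (\<Sum>i\<in>{1..n}. measure N (A i))\<bar> \<le> (\<Sum>i\<in>{1..n}. e)"
      unfolding sum_subtractf[symmetric] by (rule order_trans[OF sum_abs sum_mono]) (use e Am in auto)
    then have "\<bar>(\<integral>x. real n * f x \<partial>M) - (\<integral>x. real n * f x \<partial>N)\<bar> \<le> real n * e + 2"
      using D[OF M refl] D[OF N s[symmetric]] by simp
    then have "real n * \<bar>(\<integral>x. f x \<partial>M) - (\<integral>x. f x \<partial>N)\<bar> \<le> real n * e + 2"
      by (simp add: right_diff_distrib[symmetric] abs_mult)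
    then show ?thesis using n by (simp add: field_simps)
  qed
  show ?thesis
  proof (rule tendsto_lowerbound)
    show "((\<lambda>n. e + 2 / real n) \<longlonglongrightarrow> e)" by real_asymp
    show "\<forall>\<^sub>F n in sequentially. \<bar>(\<integral>x. f x \<partial>M) - (\<integral>x. f x \<partial>N)\<bar> \<le> e + 2 / real n"
      using eventually_gt_at_top[of 0] by eventually_elim (rule approx)
  qed simp
qed

text \<open>Completeness in total variation. The setwise limit is finitely additive. For continuity
  at the empty set, choose \<open>m\<close> with \<open>e m\<close> small: the limit is close to
  \<open>\<mu> m\<close> uniformly over events, and \<open>\<mu> m\<close> is continuous
  there.\<close>

lemma total_variation_limit:
  fixes \<mu> :: "nat \<Rightarrow> 'a::topological_space measure"
  assumes \<mu>: "\<And>m. prob_space (\<mu> m)" "\<And>m. sets (\<mu> m) = sets borel"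
    and e: "e \<longlonglongrightarrow> 0" "\<And>m k A. m \<le> k \<Longrightarrow> A \<in> sets borel \<Longrightarrow> \<bar>measure (\<mu> m) A - measure (\<mu> k) A\<bar> \<le> e m"
  shows "\<exists>\<pi>. prob_space \<pi> \<and> sets \<pi> = sets borel \<and> (\<forall>A\<in>sets borel. \<forall>m. \<bar>measure (\<mu> m) A - measure \<pi> A\<bar> \<le> e m)"
proof -
  have conv: "convergent (\<lambda>m. measure (\<mu> m) A)" if A: "A \<in> sets borel" for A
  proof (rule Cauchy_convergent, rule metric_CauchyI)
    fix r :: real assume "r > 0"
    then obtain m0 where m0: "\<And>m. m \<ge> m0 \<Longrightarrow> \<bar>e m\<bar> < r / 2"
      using LIMSEQ_D[OF e(1), of "r / 2"] by auto
    have "dist (measure (\<mu> m) A) (measure (\<mu> k) A) < r" if "m \<ge> m0" "k \<ge> m0" for m k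
    proof -
      have "\<bar>measure (\<mu> m0) A - measure (\<mu> m) A\<bar> < r / 2" "\<bar>measure (\<mu> m0) A - measure (\<mu> k) A\<bar> < r / 2"
        using e(2)[OF that(1) A] e(2)[OF that(2) A] m0[of m0] by auto
      then show ?thesis unfolding dist_real_def by linarith
    qed
    then show "\<exists>M. \<forall>m\<ge>M. \<forall>n\<ge>M. dist (measure (\<mu> m) A) (measure (\<mu> n) A) < r" by blast
  qed
  define l where "l = (\<lambda>A. lim (\<lambda>m. measure (\<mu> m) A))"
  have lim: "(\<lambda>m. measure (\<mu> m) A) \<longlonglongrightarrow> l A" if "A \<in> sets borel" for A
    using conv[OF that] by (simp add: l_def convergent_LIMSEQ_iff)
  have close: "\<bar>measure (\<mu> m) A - l A\<bar> \<le> e m" if A: "A \<in> sets borel" for A m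
  proof (rule tendsto_upperbound)
    show "(\<lambda>k. \<bar>measure (\<mu> m) A - measure (\<mu> k) A\<bar>) \<longlonglongrightarrow> \<bar>measure (\<mu> m) A - l A\<bar>"
      by (intro tendsto_intros lim A)
    show "\<forall>\<^sub>F k in sequentially. \<bar>measure (\<mu> m) A - measure (\<mu> k) A\<bar> \<le> e m"
      using eventually_ge_at_top[of m] by eventually_elim (use e(2) A in auto)
  qed simp
  have l0: "0 \<le> l A" if "A \<in> sets borel" for A
    by (rule tendsto_lowerbound[OF lim[OF that]]) auto
  have l_empty: "l {} = 0" using lim[of "{}"] by (simp add: LIMSEQ_const_iff)
  have l_UNIV: "l UNIV = 1"
  proof -
    have "measure (\<mu> m) UNIV = 1" for m
      using prob_space.prob_space[OF \<mu>(1)[of m]] sets_eq_imp_space_eq[OF \<mu>(2)[of m]] by simp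
    then show ?thesis using lim[of UNIV] by (simp add: LIMSEQ_const_iff)
  qed
  have ladd: "l (A \<union> A') = l A + l A'" if "A \<in> sets borel" "A' \<in> sets borel" "A \<inter> A' = {}" for A A'
  proof (rule LIMSEQ_unique[OF lim])
    have "measure (\<mu> m) (A \<union> A') = measure (\<mu> m) A + measure (\<mu> m) A'" for m
      using that \<mu> by (intro finite_measure.finite_measure_Union) (auto simp: prob_space.finite_measure)
    then show "(\<lambda>m. measure (\<mu> m) (A \<union> A')) \<longlonglongrightarrow> l A + l A'"
      using tendsto_add[OF lim[OF that(1)] lim[OF that(2)]] by simp
  qed (use that in auto)
  interpret sigma_algebra "UNIV :: 'a set" "sets borel" using sets.sigma_algebra_axioms[of borel] by simp
  define \<pi> where "\<pi> = measure_of UNIV (sets borel) (\<lambda>A. ennreal (l A))"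
  have sets\<pi>: "sets \<pi> = sets (borel :: 'a measure)"
    unfolding \<pi>_def by (simp add: sets_measure_of_eq)
  have em: "emeasure \<pi> A = ennreal (l A)" if A: "A \<in> sets borel" for A
  proof (rule emeasure_measure_of[OF \<pi>_def])
    show "positive (sets \<pi>) (\<lambda>A. ennreal (l A))" by (simp add: positive_def l_empty)
    have pos: "positive (sets borel) (\<lambda>A. ennreal (l A))" by (simp add: positive_def l_empty)
    have "countably_additive (sets borel) (\<lambda>A. ennreal (l A))"
    proof (rule empty_continuous_imp_countably_additive[OF pos])
      show "additive (sets borel) (\<lambda>A. ennreal (l A))"
        by (auto simp: additive_def ladd l0)
      fix F :: "nat \<Rightarrow> 'a set"
      assume F: "range F \<subseteq> sets borel" "decseq F" "(\<Inter>i. F i) = {}"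
      have "(\<lambda>i. l (F i)) \<longlonglongrightarrow> 0"
      proof (rule LIMSEQ_I)
        fix r :: real assume r: "r > 0"
        then obtain m where m: "\<bar>e m\<bar> < r / 2"
          using LIMSEQ_D[OF e(1), of "r / 2"] by auto
        interpret pm: prob_space "\<mu> m" by (rule \<mu>(1))
        have "(\<lambda>i. measure (\<mu> m) (F i)) \<longlonglongrightarrow> measure (\<mu> m) (\<Inter>i. F i)"
          by (rule pm.finite_Lim_measure_decseq) (use F \<mu>(2) in auto)
        then have "(\<lambda>i. measure (\<mu> m) (F i)) \<longlonglongrightarrow> 0" using F(3) by simp
        then obtain i0 where i0: "\<And>i. i \<ge> i0 \<Longrightarrow> measure (\<mu> m) (F i) < r / 2"
          using LIMSEQ_D[of "\<lambda>i. measure (\<mu> m) (F i)" 0 "r / 2"] r by auto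
        have "norm (l (F i) - 0) < r" if "i \<ge> i0" for i
          using i0[OF that] close[of "F i" m] m F(1) l0[of "F i"] by auto
        then show "\<exists>no. \<forall>n\<ge>no. norm (l (F n) - 0) < r" by blast
      qed
      then show "(\<lambda>i. ennreal (l (F i))) \<longlonglongrightarrow> 0" using tendsto_ennrealI by fastforce
    qed simp
    then show "countably_additive (sets \<pi>) (\<lambda>A. ennreal (l A))" by (simp add: sets\<pi>)
  qed (use A sets\<pi> in \<open>auto\<close>)
  have "prob_space \<pi>"
  proof (rule prob_spaceI)
    have "space \<pi> = UNIV" using sets_eq_imp_space_eq[OF sets\<pi>] by simp
    then show "emeasure \<pi> (space \<pi>) = 1" using em[of UNIV] by (simp add: l_UNIV)
  qed
  moreover have "measure \<pi> A = l A" if "A \<in> sets borel" for A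
    using em[OF that] l0[OF that] by (simp add: measure_def)
  ultimately show ?thesis using sets\<pi> close by (intro exI[of _ \<pi>]) auto
qed

text \<open>Truncation at level \<open>n\<close> and dominated convergence pass from bounded test
  functions to all functions below \<open>W\<close>, since \<open>E\<close> does not depend on
  \<open>D\<close>. Integrability of \<open>W\<close> keeps \<open>wnorm\<close> away from its
  default value \<open>\<infinity>\<close>.\<close>

lemma wnorm_le_bounded:
  fixes W :: "'a::euclidean_space \<Rightarrow> real"
  assumes \<mu>: "prob_space \<mu>" "sets \<mu> = sets borel" "integrable \<mu> W"
    and \<nu>: "prob_space \<nu>" "sets \<nu> = sets borel" "integrable \<nu> W"
    and bd: "\<And>f D. f \<in> borel_measurable borel \<Longrightarrow> (\<And>x. \<bar>f x\<bar> \<le> W x) \<Longrightarrow> (\<And>x. \<bar>f x\<bar> \<le> D) \<Longrightarrow>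
       \<bar>(\<integral>x. f x \<partial>\<mu>) - (\<integral>x. f x \<partial>\<nu>)\<bar> \<le> E"
  shows "wnorm W \<mu> \<nu> \<le> ereal E"
proof -
  have "\<bar>(\<integral>x. f x \<partial>\<mu>) - (\<integral>x. f x \<partial>\<nu>)\<bar> \<le> E"
    if [measurable]: "f \<in> borel_measurable borel" and fW: "\<And>x. \<bar>f x\<bar> \<le> W x" for f
  proof -
    define g where "g = (\<lambda>(n::nat) x. max (- real n) (min (real n) (f x)))"
    have [measurable]: "g n \<in> borel_measurable borel" for n unfolding g_def by measurable
    have gW: "\<bar>g n x\<bar> \<le> W x" and gn: "\<bar>g n x\<bar> \<le> real n" for n x
      using fW[of x] by (auto simp: g_def max_def min_def abs_le_iff)
    have glim: "(\<lambda>n. g n x) \<longlonglongrightarrow> f x" for x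
    proof (rule tendsto_eventually)
      obtain N :: nat where "\<bar>f x\<bar> \<le> real N" using real_arch_simple by blast
      then show "\<forall>\<^sub>F n in sequentially. g n x = f x"
        by (intro eventually_sequentiallyI[of N]) (auto simp: g_def max_def min_def)
    qed
    have "(\<lambda>n. \<integral>x. g n x \<partial>M) \<longlonglongrightarrow> (\<integral>x. f x \<partial>M)" if "sets M = sets borel" "integrable M W" for M
    proof (rule integral_dominated_convergence[of _ _ _ W])
      have [measurable_cong]: "sets M = sets borel" by fact
      show "f \<in> borel_measurable M" "\<And>n. g n \<in> borel_measurable M" by measurable
    qed (use that gW glim in auto)
    then have "(\<lambda>n. \<bar>(\<integral>x. g n x \<partial>\<mu>) - (\<integral>x. g n x \<partial>\<nu>)\<bar>) \<longlonglongrightarrow> \<bar>(\<integral>x. f x \<partial>\<mu>) - (\<integral>x. f x \<partial>\<nu>)\<bar>"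
      using \<mu> \<nu> by (intro tendsto_intros) auto
    then show ?thesis
      by (rule tendsto_upperbound) (use bd[OF _ gW gn] in auto)
  qed
  then show ?thesis using \<mu> \<nu> by (auto simp: wnorm_def intro!: SUP_least)
qed

subsection \<open>Chains with a uniform drift\<close>

text \<open>Bounds the geometric sum \<open>b \<gamma> / (1 - exp (- \<delta> \<gamma>))\<close> uniformly in \<open>\<gamma> \<le> \<Gamma>\<close>.\<close>

definition drift_level :: "real \<Rightarrow> real \<Rightarrow> real \<Rightarrow> real" where
  "drift_level \<delta> b \<Gamma> = b * (1 / \<delta> + \<Gamma>)"

text \<open>The kernel and \<gamma> vary from chain to chain, while \<open>W\<close>, \<Gamma>,
  \<delta>, \<open>b\<close> and \<epsilon> are shared; the final constants are built from the
  latter alone. The threshold in \<open>small\<close> is a level above which the decay over unit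
  time outweighs the additive constant.\<close>

locale uniform_drift =
  fixes K :: "'a::euclidean_space \<Rightarrow> 'a measure" and W :: "'a \<Rightarrow> real" and \<gamma> \<Gamma> \<delta> b \<epsilon> :: real
  assumes K: "K \<in> borel \<rightarrow>\<^sub>M prob_algebra borel"
    and Wm [measurable]: "W \<in> borel_measurable borel" and W1: "\<And>x. 1 \<le> W x"
    and gam: "0 < \<gamma>" "\<gamma> \<le> \<Gamma>" and delta: "0 < \<delta>" and b: "0 \<le> b"
    and drift: "\<And>x. (\<integral>\<^sup>+y. ennreal (W y) \<partial>K x) \<le> ennreal (exp (- \<delta> * \<gamma>) * W x + b * \<gamma>)"
    and eps: "0 < \<epsilon>" "\<epsilon> \<le> 1"
    and small: "\<And>x y n g. 1 \<le> \<gamma> * real n \<Longrightarrow>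
        W x + W y \<le> 4 * drift_level \<delta> b \<Gamma> / (1 - exp (- \<delta>)) + 1 \<Longrightarrow>
        g \<in> borel_measurable borel \<Longrightarrow> (\<And>u. 0 \<le> g u \<and> g u \<le> 1) \<Longrightarrow>
        (\<integral>u. g u \<partial>kiter K n x) - (\<integral>u. g u \<partial>kiter K n y) \<le> 1 - \<epsilon>"
begin

abbreviation "B \<equiv> drift_level \<delta> b \<Gamma>"
abbreviation "R \<equiv> 4 * B / (1 - exp (- \<delta>)) + 1"

lemma level_nonneg: "0 \<le> B"
  using b delta gam by (simp add: drift_level_def)

text \<open>\<open>B\<close> is a supersolution of
  \<open>z = exp (- \<delta> * \<gamma>) * z + b * \<gamma>\<close>. This rests on
  \<open>1 - exp (- t) \<ge> t / (1 + t)\<close> with \<open>t = \<delta> * \<gamma>\<close>; the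
  summand \<Gamma> in \<open>drift_level\<close> compensates the denominator.\<close>

lemma drift_absorb: "exp (- \<delta> * \<gamma>) * B + b * \<gamma> \<le> B"
proof -
  have "exp (- (\<delta> * \<gamma>)) \<le> 1 / (1 + \<delta> * \<gamma>)"
    using exp_ge_add_one_self[of "\<delta> * \<gamma>"] delta gam by (simp add: exp_minus inverse_eq_divide frac_le add_pos_pos)
  then have "B * (\<delta> * \<gamma> / (1 + \<delta> * \<gamma>)) \<le> B * (1 - exp (- (\<delta> * \<gamma>)))"
  proof (intro mult_left_mono)
    have "\<delta> * \<gamma> / (1 + \<delta> * \<gamma>) = 1 - 1 / (1 + \<delta> * \<gamma>)" if "0 < \<delta> * \<gamma>"
      using that by (simp add: field_simps)
    then show "\<delta> * \<gamma> / (1 + \<delta> * \<gamma>) \<le> 1 - exp (- (\<delta> * \<gamma>))"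
      using \<open>exp (- (\<delta> * \<gamma>)) \<le> 1 / (1 + \<delta> * \<gamma>)\<close> delta gam by simp
  qed (rule level_nonneg)
  moreover have "b * \<gamma> \<le> B * (\<delta> * \<gamma> / (1 + \<delta> * \<gamma>))"
  proof -
    have "B * (\<delta> * \<gamma> / (1 + \<delta> * \<gamma>)) = b * \<gamma> * ((1 + \<delta> * \<Gamma>) / (1 + \<delta> * \<gamma>))"
    proof -
      have "B * \<delta> = b * (1 + \<delta> * \<Gamma>)" using delta by (simp add: drift_level_def field_simps)
      moreover have "B * (\<delta> * \<gamma> / (1 + \<delta> * \<gamma>)) = (B * \<delta>) * (\<gamma> / (1 + \<delta> * \<gamma>))" by simp
      ultimately show ?thesis by simp
    qed
    moreover have "1 \<le> (1 + \<delta> * \<Gamma>) / (1 + \<delta> * \<gamma>)"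
      using delta gam by (subst le_divide_eq) (auto simp: add_pos_pos)
    moreover have "0 \<le> b * \<gamma>" using b gam by simp
    ultimately show ?thesis using mult_left_mono[of 1 "(1 + \<delta> * \<Gamma>) / (1 + \<delta> * \<gamma>)" "b * \<gamma>"]
      by (simp only: mult_1_right)
  qed
  ultimately show ?thesis by (simp add: algebra_simps)
qed

text \<open>Formulated with the nonnegative integral, so that integrability of \<open>W\<close>
  under the iterates is a consequence.\<close>

lemma drift_iter: "(\<integral>\<^sup>+y. ennreal (W y) \<partial>kiter K n x) \<le> ennreal (exp (- \<delta> * (\<gamma> * real n)) * W x + B)"
proof (induction n)
  case 0
  have "(\<integral>\<^sup>+y. ennreal (W y) \<partial>return borel x) = ennreal (W x)" by (rule nn_integral_return) auto
  then show ?case using level_nonneg by (simp add: ennreal_leI)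
next
  case (Suc n)
  let ?E = "exp (- \<delta> * (\<gamma> * real n))"
  interpret P: prob_space "kiter K n x" by (rule prob_space_kiter[OF K])
  have W0: "0 \<le> W u" for u using W1[of u] by simp
  have [measurable_cong]: "sets (kiter K n x) = sets borel" by (rule prob_space_kiter[OF K])
  have "(\<integral>\<^sup>+y. ennreal (W y) \<partial>kiter K (Suc n) x) = (\<integral>\<^sup>+u. \<integral>\<^sup>+y. ennreal (W y) \<partial>K u \<partial>kiter K n x)"
    unfolding kiter.simps
    by (rule nn_integral_prob_bind[OF kernel_space(1)[OF kiter_measurable[OF K]] K]) measurable
  also have "\<dots> \<le> (\<integral>\<^sup>+u. ennreal (exp (- \<delta> * \<gamma>)) * ennreal (W u) + ennreal (b * \<gamma>) \<partial>kiter K n x)"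
  proof (rule nn_integral_mono)
    fix u show "(\<integral>\<^sup>+y. ennreal (W y) \<partial>K u) \<le> ennreal (exp (- \<delta> * \<gamma>)) * ennreal (W u) + ennreal (b * \<gamma>)"
      using drift[of u] W0[of u] b gam by (simp add: ennreal_plus ennreal_mult')
  qed
  also have "\<dots> = ennreal (exp (- \<delta> * \<gamma>)) * (\<integral>\<^sup>+u. ennreal (W u) \<partial>kiter K n x) + ennreal (b * \<gamma>)"
    by (simp add: nn_integral_add nn_integral_cmult P.emeasure_space_1)
  also have "\<dots> \<le> ennreal (exp (- \<delta> * \<gamma>)) * ennreal (?E * W x + B) + ennreal (b * \<gamma>)"
    by (intro add_right_mono mult_left_mono Suc) simp
  also have "\<dots> = ennreal (exp (- \<delta> * \<gamma>) * (?E * W x + B) + b * \<gamma>)"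
    using W0[of x] level_nonneg b gam by (simp add: ennreal_plus ennreal_mult')
  also have "\<dots> \<le> ennreal (exp (- \<delta> * (\<gamma> * real (Suc n))) * W x + B)"
  proof (rule ennreal_leI)
    have "exp (- \<delta> * (\<gamma> * real (Suc n))) = exp (- \<delta> * \<gamma>) * ?E"
      by (simp add: exp_add[symmetric] algebra_simps)
    then show "exp (- \<delta> * \<gamma>) * (?E * W x + B) + b * \<gamma> \<le> exp (- \<delta> * (\<gamma> * real (Suc n))) * W x + B"
      using drift_absorb by (simp add: algebra_simps)
  qed
  finally show ?case .
qed

lemma W_iter:
  shows integrable_W: "integrable (kiter K n x) W"
    and integral_W: "(\<integral>u. W u \<partial>kiter K n x) \<le> exp (- \<delta> * (\<gamma> * real n)) * W x + B"
    and integral_W': "(\<integral>u. W u \<partial>kiter K n x) \<le> W x + B"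
proof -
  have W0: "0 \<le> W u" for u using W1[of u] by simp
  have [measurable_cong]: "sets (kiter K n x) = sets borel" by (rule prob_space_kiter[OF K])
  show i: "integrable (kiter K n x) W"
    by (rule integrableI_nonneg) (use W0 drift_iter[of n x] in \<open>auto intro: le_less_trans\<close>)
  have "ennreal (\<integral>u. W u \<partial>kiter K n x) \<le> ennreal (exp (- \<delta> * (\<gamma> * real n)) * W x + B)"
    using drift_iter[of n x] nn_integral_eq_integral[OF i] W0 by simp
  moreover have "0 \<le> exp (- \<delta> * (\<gamma> * real n)) * W x + B" using W0[of x] level_nonneg by simp
  ultimately show 1: "(\<integral>u. W u \<partial>kiter K n x) \<le> exp (- \<delta> * (\<gamma> * real n)) * W x + B"
    by (simp only: ennreal_le_iff)
  have "exp (- \<delta> * (\<gamma> * real n)) * W x \<le> 1 * W x"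
    using W0[of x] delta gam by (intro mult_right_mono) auto
  with 1 show "(\<integral>u. W u \<partial>kiter K n x) \<le> W x + B" by simp
qed

text \<open>The contraction is set up for blocks of \<open>n0\<close> steps, which last about one unit of time \<open>\<gamma> n\<close>, so that no
constant depends on \<open>\<gamma>\<close>.\<close>

definition "n0 = nat \<lceil>1 / \<gamma>\<rceil>"

lemma n0_bounds: "n0 > 0" "1 \<le> \<gamma> * real n0" "\<gamma> * real n0 \<le> 1 + \<Gamma>"
proof -
  have p: "1 / \<gamma> > 0" using gam by simp
  then have r: "real n0 = of_int \<lceil>1 / \<gamma>\<rceil>" by (simp add: n0_def)
  show "n0 > 0" using p by (simp add: n0_def)
  have "1 / \<gamma> \<le> real n0" unfolding r by (rule le_of_int_ceiling)
  then show "1 \<le> \<gamma> * real n0" using gam by (simp add: field_simps)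
  have "real n0 \<le> 1 / \<gamma> + 1" unfolding r by linarith
  then have "\<gamma> * real n0 \<le> \<gamma> * (1 / \<gamma> + 1)" using gam by (intro mult_left_mono) auto
  then show "\<gamma> * real n0 \<le> 1 + \<Gamma>" using gam by (simp add: algebra_simps)
qed

text \<open>Chosen to give \<open>2 * \<beta> * B \<le> \<epsilon>\<close>; the \<open>+ 1\<close>
  allows \<open>B = 0\<close>.\<close>

definition "\<beta> = \<epsilon> / (2 * B + 1)"
text \<open>The competing rates: contraction on the small set, drift alone, and the ratio of the
  weights at the border \<open>W x + W y = R\<close> between the two regimes.\<close>

definition "\<alpha> = max (max (1 - \<epsilon> / 2) ((1 + exp (- \<delta>)) / 2))
   ((2 + \<beta> * ((1 + exp (- \<delta>)) / 2) * R) / (2 + \<beta> * R))"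

lemma R_pos: "R > 0" and beta_pos: "\<beta> > 0" and beta_level: "2 * \<beta> * B \<le> \<epsilon>"
proof -
  show R: "R > 0" using level_nonneg delta by (intro add_nonneg_pos divide_nonneg_nonneg) auto
  show "\<beta> > 0" using level_nonneg eps by (simp add: \<beta>_def)
  have "2 * \<beta> * B = \<epsilon> * (2 * B / (2 * B + 1))" by (simp add: \<beta>_def)
  also have "\<dots> \<le> \<epsilon> * 1" using eps level_nonneg by (intro mult_left_mono) auto
  finally show "2 * \<beta> * B \<le> \<epsilon>" by simp
qed

lemma alpha_bounds:
  "0 < \<alpha>" "\<alpha> < 1" "1 - \<epsilon> / 2 \<le> \<alpha>" "(1 + exp (- \<delta>)) / 2 \<le> \<alpha>" "exp (- \<delta>) \<le> \<alpha>"
  "2 + \<beta> * ((1 + exp (- \<delta>)) / 2) * R \<le> \<alpha> * (2 + \<beta> * R)"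
proof -
  have l: "exp (- \<delta>) < 1" using delta by simp
  have p: "0 < \<beta> * R" using beta_pos R_pos by simp
  have "\<beta> * R * ((1 + exp (- \<delta>)) / 2) < \<beta> * R * 1"
    using p l by (intro mult_strict_left_mono) auto
  moreover have "\<beta> * ((1 + exp (- \<delta>)) / 2) * R = \<beta> * R * ((1 + exp (- \<delta>)) / 2)" by (simp only: mult_ac)
  ultimately have "2 + \<beta> * ((1 + exp (- \<delta>)) / 2) * R < 2 + \<beta> * R"
    by (simp only: add_less_cancel_left mult_1_right)
  moreover have "0 < 2 + \<beta> * R" using p by linarith
  ultimately have "(2 + \<beta> * ((1 + exp (- \<delta>)) / 2) * R) / (2 + \<beta> * R) < 1"
    by (simp only: divide_less_eq_1_pos)
  then show "\<alpha> < 1" unfolding \<alpha>_def using eps l by simp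
  show "1 - \<epsilon> / 2 \<le> \<alpha>" unfolding \<alpha>_def by (intro max.coboundedI1 max.cobounded1)
  show 2: "(1 + exp (- \<delta>)) / 2 \<le> \<alpha>" unfolding \<alpha>_def by (intro max.coboundedI1 max.cobounded2)
  then show "exp (- \<delta>) \<le> \<alpha>" 
    by (rule order_trans[rotated]) (use delta in \<open>simp add: field_simps\<close>)
  have "0 < (1 + exp (- \<delta>)) / 2" by (simp add: add_pos_pos)
  with 2 show "0 < \<alpha>" by linarith
  have "(2 + \<beta> * ((1 + exp (- \<delta>)) / 2) * R) / (2 + \<beta> * R) \<le> \<alpha>"
    unfolding \<alpha>_def by (rule max.cobounded2)
  then show "2 + \<beta> * ((1 + exp (- \<delta>)) / 2) * R \<le> \<alpha> * (2 + \<beta> * R)"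
    using p by (subst (asm) divide_le_eq) auto
qed

lemma contraction_step:
  assumes f: "f \<in> borel_measurable borel" "\<And>x. \<bar>f x\<bar> \<le> D" and C: "C > 0"
    and osc: "\<And>x y. \<bar>f x - f y\<bar> \<le> C * (2 + \<beta> * W x + \<beta> * W y)"
  shows "\<bar>(\<integral>u. f u \<partial>kiter K n0 x) - (\<integral>u. f u \<partial>kiter K n0 y)\<bar> \<le> \<alpha> * C * (2 + \<beta> * W x + \<beta> * W y)"
proof (rule harris_contraction[where R=R and lam="exp (- \<delta>)" and B=B and \<epsilon>=\<epsilon> and D=D])
  have W0: "0 \<le> W u" for u using W1[of u] by simp
  show "0 \<le> W u" for u by (rule W0)
  show "exp (- \<delta>) < 1" using delta by simp
  show "(\<integral>u. W u \<partial>kiter K n0 x) \<le> exp (- \<delta>) * W x + B" for x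
  proof -
    have "exp (- \<delta> * (\<gamma> * real n0)) \<le> exp (- \<delta>)" using n0_bounds(2) delta by simp
    then have "exp (- \<delta> * (\<gamma> * real n0)) * W x \<le> exp (- \<delta>) * W x" using W0 by (intro mult_right_mono) auto
    then show ?thesis using integral_W[of n0 x] by simp
  qed
  show "4 * B \<le> (1 - exp (- \<delta>)) * R" using delta by (simp add: distrib_left)
qed (use kiter_measurable[OF K] integrable_W small[OF n0_bounds(2)] level_nonneg R_pos beta_pos beta_level alpha_bounds f C osc in auto)

lemma contraction_iter:
  assumes f: "f \<in> borel_measurable borel" "\<And>x. \<bar>f x\<bar> \<le> D" and C: "C > 0"
    and osc: "\<And>x y. \<bar>f x - f y\<bar> \<le> C * (2 + \<beta> * W x + \<beta> * W y)"
  shows "\<bar>(\<integral>u. f u \<partial>kiter K (n0 * k) x) - (\<integral>u. f u \<partial>kiter K (n0 * k) y)\<bar> \<le> \<alpha> ^ k * C * (2 + \<beta> * W x + \<beta> * W y)"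
proof (induction k arbitrary: x y)
  case 0
  have "(\<integral>u. f u \<partial>return borel z) = f z" for z by (rule integral_return) (use f in auto)
  then show ?case using osc by simp
next
  case (Suc k)
  define h where "h = (\<lambda>u. \<integral>v. f v \<partial>kiter K (n0 * k) u)"
  have eq: "(\<integral>u. f u \<partial>kiter K (n0 * Suc k) x) = (\<integral>u. h u \<partial>kiter K n0 x)" for x
    using kiter_integral_add[OF K f, of n0 "n0 * k"] by (simp add: h_def)
  have hm: "h \<in> borel_measurable borel" unfolding h_def by (rule kiter_integral_measurable[OF K f])
  have hb: "\<bar>h u\<bar> \<le> D" for u unfolding h_def by (rule kiter_integral_bound[OF K f])
  have "\<bar>(\<integral>u. h u \<partial>kiter K n0 x) - (\<integral>u. h u \<partial>kiter K n0 y)\<bar> \<le> \<alpha> * (\<alpha> ^ k * C) * (2 + \<beta> * W x + \<beta> * W y)"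
  proof (rule contraction_step[OF hm hb])
    show "0 < \<alpha> ^ k * C" using alpha_bounds C by simp
  qed (use Suc in \<open>simp add: h_def\<close>)
  then show ?case unfolding eq by (simp add: mult.assoc)
qed

text \<open>A block contracts by \<alpha> and lasts at most \<open>1 + \<Gamma>\<close>; this is the
  resulting rate per unit of time.\<close>

definition "\<rho> = \<alpha> powr (1 / (1 + \<Gamma>))"
abbreviation "rate n \<equiv> \<rho> powr (\<gamma> * real n)"
text \<open>\<open>1 + B\<close> bounds the growth of a test function over an incomplete block,
  \<open>(1 + \<beta>) / \<beta>\<close> is the price of exchanging \<open>W\<close> and
  \<open>1 + \<beta> * W\<close>, and \<open>1 / \<alpha>\<close> replaces the contraction missing
  from the incomplete block.\<close>

definition "A0 = (1 + B) * (1 + \<beta>) / (\<beta> * \<alpha>)"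

lemma rho_bounds: "0 < \<rho>" "\<rho> < 1"
  using alpha_bounds gam powr_less_mono'[of \<alpha> 0 "1 / (1 + \<Gamma>)"] by (auto simp: \<rho>_def)

lemma A0_nonneg: "0 \<le> A0"
  using alpha_bounds beta_pos level_nonneg by (simp add: A0_def)

text \<open>Write \<open>n = n0 * k + r\<close>. The last \<open>r\<close> steps are absorbed into
  the test function, where the drift controls them; the \<open>k\<close> whole blocks
  contract.\<close>

lemma difference_bound:
  assumes f: "f \<in> borel_measurable borel" "\<And>x. \<bar>f x\<bar> \<le> D" and fW: "\<And>x. \<bar>f x\<bar> \<le> W x"
  shows "\<bar>(\<integral>u. f u \<partial>kiter K n x) - (\<integral>u. f u \<partial>kiter K n y)\<bar> \<le> A0 * rate n * (W x + W y)"
proof -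
  define k where "k = n div n0"
  define r where "r = n mod n0"
  have n: "n = n0 * k + r" and r: "r < n0" using n0_bounds(1) by (auto simp: k_def r_def)
  define h where "h = (\<lambda>u. \<integral>v. f v \<partial>kiter K r u)"
  have eq: "(\<integral>u. f u \<partial>kiter K n x) = (\<integral>u. h u \<partial>kiter K (n0 * k) x)" for x
    unfolding n h_def by (rule kiter_integral_add[OF K f])
  have hm: "h \<in> borel_measurable borel" unfolding h_def by (rule kiter_integral_measurable[OF K f])
  have hb: "\<bar>h u\<bar> \<le> D" for u unfolding h_def by (rule kiter_integral_bound[OF K f])
  have hW: "\<bar>h u\<bar> \<le> (1 + B) * W u" for u
  proof -
    have "\<bar>h u\<bar> \<le> W u + B" unfolding h_def
      by (rule prob_space.abs_integral_le[OF prob_space_kiter(1)[OF K] _ integrable_W fW integral_W'])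
         (use f prob_space_kiter(2)[OF K] in \<open>simp cong: measurable_cong_sets\<close>)
    also have "\<dots> \<le> (1 + B) * W u" using mult_left_mono[OF W1[of u] level_nonneg] by (simp add: algebra_simps)
    finally show ?thesis .
  qed
  let ?C = "(1 + B) / \<beta>"
  have C0: "?C > 0" using level_nonneg beta_pos by (simp add: add_pos_nonneg)
  have "\<bar>h x - h y\<bar> \<le> ?C * (2 + \<beta> * W x + \<beta> * W y)" for x y
  proof -
    have "\<bar>h x - h y\<bar> \<le> (1 + B) * (W x + W y)" using hW[of x] hW[of y] by (simp add: distrib_left)
    also have "\<dots> = ?C * (\<beta> * W x + \<beta> * W y)" using beta_pos by (simp add: distrib_left)
    also have "\<dots> \<le> ?C * (2 + \<beta> * W x + \<beta> * W y)" using C0 by (intro mult_left_mono) auto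
    finally show ?thesis .
  qed
  from contraction_iter[OF hm hb C0 this, of k x y]
  have 1: "\<bar>(\<integral>u. f u \<partial>kiter K n x) - (\<integral>u. f u \<partial>kiter K n y)\<bar> \<le> \<alpha> ^ k * ?C * (2 + \<beta> * W x + \<beta> * W y)"
    unfolding eq .
  have 2: "2 + \<beta> * W x + \<beta> * W y \<le> (1 + \<beta>) * (W x + W y)"
    using W1[of x] W1[of y] by (simp add: algebra_simps)
  \<comment> \<open>The incomplete block is counted as a whole one, so
    \<open>n \<le> n0 * (k + 1)\<close>; as \<open>\<alpha> < 1\<close>, a smaller exponent means a
    larger power.\<close>
  have 3: "\<alpha> ^ k \<le> rate n / \<alpha>"
  proof -
    have "\<gamma> * real n \<le> \<gamma> * (real n0 * (real k + 1))"
    proof (rule mult_left_mono)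
      have "real n \<le> real (n0 * k + n0)" unfolding n using r by (intro of_nat_mono) simp
      then show "real n \<le> real n0 * (real k + 1)" by (simp add: algebra_simps)
    qed (use gam in simp)
    also have "\<dots> \<le> (1 + \<Gamma>) * (real k + 1)" using mult_right_mono[OF n0_bounds(3), of "real k + 1"] by (simp add: mult.assoc)
    finally have "\<gamma> * real n / (1 + \<Gamma>) \<le> real k + 1" using gam by (simp add: field_simps)
    then have "\<alpha> powr (real k + 1) \<le> \<alpha> powr (\<gamma> * real n / (1 + \<Gamma>))" using alpha_bounds by (intro powr_mono') auto
    also have "\<dots> = rate n" by (simp add: \<rho>_def powr_powr)
    also have "\<alpha> powr (real k + 1) = \<alpha> ^ k * \<alpha>" using alpha_bounds by (simp add: powr_add powr_realpow)
    finally show ?thesis using alpha_bounds by (simp add: field_simps)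
  qed
  have "\<alpha> ^ k * ?C * (2 + \<beta> * W x + \<beta> * W y) \<le> (rate n / \<alpha>) * ?C * ((1 + \<beta>) * (W x + W y))"
    using alpha_bounds(1) level_nonneg beta_pos W1[of x] W1[of y] by (intro mult_mono 2 3) auto
  also have "\<dots> = A0 * rate n * (W x + W y)" by (simp add: A0_def mult_ac)
  finally show ?thesis using 1 by linarith
qed

text \<open>By the Markov property the chain from \<open>z\<close> restarts after
  \<open>k - n\<close> steps; average the previous bound over its position at that time. The mean of
  \<open>W\<close> there is at most \<open>W z + B\<close>, so the bound is free of
  \<open>k\<close>, which yields a Cauchy sequence.\<close>

lemma difference_bound_shifted:
  assumes f: "f \<in> borel_measurable borel" "\<And>x. \<bar>f x\<bar> \<le> D" and fW: "\<And>x. \<bar>f x\<bar> \<le> W x" and nk: "n \<le> k"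
  shows "\<bar>(\<integral>u. f u \<partial>kiter K n x) - (\<integral>u. f u \<partial>kiter K k z)\<bar> \<le> A0 * rate n * (W x + W z + B)"
proof -
  let ?M = "kiter K (k - n) z"
  interpret P: prob_space ?M by (rule prob_space_kiter(1)[OF K])
  have [measurable_cong]: "sets ?M = sets borel" by (rule prob_space_kiter(2)[OF K])
  define h where "h = (\<lambda>u. \<integral>v. f v \<partial>kiter K n u)"
  have hm [measurable]: "h \<in> borel_measurable borel" unfolding h_def by (rule kiter_integral_measurable[OF K f])
  have hb: "\<bar>h u\<bar> \<le> D" for u unfolding h_def by (rule kiter_integral_bound[OF K f])
  have "(\<integral>u. f u \<partial>kiter K k z) = (\<integral>u. h u \<partial>?M)"
    using kiter_integral_add[OF K f, of "k - n" n z] nk by (simp add: h_def)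
  moreover have "(\<integral>u. h x - h u \<partial>?M) = h x - (\<integral>u. h u \<partial>?M)"
    using P.integrable_bounded[of h D] hb by (simp add: P.prob_space)
  moreover have "\<bar>\<integral>u. h x - h u \<partial>?M\<bar> \<le> A0 * rate n * (W x + W z + B)"
  proof (rule P.abs_integral_le)
    show "\<bar>h x - h u\<bar> \<le> A0 * rate n * (W x + W u)" for u
      unfolding h_def by (rule difference_bound[OF f fW])
    show "integrable ?M (\<lambda>u. A0 * rate n * (W x + W u))" using integrable_W by simp
    have "(\<integral>u. A0 * rate n * (W x + W u) \<partial>?M) = A0 * rate n * (W x + (\<integral>u. W u \<partial>?M))"
      using integrable_W[of "k - n" z] by (simp add: P.prob_space)
    also have "\<dots> \<le> A0 * rate n * (W x + W z + B)"
      using integral_W'[of "k - n" z] A0_nonneg by (intro mult_left_mono) auto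
    finally show "(\<integral>u. A0 * rate n * (W x + W u) \<partial>?M) \<le> A0 * rate n * (W x + W z + B)" .
  qed simp
  ultimately show ?thesis by (simp add: h_def)
qed

lemma rho_tendsto: "(\<lambda>n. c * rate n) \<longlonglongrightarrow> 0"
proof -
  have "\<rho> powr \<gamma> < 1" using rho_bounds gam powr_less_mono'[of \<rho> 0 \<gamma>] by simp
  then have "(\<lambda>n. c * (\<rho> powr \<gamma>) ^ n) \<longlonglongrightarrow> c * 0"
    by (intro tendsto_mult tendsto_const LIMSEQ_realpow_zero) auto
  moreover have "(\<rho> powr \<gamma>) ^ n = rate n" for n
    using rho_bounds by (simp add: powr_powr[symmetric] powr_realpow)
  ultimately show ?thesis by simp
qed

lemma ergodic:
  defines "A1 \<equiv> A0 * (1 + W 0 + B)"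
  shows "\<exists>\<pi>. invariant_prob K \<pi> \<and>
    (\<forall>x y n. wnorm W (kiter K n x) \<pi> \<le> ereal (A1 * rate n * W x)
       \<and> wnorm W (kiter K n x) (kiter K n y) \<le> ereal (A1 * rate n * (W x + W y)))"
proof -
  define \<mu> where "\<mu> = (\<lambda>m. kiter K m (0::'a))"
  define e where "e = (\<lambda>m. A0 * (2 * W 0 + B) * rate m)"
  have W0: "0 \<le> W u" for u using W1[of u] by simp
  have \<mu>: "prob_space (\<mu> m)" "sets (\<mu> m) = sets borel" "\<mu> m \<in> space (prob_algebra borel)" for m
    unfolding \<mu>_def using prob_space_kiter[OF K] kernel_space(1)[OF kiter_measurable[OF K]] by auto
  have e0: "e \<longlonglongrightarrow> 0" unfolding e_def by (rule rho_tendsto)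
  \<comment> \<open>Indicators are at most \<open>1 \<le> W\<close>, so the weighted bound covers
    events.\<close>
  have mm: "\<bar>measure (\<mu> m) A - measure (\<mu> k) A\<bar> \<le> e m" if "m \<le> k" and A: "A \<in> sets borel" for m k A
  proof -
    have "\<bar>(\<integral>u. indicat_real A u \<partial>kiter K m 0) - (\<integral>u. indicat_real A u \<partial>kiter K k 0)\<bar>
       \<le> A0 * rate m * (W 0 + W 0 + B)"
      by (rule difference_bound_shifted[of _ 1]) (use A W1 that in \<open>auto simp: indicator_def intro: order_trans[OF zero_le_one]\<close>)
    moreover have "(\<integral>u. indicat_real A u \<partial>kiter K m 0) = measure (\<mu> m) A" for m
      using A \<mu>(2)[of m] sets_eq_imp_space_eq[OF \<mu>(2)[of m]] by (simp add: \<mu>_def)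
    ultimately show ?thesis by (simp add: e_def mult_ac)
  qed
  obtain \<pi> where \<pi>: "prob_space \<pi>" "sets \<pi> = sets borel" "\<And>A m. A \<in> sets borel \<Longrightarrow> \<bar>measure (\<mu> m) A - measure \<pi> A\<bar> \<le> e m"
    using total_variation_limit[OF \<mu>(1,2) e0 mm] by blast
  interpret pi: prob_space \<pi> by (rule \<pi>(1))
  have [measurable_cong]: "sets \<pi> = sets borel" by (rule \<pi>(2))
  have \<pi>s: "\<pi> \<in> space (prob_algebra borel)" using \<pi> by (simp add: space_prob_algebra)
  have lim01: "(\<lambda>m. \<integral>x. f x \<partial>\<mu> m) \<longlonglongrightarrow> (\<integral>x. f x \<partial>\<pi>)"
    if [measurable]: "f \<in> borel_measurable borel" and f01: "\<And>x. 0 \<le> f x \<and> f x \<le> 1" for f :: "'a \<Rightarrow> real"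
  proof -
    have "\<bar>(\<integral>x. f x \<partial>\<mu> m) - (\<integral>x. f x \<partial>\<pi>)\<bar> \<le> e m" for m
    proof (rule abs_integral_diff_le_sets[OF \<mu>(1) \<pi>(1)])
      have [measurable_cong]: "sets (\<mu> m) = sets borel" by (rule \<mu>(2))
      show "f \<in> borel_measurable (\<mu> m)" by measurable
    qed (use \<mu>(2) \<pi> f01 in auto)
    then show ?thesis
      by (intro LIM_zero_cancel[OF Lim_null_comparison[OF _ e0]]) auto
  qed
  have lim: "(\<lambda>m. \<integral>x. f x \<partial>\<mu> m) \<longlonglongrightarrow> (\<integral>x. f x \<partial>\<pi>)"
    if fm [measurable]: "f \<in> borel_measurable borel" and fD: "\<And>x. \<bar>f x\<bar> \<le> D" for f :: "'a \<Rightarrow> real" and D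
  proof -
    define E where "E = \<bar>D\<bar> + 1"
    have E: "E > 0" by (simp add: E_def)
    have fE: "\<bar>f x\<bar> \<le> E" for x using fD[of x] by (simp add: E_def)
    define g where "g = (\<lambda>x. (f x + E) / (2 * E))"
    have gm: "g \<in> borel_measurable borel" unfolding g_def by measurable
    have g01: "0 \<le> g x \<and> g x \<le> 1" for x using fE[of x] E by (auto simp: g_def field_simps abs_le_iff)
    have eq: "(\<integral>x. f x \<partial>M) = 2 * E * (\<integral>x. g x \<partial>M) - E" if "prob_space M" "sets M = sets borel" for M
    proof -
      interpret prob_space M by (rule that)
      have [measurable_cong]: "sets M = sets borel" by (rule that)
      have "integrable M f" by (rule integrable_bounded[OF _ fE]) measurable
      then show ?thesis using E by (simp add: g_def prob_space)
    qed
    have "(\<lambda>m. 2 * E * (\<integral>x. g x \<partial>\<mu> m) - E) \<longlonglongrightarrow> 2 * E * (\<integral>x. g x \<partial>\<pi>) - E"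
      by (intro tendsto_intros lim01[OF gm g01])
    then show ?thesis by (simp add: eq[OF \<mu>(1,2)] eq[OF \<pi>(1,2)])
  qed
  have bound_pi: "\<bar>(\<integral>u. f u \<partial>kiter K n x) - (\<integral>u. f u \<partial>\<pi>)\<bar> \<le> A0 * rate n * (W x + W 0 + B)"
    if f: "f \<in> borel_measurable borel" "\<And>x. \<bar>f x\<bar> \<le> D" and fW: "\<And>x. \<bar>f x\<bar> \<le> W x" for f D n x
  proof (rule tendsto_upperbound)
    show "(\<lambda>m. \<bar>(\<integral>u. f u \<partial>kiter K n x) - (\<integral>u. f u \<partial>\<mu> m)\<bar>) \<longlonglongrightarrow> \<bar>(\<integral>u. f u \<partial>kiter K n x) - (\<integral>u. f u \<partial>\<pi>)\<bar>"
      by (intro tendsto_intros lim[OF f])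
    show "\<forall>\<^sub>F m in sequentially. \<bar>(\<integral>u. f u \<partial>kiter K n x) - (\<integral>u. f u \<partial>\<mu> m)\<bar> \<le> A0 * rate n * (W x + W 0 + B)"
      using eventually_ge_at_top[of n] by eventually_elim (use difference_bound_shifted[OF f fW] in \<open>simp add: \<mu>_def\<close>)
  qed simp
  \<comment> \<open>Convergence in total variation controls bounded functions only, hence the
    truncations of \<open>W\<close> and Fatou's lemma.\<close>
  have Wpi: "integrable \<pi> W"
  proof -
    define g where "g = (\<lambda>(n::nat) x. min (real n) (W x))"
    have gm [measurable]: "g n \<in> borel_measurable borel" for n unfolding g_def by measurable
    have gb: "\<bar>g n x\<bar> \<le> real n" and gW: "\<bar>g n x\<bar> \<le> W x" and g0: "0 \<le> g n x" for n x using W0[of x] by (auto simp: g_def)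
    have gint: "(\<integral>x. g n x \<partial>\<pi>) \<le> W 0 + B" for n
    proof (rule tendsto_upperbound[OF lim[OF gm gb]])
      have "(\<integral>x. g n x \<partial>\<mu> m) \<le> W 0 + B" for m
      proof -
        have [measurable_cong]: "sets (\<mu> m) = sets borel" by (rule \<mu>(2))
        have "\<bar>\<integral>x. g n x \<partial>\<mu> m\<bar> \<le> W 0 + B"
        proof (rule prob_space.abs_integral_le[OF \<mu>(1) _ _ gW])
          show "integrable (\<mu> m) W" "(\<integral>x. W x \<partial>\<mu> m) \<le> W 0 + B" unfolding \<mu>_def by (rule integrable_W integral_W')+
        qed measurable
        then show ?thesis by simp
      qed
      then show "\<forall>\<^sub>F m in sequentially. (\<integral>x. g n x \<partial>\<mu> m) \<le> W 0 + B" by simp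
    qed simp
    have "(\<integral>\<^sup>+x. ennreal (W x) \<partial>\<pi>) \<le> ennreal (W 0 + B)"
    proof -
      have "(\<lambda>n. ennreal (g n x)) \<longlonglongrightarrow> ennreal (W x)" for x
      proof (rule tendsto_eventually)
        obtain N :: nat where "W x \<le> real N" using real_arch_simple by blast
        then show "\<forall>\<^sub>F n in sequentially. ennreal (g n x) = ennreal (W x)"
          by (intro eventually_sequentiallyI[of N]) (auto simp: g_def min_def)
      qed
      then have "(\<integral>\<^sup>+x. ennreal (W x) \<partial>\<pi>) = (\<integral>\<^sup>+x. liminf (\<lambda>n. ennreal (g n x)) \<partial>\<pi>)"
        by (intro nn_integral_cong lim_imp_Liminf[symmetric]) simp_all
      also have "\<dots> \<le> liminf (\<lambda>n. \<integral>\<^sup>+x. ennreal (g n x) \<partial>\<pi>)"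
        by (rule nn_integral_liminf) measurable
      also have "\<dots> \<le> liminf (\<lambda>n. ennreal (W 0 + B))"
      proof (intro Liminf_mono always_eventually allI)
        fix n
        have "integrable \<pi> (g n)" by (rule pi.integrable_bounded[OF _ gb]) measurable
        then have "(\<integral>\<^sup>+x. ennreal (g n x) \<partial>\<pi>) = ennreal (\<integral>x. g n x \<partial>\<pi>)"
          using g0 by (intro nn_integral_eq_integral) auto
        then show "(\<integral>\<^sup>+x. ennreal (g n x) \<partial>\<pi>) \<le> ennreal (W 0 + B)" using gint[of n] by (simp add: ennreal_leI)
      qed
      also have "\<dots> = ennreal (W 0 + B)" by (simp add: Liminf_const)
      finally show ?thesis .
    qed
    then show ?thesis using W0 by (intro integrableI_nonneg) (auto intro: le_less_trans)
  qed
  \<comment> \<open>Shift the index: the mass of \<open>A\<close> under \<open>\<mu> (Suc m)\<close>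
    is the integral of \<open>h\<close> under \<open>\<mu> m\<close>, and both sequences converge.
    Total variation convergence admits an \<open>h\<close> that is merely bounded and
    measurable.\<close>
  have inv: "bind \<pi> K = \<pi>"
  proof (rule measure_eqI)
    show sb: "sets (bind \<pi> K) = sets \<pi>" using sets_bind'[OF \<pi>s K] \<pi>(2) by simp
    fix A assume "A \<in> sets (bind \<pi> K)"
    then have A: "A \<in> sets borel" using sb \<pi>(2) by simp
    interpret b: prob_space "bind \<pi> K" by (rule prob_space_bind'[OF \<pi>s K])
    have im: "indicat_real A \<in> borel_measurable borel" using A by simp
    have ib: "\<bar>indicat_real A x\<bar> \<le> 1" for x by (simp add: indicator_def)
    define h where "h = (\<lambda>u. \<integral>v. indicat_real A v \<partial>K u)"
    have hm: "h \<in> borel_measurable borel" unfolding h_def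
      by (rule measurable_kernel_integral[OF K im])
    have hb: "\<bar>h u\<bar> \<le> 1" for u unfolding h_def
      by (rule prob_space.abs_integral_le_const[OF kernel_space(2)[OF K] _ ib])
         (use im kernel_space(3)[OF K] in \<open>simp cong: measurable_cong_sets\<close>)
    have 1: "(\<integral>u. indicat_real A u \<partial>bind \<pi> K) = (\<integral>u. h u \<partial>\<pi>)"
      unfolding h_def by (rule integral_prob_bind[OF \<pi>s K im ib])
    have 2: "(\<integral>u. indicat_real A u \<partial>\<mu> (Suc m)) = (\<integral>u. h u \<partial>\<mu> m)" for m
      using integral_prob_bind[OF \<mu>(3) K im ib, of m] by (simp add: h_def \<mu>_def)
    have "(\<integral>u. indicat_real A u \<partial>bind \<pi> K) = (\<integral>u. indicat_real A u \<partial>\<pi>)"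
      unfolding 1
    proof (rule LIMSEQ_unique[OF lim[OF hm hb]])
      show "(\<lambda>m. \<integral>u. h u \<partial>\<mu> m) \<longlonglongrightarrow> (\<integral>u. indicat_real A u \<partial>\<pi>)"
        unfolding 2[symmetric] by (rule LIMSEQ_Suc[OF lim[OF im ib]])
    qed
    moreover have "A \<inter> space (bind \<pi> K) = A" "A \<inter> space \<pi> = A"
      using sets_eq_imp_space_eq[OF \<pi>(2)] sets_eq_imp_space_eq[OF sb] by auto
    ultimately have "measure (bind \<pi> K) A = measure \<pi> A" by simp
    then show "emeasure (bind \<pi> K) A = emeasure \<pi> A"
      by (simp add: b.emeasure_eq_measure pi.emeasure_eq_measure)
  qed
  have "invariant_prob K \<pi>" using \<pi> inv by (simp add: invariant_prob_def)
  moreover have "wnorm W (kiter K n x) \<pi> \<le> ereal (A1 * rate n * W x)" for n x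
  proof (rule wnorm_le_bounded[OF prob_space_kiter(1,2)[OF K] integrable_W \<pi>(1,2) Wpi])
    fix f :: "'a \<Rightarrow> real" and D
    assume f: "f \<in> borel_measurable borel" "\<And>x. \<bar>f x\<bar> \<le> W x" "\<And>x. \<bar>f x\<bar> \<le> D"
    \<comment> \<open>\<open>W x \<ge> 1\<close> turns the additive constant into a multiple of
      \<open>W x\<close>.\<close>
    have "W x + W 0 + B \<le> (1 + W 0 + B) * W x"
      using mult_left_mono[OF W1[of x], of "W 0 + B"] W0[of 0] level_nonneg by (simp add: algebra_simps)
    then have "A0 * rate n * (W x + W 0 + B) \<le> A0 * rate n * ((1 + W 0 + B) * W x)"
      using A0_nonneg by (intro mult_left_mono) auto
    then show "\<bar>(\<integral>u. f u \<partial>kiter K n x) - (\<integral>u. f u \<partial>\<pi>)\<bar> \<le> A1 * rate n * W x"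
      using bound_pi[OF f(1,3,2), of n x] by (simp add: A1_def mult_ac)
  qed
  moreover have "wnorm W (kiter K n x) (kiter K n y) \<le> ereal (A1 * rate n * (W x + W y))" for n x y
  proof (rule wnorm_le_bounded[OF prob_space_kiter(1,2)[OF K] integrable_W prob_space_kiter(1,2)[OF K] integrable_W])
    fix f :: "'a \<Rightarrow> real" and D
    assume f: "f \<in> borel_measurable borel" "\<And>x. \<bar>f x\<bar> \<le> W x" "\<And>x. \<bar>f x\<bar> \<le> D"
    have "A0 \<le> A1" unfolding A1_def using A0_nonneg mult_left_mono[of 1 "1 + W 0 + B" A0] W0[of 0] level_nonneg by simp
    then have "A0 * rate n * (W x + W y) \<le> A1 * rate n * (W x + W y)"
      using W0[of x] W0[of y] by (intro mult_right_mono) auto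
    then show "\<bar>(\<integral>u. f u \<partial>kiter K n x) - (\<integral>u. f u \<partial>kiter K n y)\<bar> \<le> A1 * rate n * (W x + W y)"
      using difference_bound[OF f(1,3,2), of n x y] by linarith
  qed
  ultimately show ?thesis by blast
qed

end

subsection \<open>Growth of weights under Gaussian steps\<close>

text \<open>For every \<open>\<tau> > 0\<close> one has \<open>sqrt X \<le> X / (2 \<tau>) + \<tau> / 2\<close>, which makes the integrand the exponential of a
quadratic polynomial. The choice \<open>\<tau> = sqrt (1 + |x|\<^sup>2) + 4 \<alpha> \<gamma>\<close> keeps its quadratic coefficient at most half the
critical one, even for large \<open>\<gamma>\<close>, and costs at most \<open>2 \<alpha> \<gamma>\<close>; this is where \<open>k > 4 \<alpha>\<close> comes from.\<close>

lemma gaussian_exp_growth: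
  fixes u x :: "'a::euclidean_space"
  assumes gam: "0 < \<gamma>" "\<gamma> \<le> \<Gamma>" and alpha: "0 < \<alpha>" and k: "0 \<le> k" and C: "0 \<le> C"
    and u: "1 + (norm u)^2 \<le> 1 + (norm x)^2 - 2 * k * \<gamma> * sqrt (1 + (norm x)^2) + \<gamma> * C"
  defines "C' \<equiv> 4 * \<alpha>^2 * \<Gamma> * k + \<alpha> * C + 2 * \<alpha>^2 * \<Gamma> * C + 2 * real DIM('a) * \<alpha>"
  shows "(\<integral>\<^sup>+y. ennreal (W_exp \<alpha> y) \<partial>gaussian u (2 * \<gamma>)) \<le>
    ennreal (exp (\<alpha> * sqrt (1 + (norm x)^2) + \<gamma> * (- \<alpha> * (k - 4 * \<alpha>) + C' / sqrt (1 + (norm x)^2))))"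
proof -
  define \<phi> where "\<phi> = sqrt (1 + (norm x)^2)"
  define \<tau> where "\<tau> = \<phi> + 4 * \<alpha> * \<gamma>"
  have \<phi>2: "\<phi>^2 = 1 + (norm x)^2" by (simp add: \<phi>_def)
  have \<phi>1: "1 \<le> \<phi>" by (simp add: \<phi>_def)
  have ag: "0 < \<alpha> * \<gamma>" using alpha gam by simp
  have \<tau>: "0 < \<tau>" "\<phi> \<le> \<tau>" "4 * \<alpha> * \<gamma> \<le> \<tau>" using \<phi>1 ag by (auto simp: \<tau>_def)
  have u': "1 + (norm u)^2 \<le> \<phi>^2 - 2 * k * \<gamma> * \<phi> + \<gamma> * C" using u by (simp add: \<phi>_def)
  define w where "w = (\<alpha> / \<tau>) *\<^sub>R u"
  define r where "r = \<alpha> / (2 * \<tau>)"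
  define z where "z = 2 * \<alpha> * \<gamma> / \<tau>"
  have z: "0 \<le> z" "z \<le> 1 / 2" using ag \<tau> by (auto simp: z_def field_simps)
  have rz: "2 * r * (2 * \<gamma>) = z" by (simp add: r_def z_def)
  define v where "v = 1 / (1 - 2 * r * (2 * \<gamma>))"
  have v: "v = 1 / (1 - z)" unfolding v_def rz ..
  have v0: "0 < v" "v \<le> 2" using z by (auto simp: v field_simps)
  \<comment> \<open>For \<open>z \<le> 1 / 2\<close> the factor \<open>v\<close> is at most
    \<open>1 + 2 * z\<close>, so its power \<open>DIM('a) / 2\<close> adds at most
    \<open>DIM('a) * z\<close> to the exponent, which is of order
    \<open>\<gamma> / \<phi>\<close>.\<close>
  have v1: "v \<le> exp (2 * z)"
  proof -
    have "v = 1 + z * v" using z by (simp add: v field_simps)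
    also have "z * v \<le> z * 2" using z v0 by (intro mult_left_mono) auto
    also have "1 + z * 2 \<le> exp (2 * z)" using exp_ge_add_one_self[of "2 * z"] by (simp add: mult.commute)
    finally show ?thesis by simp
  qed
  define E0 where "E0 = \<alpha> * ((1 + (norm u)^2) / (2 * \<tau>) + \<tau> / 2)"
  have pt: "W_exp \<alpha> y \<le> exp E0 * exp (w \<bullet> (y - u) + r * (norm (y - u))^2)" for y
  proof -
    have X: "1 + (norm y)^2 = 1 + (norm u)^2 + 2 * (u \<bullet> (y - u)) + (norm (y - u))^2"
      unfolding power2_norm_eq_inner by (simp add: inner_diff_left inner_diff_right inner_commute)
    let ?S = "sqrt (1 + (norm y)^2)"
    have "2 * (?S * \<tau>) \<le> ?S^2 + \<tau>^2" using sum_squares_ge_zero[of "?S - \<tau>" 0] by (simp add: algebra_simps power2_eq_square)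
    then have "?S * (2 * \<tau>) \<le> (1 + (norm y)^2) + \<tau>^2" by simp
    then have "?S \<le> ((1 + (norm y)^2) + \<tau>^2) / (2 * \<tau>)" using \<tau> by (simp add: pos_le_divide_eq)
    also have "\<dots> = ((1 + (norm u)^2) / (2 * \<tau>) + \<tau> / 2) + (u \<bullet> (y - u)) / \<tau> + (norm (y - u))^2 / (2 * \<tau>)"
      unfolding X using \<tau> by (simp add: add_divide_distrib power2_eq_square[of \<tau>])
    finally have "\<alpha> * ?S \<le> \<alpha> * (((1 + (norm u)^2) / (2 * \<tau>) + \<tau> / 2) + (u \<bullet> (y - u)) / \<tau> + (norm (y - u))^2 / (2 * \<tau>))"
      using alpha by (intro mult_left_mono) auto
    also have "\<dots> = E0 + (w \<bullet> (y - u) + r * (norm (y - u))^2)"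
      by (simp add: E0_def w_def r_def distrib_left)
    finally show ?thesis unfolding W_exp_def exp_add[symmetric] by simp
  qed
  have "(\<integral>\<^sup>+y. ennreal (W_exp \<alpha> y) \<partial>gaussian u (2 * \<gamma>))
     \<le> (\<integral>\<^sup>+y. ennreal (exp E0) * ennreal (exp (w \<bullet> (y - u) + r * (norm (y - u))^2)) \<partial>gaussian u (2 * \<gamma>))"
    using pt by (intro nn_integral_mono) (simp add: ennreal_mult'[symmetric] ennreal_leI)
  also have "\<dots> = ennreal (exp E0) * (\<integral>\<^sup>+y. ennreal (exp (w \<bullet> (y - u) + r * (norm (y - u))^2)) \<partial>gaussian u (2 * \<gamma>))"
    by (rule nn_integral_cmult) measurable
  also have "\<dots> = ennreal (exp E0 * (v powr (real DIM('a) / 2) * exp (v * (2 * \<gamma>) * (norm w)^2 / 2)))"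
    unfolding v_def using gam z rz
    by (subst nn_integral_gaussian_exp_quadratic) (auto simp: ennreal_mult')
  also have "\<dots> \<le> ennreal (exp E0 * (exp (real DIM('a) * z) * exp (v * \<gamma> * (norm w)^2)))"
  proof (intro ennreal_leI mult_left_mono mult_right_mono)
    have "v powr (real DIM('a) / 2) \<le> exp (2 * z) powr (real DIM('a) / 2)"
      using v0 v1 by (intro powr_mono2) auto
    then have vp: "v powr (real DIM('a) / 2) \<le> exp (real DIM('a) * z)"
      by (simp add: exp_powr_real mult.commute)
    have "v * (2 * \<gamma>) * (norm w)^2 / 2 = v * \<gamma> * (norm w)^2" by simp
    then show "v powr (real DIM('a) / 2) * exp (v * (2 * \<gamma>) * (norm w)^2 / 2) \<le> exp (real DIM('a) * z) * exp (v * \<gamma> * (norm w)^2)"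
      by (simp only:) (intro mult_right_mono vp, simp)
  qed auto
  also have "exp E0 * (exp (real DIM('a) * z) * exp (v * \<gamma> * (norm w)^2)) = exp (E0 + (real DIM('a) * z + v * \<gamma> * (norm w)^2))"
    by (simp add: exp_add)
  also have "ennreal (exp (E0 + (real DIM('a) * z + v * \<gamma> * (norm w)^2))) \<le> ennreal (exp (\<alpha> * \<phi> + \<gamma> * (- \<alpha> * (k - 4 * \<alpha>) + C' / \<phi>)))"
  proof (intro ennreal_leI, subst exp_le_cancel_iff)
    have inv: "x' / \<tau> \<le> x' / \<phi>" if "0 \<le> x'" for x' using that \<tau> \<phi>1 by (intro divide_left_mono) auto
    have 1: "(1 + (norm u)^2) / (2 * \<tau>) + \<tau> / 2 \<le> \<phi> + 2 * \<alpha> * \<gamma> - k * \<gamma> + 4 * \<alpha> * \<Gamma> * k * \<gamma> / \<phi> + \<gamma> * C / \<phi>"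
    proof -
      have "(1 + (norm u)^2) / (2 * \<tau>) + \<tau> / 2 \<le> (\<phi>^2 - 2 * k * \<gamma> * \<phi> + \<gamma> * C) / (2 * \<tau>) + \<tau> / 2"
        using u' \<tau> by (intro add_right_mono divide_right_mono) auto
      also have "\<dots> = (\<phi>^2 + \<tau>^2) / (2 * \<tau>) - k * \<gamma> * (\<phi> / \<tau>) + \<gamma> * C / \<tau> / 2"
        using \<tau> by (simp add: add_divide_distrib diff_divide_distrib power2_eq_square[of \<tau>])
      also have "(\<phi>^2 + \<tau>^2) / (2 * \<tau>) \<le> \<phi> + 2 * \<alpha> * \<gamma>"
      proof -
        have "(4 * \<alpha> * \<gamma>)^2 \<le> 4 * \<alpha> * \<gamma> * \<tau>" unfolding power2_eq_square using \<tau> ag by (intro mult_left_mono) auto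
        moreover have "\<phi>^2 + \<tau>^2 = 2 * \<tau> * \<phi> + (4 * \<alpha> * \<gamma>)^2" by (simp add: \<tau>_def power2_eq_square algebra_simps)
        ultimately have "\<phi>^2 + \<tau>^2 \<le> (\<phi> + 2 * \<alpha> * \<gamma>) * (2 * \<tau>)" by (simp add: algebra_simps)
        then show ?thesis using \<tau> by (simp add: pos_divide_le_eq)
      qed
      also have "k * \<gamma> * (\<phi> / \<tau>) \<ge> k * \<gamma> - 4 * \<alpha> * \<Gamma> * k * \<gamma> / \<phi>"
      proof -
        have "\<phi> / \<tau> = 1 - 4 * \<alpha> * \<gamma> / \<tau>" using \<tau>(1) by (simp add: \<tau>_def field_simps)
        moreover have "4 * \<alpha> * \<gamma> / \<tau> \<le> 4 * \<alpha> * \<Gamma> / \<phi>"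
          using \<tau> \<phi>1 gam alpha by (intro frac_le) auto
        ultimately have "1 - 4 * \<alpha> * \<Gamma> / \<phi> \<le> \<phi> / \<tau>" by simp
        then have "k * \<gamma> * (1 - 4 * \<alpha> * \<Gamma> / \<phi>) \<le> k * \<gamma> * (\<phi> / \<tau>)" using k gam by (intro mult_left_mono) auto
        then show ?thesis by (simp add: algebra_simps)
      qed
      moreover have "\<gamma> * C / \<tau> / 2 \<le> \<gamma> * C / \<phi>"
      proof -
        have "0 \<le> \<gamma> * C / \<tau>" using C gam \<tau>(1) by simp
        moreover have "\<gamma> * C / \<tau> \<le> \<gamma> * C / \<phi>" using inv[of "\<gamma> * C"] C gam by simp
        moreover have "p / 2 \<le> q" if "0 \<le> p" "p \<le> q" for p q :: real using that by linarith
        ultimately show ?thesis by blast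
      qed
      ultimately show ?thesis by linarith
    qed
    have 2: "real DIM('a) * z \<le> 2 * real DIM('a) * \<alpha> * \<gamma> / \<phi>"
      using inv[of "2 * real DIM('a) * \<alpha> * \<gamma>"] alpha gam by (simp add: z_def mult_ac)
    \<comment> \<open>With \<open>v \<le> 2\<close> the tilt by \<open>w\<close> costs
      \<open>2 * \<alpha>^2 * \<gamma>\<close> to leading order. Together with \<alpha> times the
      \<open>2 * \<alpha> * \<gamma>\<close> of fact \<open>1\<close> this makes the loss
      \<open>4 * \<alpha>^2 * \<gamma>\<close>, to be outweighed by
      \<open>\<alpha> * k * \<gamma>\<close>.\<close>
    have 3: "v * \<gamma> * (norm w)^2 \<le> 2 * \<alpha>^2 * \<gamma> + 2 * \<alpha>^2 * \<Gamma> * C * \<gamma> / \<phi>"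
    proof -
      have "0 \<le> 2 * k * \<gamma> * \<phi>" using k gam \<phi>1 by simp
      then have nu: "(norm u)^2 \<le> \<phi>^2 + \<gamma> * C" using u' by linarith
      have "(norm w)^2 = \<alpha>^2 * ((norm u)^2 / \<tau>^2)" by (simp add: w_def power_mult_distrib power_divide)
      also have "(norm u)^2 / \<tau>^2 \<le> (\<phi>^2 + \<gamma> * C) / \<phi>^2"
        using nu \<tau> \<phi>1 C gam by (intro frac_le power_mono) auto
      also have "\<dots> = 1 + \<gamma> * C / \<phi>^2" using \<phi>1 by (simp add: add_divide_distrib)
      also have "\<gamma> * C / \<phi>^2 \<le> \<Gamma> * C / \<phi>"
        using \<phi>1 C gam by (intro frac_le mult_right_mono) (auto simp: power2_eq_square)
      finally have "(norm w)^2 \<le> \<alpha>^2 * (1 + \<Gamma> * C / \<phi>)" by (simp add: mult_left_mono)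
      then have "v * \<gamma> * (norm w)^2 \<le> 2 * \<gamma> * (\<alpha>^2 * (1 + \<Gamma> * C / \<phi>))"
        using v0 gam by (intro mult_mono) auto
      also have "\<dots> = 2 * \<alpha>^2 * \<gamma> + 2 * \<alpha>^2 * \<Gamma> * C * \<gamma> / \<phi>" by (simp add: algebra_simps)
      finally show ?thesis .
    qed
    have "E0 \<le> \<alpha> * (\<phi> + 2 * \<alpha> * \<gamma> - k * \<gamma> + 4 * \<alpha> * \<Gamma> * k * \<gamma> / \<phi> + \<gamma> * C / \<phi>)"
      unfolding E0_def using alpha 1 by (intro mult_left_mono) auto
    then have "E0 + (real DIM('a) * z + v * \<gamma> * (norm w)^2) \<le>
       \<alpha> * (\<phi> + 2 * \<alpha> * \<gamma> - k * \<gamma> + 4 * \<alpha> * \<Gamma> * k * \<gamma> / \<phi> + \<gamma> * C / \<phi>)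
       + (2 * real DIM('a) * \<alpha> * \<gamma> / \<phi> + (2 * \<alpha>^2 * \<gamma> + 2 * \<alpha>^2 * \<Gamma> * C * \<gamma> / \<phi>))"
      using 2 3 by linarith
    also have "\<dots> = \<alpha> * \<phi> + \<gamma> * (- \<alpha> * (k - 4 * \<alpha>) + C' / \<phi>)"
      by (simp add: C'_def algebra_simps add_divide_distrib power2_eq_square)
    finally show "E0 + (real DIM('a) * z + v * \<gamma> * (norm w)^2) \<le> \<alpha> * \<phi> + \<gamma> * (- \<alpha> * (k - 4 * \<alpha>) + C' / \<phi>)" .
  qed
  finally show ?thesis unfolding \<phi>_def .
qed

text \<open>For \<open>\<phi> \<ge> 2 * C / D\<close> the error \<open>C / \<phi>\<close> takes at
  most half of the decay. For smaller \<phi> the weight is bounded, and the excess over the wanted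
  decay is O(\<gamma>), which goes into the additive constant.\<close>

lemma exponential_drift:
  fixes \<phi> :: real
  assumes gam: "0 < \<gamma>" "\<gamma> \<le> \<Gamma>" and alpha: "0 < \<alpha>" and D: "0 < D" and C: "0 \<le> C" and \<phi>: "1 \<le> \<phi>"
  shows "exp (\<alpha> * \<phi> + \<gamma> * (- D + C / \<phi>)) \<le> exp (- (D / 2) * \<gamma>) * exp (\<alpha> * \<phi>)
     + exp (2 * \<alpha> * C / D) * ((C + D / 2) * exp (\<Gamma> * C)) * \<gamma>"
proof (cases "2 * C / D \<le> \<phi>")
  case True
  then have "C / \<phi> \<le> D / 2" using \<phi> D by (simp add: field_simps)
  then have "- D + C / \<phi> \<le> - (D / 2)" by linarith
  then have "\<gamma> * (- D + C / \<phi>) \<le> \<gamma> * (- (D / 2))" using gam by (intro mult_left_mono) auto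
  then have "\<alpha> * \<phi> + \<gamma> * (- D + C / \<phi>) \<le> - (D / 2) * \<gamma> + \<alpha> * \<phi>" by (simp add: mult.commute)
  then have "exp (\<alpha> * \<phi> + \<gamma> * (- D + C / \<phi>)) \<le> exp (- (D / 2) * \<gamma>) * exp (\<alpha> * \<phi>)"
    unfolding exp_add[symmetric] exp_le_cancel_iff .
  moreover have "0 \<le> exp (2 * \<alpha> * C / D) * ((C + D / 2) * exp (\<Gamma> * C)) * \<gamma>" using C D gam by simp
  ultimately show ?thesis by linarith
next
  case False
  have W: "exp (\<alpha> * \<phi>) \<le> exp (2 * \<alpha> * C / D)"
    using mult_left_mono[of \<phi> "2 * C / D" \<alpha>] False alpha by (simp add: mult_ac)
  have "C / \<phi> \<le> C / 1" using C \<phi> by (intro divide_left_mono) auto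
  then have "\<gamma> * (- D + C / \<phi>) \<le> \<gamma> * C" using D gam by (intro mult_left_mono) auto
  then have "exp (\<gamma> * (- D + C / \<phi>)) - exp (- (D / 2) * \<gamma>) \<le> exp (\<gamma> * C) - exp (- (D / 2) * \<gamma>)" by simp
  \<comment> \<open>Factored so that \<open>1 - exp (- y) \<le> y\<close> produces the factor
    \<gamma> that the additive term must carry.\<close>
  also have "\<dots> = exp (\<gamma> * C) * (1 - exp (- (\<gamma> * (C + D / 2))))"
    by (simp add: right_diff_distrib exp_add[symmetric] algebra_simps)
  also have "\<dots> \<le> exp (\<Gamma> * C) * (\<gamma> * (C + D / 2))"
  proof (rule mult_mono)
    show "1 - exp (- (\<gamma> * (C + D / 2))) \<le> \<gamma> * (C + D / 2)"
      using exp_ge_add_one_self[of "- (\<gamma> * (C + D / 2))"] by linarith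
    show "0 \<le> 1 - exp (- (\<gamma> * (C + D / 2)))" using C D gam by simp
  qed (use gam C in \<open>auto intro: mult_right_mono\<close>)
  finally have "exp (\<alpha> * \<phi>) * (exp (\<gamma> * (- D + C / \<phi>)) - exp (- (D / 2) * \<gamma>)) \<le> exp (\<alpha> * \<phi>) * (exp (\<Gamma> * C) * (\<gamma> * (C + D / 2)))"
    by (intro mult_left_mono) auto
  also have "\<dots> \<le> exp (2 * \<alpha> * C / D) * (exp (\<Gamma> * C) * (\<gamma> * (C + D / 2)))"
    using C D gam by (intro mult_right_mono W) auto
  finally show ?thesis unfolding exp_add by (simp add: algebra_simps)
qed

section \<open>Powers of the norm under Gaussian steps\<close>

text \<open>If \<open>b \<le> a\<close>, exchange factors \<open>b\<close> for \<open>a\<close>;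
  otherwise everything is below the pure power of \<open>b\<close>. So mixed monomials of a fixed
  degree are controlled by two of them.\<close>

lemma monomial_le:
  fixes a b :: real
  assumes "0 \<le> a" "0 \<le> b" "i \<le> i'" "i + j = i' + j'"
  shows "a ^ i * b ^ j \<le> a ^ i' * b ^ j' + b ^ (i + j)"
proof (cases "b \<le> a")
  case True
  have j: "j = (i' - i) + j'" using assms by simp
  have "a ^ i * b ^ j = a ^ i * (b ^ (i' - i) * b ^ j')" unfolding j power_add ..
  also have "\<dots> \<le> a ^ i * (a ^ (i' - i) * b ^ j')"
    using assms True by (intro mult_left_mono mult_right_mono power_mono) auto
  also have "\<dots> = a ^ i' * b ^ j'" using assms by (simp add: mult.assoc[symmetric] power_add[symmetric])
  finally show ?thesis using assms by (simp add: add_increasing2)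
next
  case False
  then have "a ^ i * b ^ j \<le> b ^ i * b ^ j" using assms by (intro mult_right_mono power_mono) auto
  also have "\<dots> = b ^ (i + j)" by (simp add: power_add)
  finally show ?thesis using assms by (simp add: add_increasing)
qed

text \<open>A Taylor bound in \<open>h\<close> that keeps the linear term exactly, since the
  symmetry of the noise will cancel it. The induction multiplies by \<open>norm (u + h) ^ 2\<close>,
  itself an exact quadratic, and reduces the mixed products by \<open>monomial_le\<close>.\<close>

lemma norm_power_expansion:
  "\<exists>C\<ge>0. \<forall>u h :: 'a::euclidean_space. norm (u + h) ^ (2 * Suc q)
     \<le> norm u ^ (2 * Suc q) + 2 * real (Suc q) * norm u ^ (2 * q) * (u \<bullet> h)
       + C * (norm u ^ (2 * q) * norm h ^ 2 + norm h ^ (2 * Suc q))"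
proof (induction q)
  case 0
  have "norm (u + h) ^ 2 = norm u ^ 2 + 2 * (u \<bullet> h) + norm h ^ 2" for u h :: 'a
    unfolding power2_norm_eq_inner by (simp add: inner_add_left inner_add_right inner_commute)
  then show ?case by (intro exI[of _ 1]) auto
next
  case (Suc q)
  then obtain C where C: "C \<ge> 0" and IH: "\<And>u h :: 'a. norm (u + h) ^ (2 * Suc q)
     \<le> norm u ^ (2 * Suc q) + 2 * real (Suc q) * norm u ^ (2 * q) * (u \<bullet> h)
       + C * (norm u ^ (2 * q) * norm h ^ 2 + norm h ^ (2 * Suc q))" by blast
  define Q where "Q = real (Suc q)"
  have Q: "Q \<ge> 1" by (simp add: Q_def)
  \<comment> \<open>In this order: the leading power times the square of \<open>h\<close>, the
    product of the two linear terms, the linear term times the square of \<open>h\<close>, and the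
    old remainder times \<open>N\<close>.\<close>
  let ?C' = "1 + 4 * Q + 2 * Q + 6 * C"
  have "norm (u + h) ^ (2 * Suc (Suc q))
     \<le> norm u ^ (2 * Suc (Suc q)) + 2 * real (Suc (Suc q)) * norm u ^ (2 * Suc q) * (u \<bullet> h)
       + ?C' * (norm u ^ (2 * Suc q) * norm h ^ 2 + norm h ^ (2 * Suc (Suc q)))" for u h :: 'a
  proof -
    define a b z N where "a = norm u" and "b = norm h" and "z = u \<bullet> h" and "N = norm (u + h) ^ 2"
    have ab: "0 \<le> a" "0 \<le> b" by (auto simp: a_def b_def)
    have zab: "\<bar>z\<bar> \<le> a * b" unfolding z_def a_def b_def by (rule Cauchy_Schwarz_ineq2)
    have N: "N = a^2 + 2 * z + b^2" unfolding N_def a_def b_def z_def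
      unfolding power2_norm_eq_inner by (simp add: inner_add_left inner_add_right inner_commute)
    have N0: "0 \<le> N" by (simp add: N_def)
    have "2 * (a * b) \<le> a^2 + b^2" using sum_squares_ge_zero[of "a - b" 0] by (simp add: algebra_simps power2_eq_square)
    then have N2: "N \<le> 2 * a^2 + 2 * b^2" using zab N by linarith
    have z2: "z^2 \<le> a^2 * b^2" using zab ab by (simp add: power_mult_distrib[symmetric] abs_le_square_iff[symmetric])
    let ?P = "a ^ (2 * Suc q) * b^2" and ?B = "b ^ (2 * Suc (Suc q))"
    have m1: "a ^ (2 * q + 1) * b ^ 3 \<le> ?P + ?B"
    proof -
      have "2 * q + 1 + 3 = 2 * Suc (Suc q)" by simp
      then show ?thesis using monomial_le[OF ab, of "2 * q + 1" "2 * Suc q" 3 2] by (simp only:) simp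
    qed
    have m2: "a ^ (2 * q) * b ^ 4 \<le> ?P + ?B"
    proof -
      have "2 * q + 4 = 2 * Suc (Suc q)" by simp
      then show ?thesis using monomial_le[OF ab, of "2 * q" "2 * Suc q" 4 2] by (simp only:) simp
    qed
    have m3: "a ^ 2 * b ^ (2 * Suc q) \<le> ?P + ?B"
    proof -
      have "2 + 2 * Suc q = 2 * Suc (Suc q)" by simp
      then show ?thesis using monomial_le[OF ab, of 2 "2 * Suc q" "2 * Suc q" 2] by (simp only:) simp
    qed
    have P0: "0 \<le> ?P" "0 \<le> ?B" using ab by auto
    have p1: "a ^ (2 * Suc q) = a ^ (2 * q) * a^2" "a ^ (2 * Suc (Suc q)) = a ^ (2 * q) * a^2 * a^2"
      by (simp_all add: power2_eq_square)
    have "norm (u + h) ^ (2 * Suc (Suc q)) = norm (u + h) ^ (2 * Suc q) * N" by (simp add: N_def power2_eq_square)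
    also have "\<dots> \<le> (a ^ (2 * Suc q) + 2 * Q * a ^ (2 * q) * z + C * (a ^ (2 * q) * b^2 + b ^ (2 * Suc q))) * N"
      using IH[of u h] N0 by (intro mult_right_mono) (auto simp: a_def b_def z_def Q_def)
    also have "\<dots> = (a ^ (2 * Suc q) + 2 * Q * a ^ (2 * q) * z) * N + C * ((a ^ (2 * q) * b^2 + b ^ (2 * Suc q)) * N)"
      by (simp add: algebra_simps)
    also have "(a ^ (2 * Suc q) + 2 * Q * a ^ (2 * q) * z) * N
       = a ^ (2 * Suc (Suc q)) + 2 * (Q + 1) * a ^ (2 * Suc q) * z + (?P + 4 * Q * (a ^ (2 * q) * z^2) + 2 * Q * (a ^ (2 * q) * b^2 * z))"
      unfolding N p1 by (simp add: algebra_simps power2_eq_square)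
    also have "a ^ (2 * q) * z^2 \<le> ?P"
      using mult_left_mono[OF z2, of "a ^ (2 * q)"] ab unfolding p1 by (simp only: mult.assoc) simp
    also have "a ^ (2 * q) * b^2 * z \<le> ?P + ?B"
    proof -
      have "a ^ (2 * q) * b^2 * z \<le> a ^ (2 * q) * b^2 * (a * b)" using zab ab by (intro mult_left_mono) auto
      also have "\<dots> = a ^ (2 * q + 1) * b ^ 3" by (simp add: power2_eq_square power3_eq_cube)
      finally show ?thesis using m1 by linarith
    qed
    also have "(a ^ (2 * q) * b^2 + b ^ (2 * Suc q)) * N \<le> 6 * (?P + ?B)"
    proof -
      have "(a ^ (2 * q) * b^2 + b ^ (2 * Suc q)) * N \<le> (a ^ (2 * q) * b^2 + b ^ (2 * Suc q)) * (2 * a^2 + 2 * b^2)"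
        using N2 ab by (intro mult_left_mono) auto
      also have "\<dots> = 2 * ?P + 2 * (a ^ (2 * q) * b ^ 4) + 2 * (a ^ 2 * b ^ (2 * Suc q)) + 2 * ?B"
        unfolding p1 by (simp add: algebra_simps power2_eq_square eval_nat_numeral)
      finally have "(a ^ (2 * q) * b^2 + b ^ (2 * Suc q)) * N \<le> 2 * ?P + 2 * (a ^ (2 * q) * b ^ 4) + 2 * (a ^ 2 * b ^ (2 * Suc q)) + 2 * ?B" .
      moreover have "n \<le> 6 * (p + c)" if "n \<le> 2 * p + 2 * x + 2 * y + 2 * c" "x \<le> p + c" "y \<le> p + c" for n p c x y :: real
        using that by argo
      ultimately show ?thesis using m2 m3 by blast
    qed
    finally have F: "norm (u + h) ^ (2 * Suc (Suc q)) \<le> a ^ (2 * Suc (Suc q)) + 2 * (Q + 1) * a ^ (2 * Suc q) * z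
       + (?P + 4 * Q * ?P + 2 * Q * (?P + ?B)) + C * (6 * (?P + ?B))"
      by this (use Q C in \<open>auto intro!: mult_left_mono\<close>)
    have "4 * Q * ?P \<le> 4 * Q * (?P + ?B)" using Q P0 by (intro mult_left_mono) auto
    then have "(?P + 4 * Q * ?P + 2 * Q * (?P + ?B)) + C * (6 * (?P + ?B)) \<le> ?C' * (?P + ?B)"
      using P0 by (simp add: algebra_simps)
    moreover have S: "real (Suc (Suc q)) = Q + 1" by (simp add: Q_def)
    moreover have "n \<le> t + s3" if "n \<le> t + s1 + s2" "s1 + s2 \<le> s3" for n t s1 s2 s3 :: real
      using that by argo
    ultimately show ?thesis using F unfolding a_def[symmetric] b_def[symmetric] z_def[symmetric] S by blast
  qed
  moreover have "?C' \<ge> 0" using Q C by simp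
  ultimately show ?case by (intro exI[of _ ?C']) blast
qed

lemma nn_integral_gaussian_uminus:
  assumes [measurable]: "f \<in> borel_measurable borel"
  shows "(\<integral>\<^sup>+h. f (- h) \<partial>gaussian (0::'a::euclidean_space) s) = (\<integral>\<^sup>+h. f h \<partial>gaussian 0 s)"
proof -
  have L: "(lborel :: 'a measure) = distr lborel borel (\<lambda>x. - x)"
    using lborel_affine[of "-1" "0::'a"] by (simp add: density_1)
  have "(\<integral>\<^sup>+h. f h \<partial>gaussian (0::'a) s) = (\<integral>\<^sup>+y. ennreal (gdens 0 s y) * f y \<partial>lborel)"
    by (simp add: nn_integral_gaussian)
  also have "\<dots> = (\<integral>\<^sup>+y. ennreal (gdens 0 s (- y)) * f (- y) \<partial>lborel)"
    by (subst L, subst nn_integral_distr) auto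
  also have "\<dots> = (\<integral>\<^sup>+h. f (- h) \<partial>gaussian (0::'a) s)"
    by (simp add: nn_integral_gaussian gdens_def)
  finally show ?thesis ..
qed

text \<open>The power is dominated by the exponential of half the critical quadratic, by
  \<open>(x / n) ^ n \<le> exp x\<close> with \<open>x = (norm h)^2 / (4 * s)\<close>. The Gaussian
  integral then has \<open>v = 2\<close>.\<close>

lemma gaussian_moment:
  assumes s: "s > 0"
  shows "(\<integral>\<^sup>+h. ennreal (norm h ^ (2 * n)) \<partial>gaussian (0::'a::euclidean_space) s)
     \<le> ennreal ((4 * s) ^ n * real n ^ n * 2 powr (real DIM('a) / 2))"
proof -
  have pt: "norm h ^ (2 * n) \<le> ((4 * s) ^ n * real n ^ n) * exp (0 \<bullet> (h - 0) + 1 / (4 * s) * (norm (h - 0))^2)" for h :: 'a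
  proof (cases "n = 0")
    case True
    then show ?thesis using s by simp
  next
    case False
    define x where "x = (norm h)^2 / (4 * s)"
    have x: "0 \<le> x" using s by (simp add: x_def)
    have "(x / real n) ^ n \<le> (1 + x / real n) ^ n" using x by (intro power_mono) auto
    also have "\<dots> \<le> exp x" using x False by (intro exp_ge_one_plus_x_over_n_power_n) auto
    finally have "x ^ n \<le> real n ^ n * exp x" using False by (simp add: power_divide field_simps)
    then have "(4 * s) ^ n * x ^ n \<le> (4 * s) ^ n * (real n ^ n * exp x)" using s by (intro mult_left_mono) auto
    moreover have "(4 * s) ^ n * x ^ n = norm h ^ (2 * n)"
      unfolding power_mult_distrib[symmetric] x_def using s by (simp add: power_mult)
    moreover have "0 \<bullet> (h - 0) + 1 / (4 * s) * (norm (h - 0))^2 = x" by (simp add: x_def)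
    ultimately show ?thesis by (simp only: mult.assoc)
  qed
  have "(\<integral>\<^sup>+h. ennreal (norm h ^ (2 * n)) \<partial>gaussian (0::'a) s)
     \<le> (\<integral>\<^sup>+h. ennreal ((4 * s) ^ n * real n ^ n) * ennreal (exp (0 \<bullet> (h - 0) + 1 / (4 * s) * (norm (h - 0))^2)) \<partial>gaussian (0::'a) s)"
    using pt s by (intro nn_integral_mono) (simp add: ennreal_mult'[symmetric] ennreal_leI del: diff_zero inner_zero_left)
  also have "\<dots> = ennreal ((4 * s) ^ n * real n ^ n) * (\<integral>\<^sup>+h. ennreal (exp (0 \<bullet> (h - 0) + 1 / (4 * s) * (norm (h - 0))^2)) \<partial>gaussian (0::'a) s)"
    by (rule nn_integral_cmult) measurable
  also have "\<dots> = ennreal ((4 * s) ^ n * real n ^ n * 2 powr (real DIM('a) / 2))"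
    using s by (subst nn_integral_gaussian_exp_quadratic) (auto simp: ennreal_mult')
  finally show ?thesis .
qed

lemma gaussian_power_growth:
  "\<exists>C\<ge>0. \<forall>(u :: 'a::euclidean_space) s. s > 0 \<longrightarrow>
     (\<integral>\<^sup>+y. ennreal (norm y ^ (2 * Suc q)) \<partial>gaussian u s)
       \<le> ennreal (norm u ^ (2 * Suc q) + C * (norm u ^ (2 * q) * s + s ^ Suc q))"
proof -
  obtain C where C: "C \<ge> 0" and exp: "\<And>u h :: 'a. norm (u + h) ^ (2 * Suc q)
     \<le> norm u ^ (2 * Suc q) + 2 * real (Suc q) * norm u ^ (2 * q) * (u \<bullet> h)
       + C * (norm u ^ (2 * q) * norm h ^ 2 + norm h ^ (2 * Suc q))"
    using norm_power_expansion by blast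
  \<comment> \<open>The constants of \<open>gaussian_moment\<close> for the exponents 2 and
    \<open>2 * Suc q\<close>, with the powers of \<open>s\<close> removed.\<close>
  define c1 where "c1 = 4 * 2 powr (real DIM('a) / 2)"
  define c2 where "c2 = 4 ^ Suc q * real (Suc q) ^ Suc q * 2 powr (real DIM('a) / 2)"
  have c: "0 \<le> c1" "0 \<le> c2" by (auto simp: c1_def c2_def)
  have "(\<integral>\<^sup>+y. ennreal (norm y ^ (2 * Suc q)) \<partial>gaussian u s)
       \<le> ennreal (norm u ^ (2 * Suc q) + C * (c1 + c2) * (norm u ^ (2 * q) * s + s ^ Suc q))" if s: "s > 0" for u :: 'a and s
  proof -
    let ?G = "gaussian (0::'a) s"
    interpret prob_space ?G by (rule prob_space_gaussian[OF s])
    let ?F = "\<lambda>h. ennreal (norm (u + h) ^ (2 * Suc q))"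
    let ?H = "\<lambda>h. ennreal (norm u ^ (2 * Suc q)) + (ennreal (C * norm u ^ (2 * q)) * ennreal (norm h ^ (2 * 1)) + ennreal C * ennreal (norm h ^ (2 * Suc q)))"
    have I: "(\<integral>\<^sup>+y. ennreal (norm y ^ (2 * Suc q)) \<partial>gaussian u s) = (\<integral>\<^sup>+h. ?F h \<partial>?G)"
      unfolding gaussian_eq_distr[of u] by (subst nn_integral_distr) auto
    \<comment> \<open>averaging over \<open>h\<close> and \<open>- h\<close> removes the linear term, which would be of order \<open>sqrt s\<close>\<close>
    have sym: "?F h + ?F (- h) \<le> 2 * ?H h" for h
    proof -
      have "norm (u + h) ^ (2 * Suc q) + norm (u + - h) ^ (2 * Suc q)
        \<le> 2 * (norm u ^ (2 * Suc q) + (C * norm u ^ (2 * q) * norm h ^ (2 * 1) + C * norm h ^ (2 * Suc q)))"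
        using exp[of u h] exp[of u "- h"] by (simp only: norm_minus_cancel inner_minus_right mult_1_right) (simp add: algebra_simps)
      then have "ennreal (norm (u + h) ^ (2 * Suc q) + norm (u + - h) ^ (2 * Suc q))
        \<le> ennreal (2 * (norm u ^ (2 * Suc q) + (C * norm u ^ (2 * q) * norm h ^ (2 * 1) + C * norm h ^ (2 * Suc q))))"
        by (rule ennreal_leI)
      also have "\<dots> = 2 * ?H h"
        using C by (simp add: ennreal_mult' ennreal_plus del: power_Suc mult_Suc_right)
      finally show ?thesis by (simp add: ennreal_plus del: power_Suc mult_Suc_right)
    qed
    have "2 * (\<integral>\<^sup>+h. ?F h \<partial>?G) = (\<integral>\<^sup>+h. ?F h \<partial>?G) + (\<integral>\<^sup>+h. ?F (- h) \<partial>?G)"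
      by (subst nn_integral_gaussian_uminus) (auto simp: mult_2)
    also have "\<dots> = (\<integral>\<^sup>+h. ?F h + ?F (- h) \<partial>?G)" by (rule nn_integral_add[symmetric]) auto
    also have "\<dots> \<le> (\<integral>\<^sup>+h. 2 * ?H h \<partial>?G)" by (rule nn_integral_mono) (rule sym)
    also have "\<dots> = 2 * (\<integral>\<^sup>+h. ?H h \<partial>?G)" by (rule nn_integral_cmult) measurable
    finally have "(\<integral>\<^sup>+h. ?F h \<partial>?G) \<le> (\<integral>\<^sup>+h. ?H h \<partial>?G)"
      by (subst (asm) ennreal_mult_le_mult_iff) auto
    also have "\<dots> = ennreal (norm u ^ (2 * Suc q)) + (ennreal (C * norm u ^ (2 * q)) * (\<integral>\<^sup>+h. ennreal (norm h ^ (2 * 1)) \<partial>?G)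
        + ennreal C * (\<integral>\<^sup>+h. ennreal (norm h ^ (2 * Suc q)) \<partial>?G))"
      by (simp add: nn_integral_add nn_integral_cmult emeasure_space_1 del: power_Suc mult_Suc_right)
    also have "\<dots> \<le> ennreal (norm u ^ (2 * Suc q)) + (ennreal (C * norm u ^ (2 * q)) * ennreal (c1 * s) + ennreal C * ennreal (c2 * s ^ Suc q))"
    proof (intro add_left_mono add_mono mult_left_mono)
      show "(\<integral>\<^sup>+h. ennreal (norm h ^ (2 * 1)) \<partial>?G) \<le> ennreal (c1 * s)"
        using gaussian_moment[OF s, of 1] by (simp add: c1_def mult_ac)
      show "(\<integral>\<^sup>+h. ennreal (norm h ^ (2 * Suc q)) \<partial>?G) \<le> ennreal (c2 * s ^ Suc q)"
        using gaussian_moment[OF s, of "Suc q"] unfolding c2_def power_mult_distrib by (simp only: mult_ac)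
    qed auto
    also have "\<dots> = ennreal (norm u ^ (2 * Suc q) + (C * norm u ^ (2 * q) * (c1 * s) + C * (c2 * s ^ Suc q)))"
      using C c s by (simp add: ennreal_mult' ennreal_plus del: power_Suc mult_Suc_right)
    also have "\<dots> \<le> ennreal (norm u ^ (2 * Suc q) + C * (c1 + c2) * (norm u ^ (2 * q) * s + s ^ Suc q))"
    proof (rule ennreal_leI)
      have "0 \<le> C * c2 * (norm u ^ (2 * q) * s)" "0 \<le> C * c1 * s ^ Suc q" using C c s by auto
      then show "norm u ^ (2 * Suc q) + (C * norm u ^ (2 * q) * (c1 * s) + C * (c2 * s ^ Suc q))
        \<le> norm u ^ (2 * Suc q) + C * (c1 + c2) * (norm u ^ (2 * q) * s + s ^ Suc q)"
        by (simp add: algebra_simps)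
    qed
    finally show ?thesis unfolding I .
  qed
  moreover have "C * (c1 + c2) \<ge> 0" using C c by simp
  ultimately show ?thesis by blast
qed

subsection \<open>The PULA map\<close>

definition pula_map :: "('a::euclidean_space \<Rightarrow> 'a) \<Rightarrow> ('a \<Rightarrow> real) \<Rightarrow> real \<Rightarrow> real \<Rightarrow> 'a \<Rightarrow> 'a" where
  "pula_map gV U \<kappa> \<gamma> x = prox (\<gamma> * \<kappa>) U x - \<gamma> *\<^sub>R gV (prox (\<gamma> * \<kappa>) U x)"

lemma pula_kernel_eq: "pula_kernel gV U \<kappa> \<gamma> = (\<lambda>x. gaussian (pula_map gV U \<kappa> \<gamma> x) (2 * \<gamma>))"
  by (rule ext) (simp add: pula_kernel_def pula_map_def Let_def)

locale pula_potential =
  fixes V U :: "'a::euclidean_space \<Rightarrow> real" and gV :: "'a \<Rightarrow> 'a" and L M \<Gamma> \<kappa>hi R1 :: real and xs :: 'a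
  assumes convV: "convex_on UNIV V" and convU: "convex_on UNIV U" and U0: "\<And>x. 0 \<le> U x"
    and der: "\<And>x. (V has_derivative (\<lambda>h. gV x \<bullet> h)) (at x)"
    and lipV: "L-lipschitz_on UNIV gV" and lipU: "M-lipschitz_on UNIV U"
    and L: "0 < L" and gbar: "\<Gamma> * L < 2"
    and xs: "\<And>z. V xs \<le> V z" "norm xs \<le> R1"
begin

text \<open>Otherwise a gradient step of length \<open>1 / L\<close> would lower \<open>V\<close> by
  at least \<open>(norm (gV xs))^2 / (2 * L)\<close> below its minimum.\<close>

lemma gradient_xs: "gV xs = 0"
proof -
  define e where "e = (1 / L) *\<^sub>R gV xs"
  have "V (xs - e) \<le> V xs + gV xs \<bullet> ((xs - e) - xs) + L / 2 * (norm ((xs - e) - xs))^2"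
    by (rule descent_lemma[OF convV der lipV])
  moreover have "gV xs \<bullet> ((xs - e) - xs) = - ((norm (gV xs))^2 / L)" by (simp add: e_def power2_norm_eq_inner)
  moreover have "L / 2 * (norm ((xs - e) - xs))^2 = (norm (gV xs))^2 / L / 2"
  proof -
    have "norm ((xs - e) - xs) = norm (gV xs) / L" using L by (simp add: e_def)
    then show ?thesis using L by (simp add: power_divide power2_eq_square[of L])
  qed
  ultimately have "(norm (gV xs))^2 / L \<le> 0" using xs(1)[of "xs - e"] by argo
  then have "(norm (gV xs))^2 \<le> 0" using L by (simp add: divide_le_0_iff)
  then show ?thesis by simp
qed

context
  fixes \<kappa> \<gamma> :: real
  assumes gam: "0 < \<gamma>" "\<gamma> \<le> \<Gamma>" and kap: "0 < \<kappa>" "\<kappa> \<le> \<kappa>hi"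
begin

abbreviation "P \<equiv> prox (\<gamma> * \<kappa>) U"

lemma prox_parameter_pos: "0 < \<gamma> * \<kappa>" using gam kap by simp

lemma is_prox_P: "is_prox (\<gamma> * \<kappa>) U x (P x)"
  by (rule is_prox_prox[OF convU lipschitz_on_continuous_on[OF lipU] U0 prox_parameter_pos])

lemma step_size_bounds: "0 \<le> 2 - \<gamma> * L" "2 - \<Gamma> * L \<le> 2 - \<gamma> * L"
proof -
  have "\<gamma> * L \<le> \<Gamma> * L" using gam L by (intro mult_right_mono) auto
  then show "0 \<le> 2 - \<gamma> * L" "2 - \<Gamma> * L \<le> 2 - \<gamma> * L" using gbar by linarith+
qed

lemma pula_map_nonexpansive: "norm (pula_map gV U \<kappa> \<gamma> x - pula_map gV U \<kappa> \<gamma> y) \<le> norm (x - y)"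
proof -
  have "(norm (pula_map gV U \<kappa> \<gamma> x - pula_map gV U \<kappa> \<gamma> y))^2
      \<le> (norm (P x - P y))^2 - \<gamma> * (2 - \<gamma> * L) * ((gV (P x) - gV (P y)) \<bullet> (P x - P y))"
    unfolding pula_map_def by (rule gradient_step_bound[OF convV der lipV L]) (use gam in simp)
  also have "\<dots> \<le> (norm (P x - P y))^2"
    using gam step_size_bounds gradient_monotone[OF convV der, of "P x" "P y"] by simp
  finally have "norm (pula_map gV U \<kappa> \<gamma> x - pula_map gV U \<kappa> \<gamma> y) \<le> norm (P x - P y)"
    by (rule power2_le_imp_le) simp
  also have "\<dots> \<le> norm (x - y)" by (rule is_prox_nonexpansive[OF convU prox_parameter_pos is_prox_P is_prox_P])
  finally show ?thesis .
qed

lemma P_displacement: "norm (x - P x) \<le> \<gamma> * (\<kappa>hi * M)"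
proof -
  have M: "0 \<le> M" using lipschitz_on_nonneg[OF lipU] .
  have "norm (x - P x) \<le> \<gamma> * (\<kappa> * M)" using is_prox_displacement[OF convU prox_parameter_pos is_prox_P lipU] by (simp add: mult.assoc)
  also have "\<dots> \<le> \<gamma> * (\<kappa>hi * M)" using gam kap M by (intro mult_left_mono mult_right_mono) auto
  finally show ?thesis .
qed

text \<open>Descent is available for the distance to \<open>xs\<close>. Moving the centre to the origin produces the term
\<open>2 \<gamma> R1 |gV p|\<close>, which may grow linearly in \<open>x\<close>; it is absorbed by the gain \<open>\<gamma> c0 |gV p|\<^sup>2\<close> coming from cocoercivity.\<close>

lemma pula_map_norm_sq:
  assumes eta: "0 < \<eta>" and c: "0 \<le> c" and growth: "\<And>z. \<eta> * norm z - c \<le> U z"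
    and Us: "U xs \<le> Us" "0 \<le> Us"
  defines "c0 \<equiv> (2 - \<Gamma> * L) / L"
  shows "(norm (pula_map gV U \<kappa> \<gamma> x))^2 \<le> (norm x)^2 - 2 * \<gamma> * \<kappa> * \<eta> * norm x
     + \<gamma> * (2 * \<kappa>hi * (\<eta> * (\<Gamma> * (\<kappa>hi * M)) + c + Us) + R1^2 / c0 + 2 * R1 * (\<kappa>hi * M))"
proof -
  define p where "p = P x"
  define G where "G = norm (gV p)"
  define T where "T = pula_map gV U \<kappa> \<gamma> x"
  have T: "T = p - \<gamma> *\<^sub>R gV p" by (simp add: T_def pula_map_def p_def)
  have M: "0 \<le> M" using lipschitz_on_nonneg[OF lipU] .
  have R1: "0 \<le> R1" using norm_ge_zero order_trans xs(2) by blast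
  have c0: "0 < c0" using gbar L by (simp add: c0_def)
  have khi: "0 < \<kappa>hi" using kap by linarith
  have D: "norm (x - p) \<le> \<gamma> * (\<kappa>hi * M)" unfolding p_def by (rule P_displacement)
  have A: "(norm (T - xs))^2 \<le> (norm (p - xs))^2 - \<gamma> * (c0 * G^2)"
  proof -
    have "(norm ((p - \<gamma> *\<^sub>R gV p) - (xs - \<gamma> *\<^sub>R gV xs)))^2
      \<le> (norm (p - xs))^2 - \<gamma> * (2 - \<gamma> * L) * ((gV p - gV xs) \<bullet> (p - xs))"
      by (rule gradient_step_bound[OF convV der lipV L]) (use gam in simp)
    moreover have "c0 * G^2 \<le> (2 - \<gamma> * L) * ((gV p - gV xs) \<bullet> (p - xs))"
    proof -
      have "G^2 / L \<le> (gV p - gV xs) \<bullet> (p - xs)"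
        using gradient_cocoercive[OF convV der lipV L, of p xs] L
        by (simp add: gradient_xs G_def pos_divide_le_eq mult.commute)
      then have "(2 - \<gamma> * L) * (G^2 / L) \<le> (2 - \<gamma> * L) * ((gV p - gV xs) \<bullet> (p - xs))"
        using step_size_bounds by (intro mult_left_mono) auto
      moreover have "(2 - \<Gamma> * L) * (G^2 / L) \<le> (2 - \<gamma> * L) * (G^2 / L)"
        using step_size_bounds L by (intro mult_right_mono) auto
      ultimately show ?thesis by (simp add: c0_def)
    qed
    then have "\<gamma> * (c0 * G^2) \<le> \<gamma> * ((2 - \<gamma> * L) * ((gV p - gV xs) \<bullet> (p - xs)))" using gam by (intro mult_left_mono) auto
    ultimately show ?thesis by (simp add: T gradient_xs mult.assoc)
  qed
  have Bd: "(norm (p - xs))^2 \<le> (norm (x - xs))^2 - 2 * (\<gamma> * \<kappa>) * (U p - U xs)"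
    unfolding p_def by (rule is_prox_three_point[OF convU prox_parameter_pos is_prox_P])
  have C: "(norm T)^2 - (norm x)^2 = (norm (T - xs))^2 - (norm (x - xs))^2 + 2 * ((T - x) \<bullet> xs)"
    unfolding power2_norm_eq_inner by (simp add: inner_diff_left inner_diff_right inner_commute)
  have E: "(T - x) \<bullet> xs \<le> (\<gamma> * G + \<gamma> * (\<kappa>hi * M)) * R1"
  proof -
    have "norm (T - x) = norm ((p - x) - \<gamma> *\<^sub>R gV p)" by (simp add: T algebra_simps)
    also have "\<dots> \<le> norm (p - x) + norm (\<gamma> *\<^sub>R gV p)" by (rule norm_triangle_ineq4)
    also have "\<dots> \<le> \<gamma> * (\<kappa>hi * M) + \<gamma> * G" using D gam by (simp add: G_def norm_minus_commute)
    finally have "norm (T - x) \<le> \<gamma> * G + \<gamma> * (\<kappa>hi * M)" by simp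
    then have "norm (T - x) * norm xs \<le> (\<gamma> * G + \<gamma> * (\<kappa>hi * M)) * R1"
      using xs(2) order_trans[OF norm_ge_zero \<open>norm (T - x) \<le> _\<close>] by (intro mult_mono) auto
    then show ?thesis using norm_cauchy_schwarz[of "T - x" xs] by linarith
  qed
  have F: "2 * (\<gamma> * G * R1) - \<gamma> * (c0 * G^2) \<le> \<gamma> * (R1^2 / c0)"
  proof -
    \<comment> \<open>The gap in Young's inequality, multiplied by \<open>c0\<close>, is the square
      of \<open>c0 * G - R1\<close>.\<close>
    have "c0 * (c0 * G^2 + R1^2 / c0) = c0 * (2 * (G * R1)) + (c0 * G - R1)^2"
      using c0 by (simp add: distrib_left) (simp add: power2_eq_square algebra_simps)
    then have "c0 * (2 * (G * R1)) \<le> c0 * (c0 * G^2 + R1^2 / c0)" by simp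
    then have "2 * (G * R1) \<le> c0 * G^2 + R1^2 / c0" using c0 by (simp only: mult_le_cancel_left_pos)
    then have "\<gamma> * (2 * (G * R1)) \<le> \<gamma> * (c0 * G^2 + R1^2 / c0)" using gam by (intro mult_left_mono) auto
    then show ?thesis by (simp add: algebra_simps)
  qed
  \<comment> \<open>The growth of \<open>U\<close> is felt at \<open>p\<close>, which is within
    O(\<gamma>) of \<open>x\<close>. The leading term keeps \<kappa> itself, because the admissible
    \<alpha> is governed by the least \<kappa>; only the constants are enlarged to
    \<open>\<kappa>hi\<close>.\<close>
  have H: "- (2 * (\<gamma> * \<kappa>) * (U p - U xs)) \<le> - 2 * \<gamma> * \<kappa> * \<eta> * norm x + \<gamma> * (2 * \<kappa>hi * (\<eta> * (\<Gamma> * (\<kappa>hi * M)) + c + Us))"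
  proof -
    define K0 where "K0 = \<eta> * (\<Gamma> * (\<kappa>hi * M)) + c + Us"
    have K0: "0 \<le> K0" using eta c Us M khi gam by (simp add: K0_def)
    have "norm x \<le> norm p + norm (x - p)" by (rule norm_triangle_sub)
    moreover have "\<gamma> * (\<kappa>hi * M) \<le> \<Gamma> * (\<kappa>hi * M)" using gam khi M by (intro mult_right_mono) auto
    ultimately have "norm x - \<Gamma> * (\<kappa>hi * M) \<le> norm p" using D by linarith
    then have "\<eta> * (norm x - \<Gamma> * (\<kappa>hi * M)) \<le> \<eta> * norm p" using eta by (intro mult_left_mono) auto
    then have "\<eta> * norm x - K0 \<le> U p - U xs" using growth[of p] Us(1) by (simp add: K0_def right_diff_distrib)
    then have "2 * (\<gamma> * \<kappa>) * (\<eta> * norm x - K0) \<le> 2 * (\<gamma> * \<kappa>) * (U p - U xs)" using prox_parameter_pos by (intro mult_left_mono) auto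
    moreover have "2 * (\<gamma> * \<kappa>) * K0 \<le> \<gamma> * (2 * \<kappa>hi * K0)"
      using mult_right_mono[OF kap(2) K0] gam by (simp add: mult.assoc mult.left_commute[of _ \<gamma>])
    moreover have "2 * (\<gamma> * \<kappa>) * (\<eta> * norm x - K0) = 2 * \<gamma> * \<kappa> * \<eta> * norm x - 2 * (\<gamma> * \<kappa>) * K0"
      by (simp add: right_diff_distrib)
    moreover have "- 2 * \<gamma> * \<kappa> * \<eta> * norm x = - (2 * \<gamma> * \<kappa> * \<eta> * norm x)" by simp
    ultimately show ?thesis unfolding K0_def[symmetric] by argo
  qed
  have "(norm T)^2 - (norm x)^2 \<le> - (2 * (\<gamma> * \<kappa>) * (U p - U xs)) - \<gamma> * (c0 * G^2) + 2 * ((\<gamma> * G + \<gamma> * (\<kappa>hi * M)) * R1)"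
    using A Bd C E by argo
  also have "\<dots> = - (2 * (\<gamma> * \<kappa>) * (U p - U xs)) + (2 * (\<gamma> * G * R1) - \<gamma> * (c0 * G^2)) + \<gamma> * (2 * R1 * (\<kappa>hi * M))"
    by (simp add: algebra_simps)
  also have "\<dots> \<le> (- 2 * \<gamma> * \<kappa> * \<eta> * norm x + \<gamma> * (2 * \<kappa>hi * (\<eta> * (\<Gamma> * (\<kappa>hi * M)) + c + Us))) + \<gamma> * (R1^2 / c0) + \<gamma> * (2 * R1 * (\<kappa>hi * M))"
    by (intro add_mono F H order_refl)
  finally show ?thesis unfolding T_def[symmetric] by (simp add: distrib_left)
qed

text \<open>A gradient step contracts squared distances by \<open>1 - \<gamma> * c\<close>, hence
  distances by a square root that is at most \<open>1 - c * \<gamma> / 2\<close>. The proximal step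
  and the image of the origin add errors O(\<gamma>).\<close>

lemma pula_map_norm_strong:
  assumes m: "0 < m" and mV: "m_convex m V"
  defines "c \<equiv> m * (2 - \<Gamma> * L)"
  shows "\<gamma> * c \<le> 1" "norm (pula_map gV U \<kappa> \<gamma> x) \<le> (1 - c * \<gamma> / 2) * norm x + \<gamma> * (\<kappa>hi * M + L * R1)"
proof -
  define T where "T = (\<lambda>x. x - \<gamma> *\<^sub>R gV x)"
  have c: "0 < c" using m gbar by (simp add: c_def)
  have Tc: "(norm (T x - T y))^2 \<le> (1 - \<gamma> * c) * (norm (x - y))^2" for x y
  proof -
    have "(norm (T x - T y))^2 \<le> (norm (x - y))^2 - \<gamma> * (2 - \<gamma> * L) * ((gV x - gV y) \<bullet> (x - y))"
      unfolding T_def by (rule gradient_step_bound[OF convV der lipV L]) (use gam in simp)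
    moreover have "\<gamma> * ((2 - \<Gamma> * L) * (m * (norm (x - y))^2)) \<le> \<gamma> * ((2 - \<gamma> * L) * ((gV x - gV y) \<bullet> (x - y)))"
      using gam step_size_bounds gbar m gradient_strongly_monotone[OF mV der, of x y] by (intro mult_left_mono mult_mono) auto
    ultimately show ?thesis by (simp add: c_def algebra_simps)
  qed
  \<comment> \<open>The factor that bounds a squared norm cannot be negative: test with a unit
    vector.\<close>
  obtain e :: 'a where "e \<in> Basis" using nonempty_Basis by blast
  then have "norm e = 1" by simp
  then have "0 \<le> 1 - \<gamma> * c" using order_trans[OF zero_le_power2 Tc[of e 0]] by simp
  then show gc: "\<gamma> * c \<le> 1" by simp
  have Tn: "norm (T x - T y) \<le> (1 - c * \<gamma> / 2) * norm (x - y)" for x y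
  proof (rule power2_le_imp_le)
    have "(1 - c * \<gamma> / 2)^2 = 1 - \<gamma> * c + (c * \<gamma> / 2)^2" by (simp add: power2_eq_square algebra_simps)
    then have "1 - \<gamma> * c \<le> (1 - c * \<gamma> / 2)^2" by simp
    then have "(1 - \<gamma> * c) * (norm (x - y))^2 \<le> (1 - c * \<gamma> / 2)^2 * (norm (x - y))^2" by (intro mult_right_mono) auto
    then show "(norm (T x - T y))^2 \<le> ((1 - c * \<gamma> / 2) * norm (x - y))^2"
      using Tc[of x y] by (simp add: power_mult_distrib)
    show "0 \<le> (1 - c * \<gamma> / 2) * norm (x - y)" using gc by (intro mult_nonneg_nonneg) (auto simp: mult.commute)
  qed
  have "norm (gV 0 - gV xs) \<le> L * norm xs" using lipschitz_onD[OF lipV, of 0 xs] by (simp add: dist_norm)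
  also have "\<dots> \<le> L * R1" using xs(2) L by (intro mult_left_mono) auto
  finally have T0: "norm (T 0) \<le> \<gamma> * (L * R1)" using gam by (simp add: T_def gradient_xs)
  have "norm (P x) \<le> norm x + \<gamma> * (\<kappa>hi * M)"
    using P_displacement[of x] norm_triangle_sub[of "P x" x] by (simp add: norm_minus_commute)
  then have "(1 - c * \<gamma> / 2) * norm (P x) \<le> (1 - c * \<gamma> / 2) * (norm x + \<gamma> * (\<kappa>hi * M))"
    using gc by (intro mult_left_mono) (auto simp: mult.commute)
  also have "\<dots> = (1 - c * \<gamma> / 2) * norm x + (1 - c * \<gamma> / 2) * (\<gamma> * (\<kappa>hi * M))" by (simp add: distrib_left)
  also have "(1 - c * \<gamma> / 2) * (\<gamma> * (\<kappa>hi * M)) \<le> 1 * (\<gamma> * (\<kappa>hi * M))"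
    using c gam kap lipschitz_on_nonneg[OF lipU] by (intro mult_right_mono) auto
  finally have "(1 - c * \<gamma> / 2) * norm (P x) \<le> (1 - c * \<gamma> / 2) * norm x + \<gamma> * (\<kappa>hi * M)" by simp
  moreover have "norm (T (P x)) \<le> norm (T (P x) - T 0) + norm (T 0)" using norm_triangle_sub[of "T (P x)" "T 0"] by simp
  moreover have "norm (T (P x) - T 0) \<le> (1 - c * \<gamma> / 2) * norm (P x)" using Tn[of "P x" 0] by simp
  moreover have pT: "pula_map gV U \<kappa> \<gamma> x = T (P x)" by (simp add: T_def pula_map_def)
  ultimately show "norm (pula_map gV U \<kappa> \<gamma> x) \<le> (1 - c * \<gamma> / 2) * norm x + \<gamma> * (\<kappa>hi * M + L * R1)"
    using T0 unfolding pT distrib_left[of \<gamma>] by linarith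
qed

end

end

section \<open>Gaussian chains with common constants\<close>

definition geom_ergodic :: "('a::euclidean_space \<Rightarrow> real) \<Rightarrow> ('a \<Rightarrow> 'a measure) \<Rightarrow> real \<Rightarrow> real \<Rightarrow> real \<Rightarrow> 'a measure \<Rightarrow> bool" where
  "geom_ergodic W K \<gamma> A \<rho> \<pi> \<longleftrightarrow> invariant_prob K \<pi> \<and>
    (\<forall>x y n. wnorm W (kiter K n x) \<pi> \<le> ereal (A * \<rho> powr (\<gamma> * real n) * W x)
       \<and> wnorm W (kiter K n x) (kiter K n y) \<le> ereal (A * \<rho> powr (\<gamma> * real n) * (W x + W y)))"

text \<open>Lets the two families of kernels share the larger constant and the slower rate.\<close>

lemma geom_ergodic_mono:
  assumes "geom_ergodic W K \<gamma> A \<rho> \<pi>" "A \<le> A'" "0 \<le> A" "0 < \<rho>" "\<rho> \<le> \<rho>'" "0 \<le> \<gamma>" "\<And>x. 0 \<le> W x"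
  shows "geom_ergodic W K \<gamma> A' \<rho>' \<pi>"
proof -
  have *: "ereal (A * \<rho> powr (\<gamma> * real n) * w) \<le> ereal (A' * \<rho>' powr (\<gamma> * real n) * w)" if "0 \<le> w" for n w
    using assms that by (simp only: ereal_less_eq) (intro mult_right_mono mult_mono powr_mono2, auto)
  show ?thesis unfolding geom_ergodic_def
  proof (intro conjI allI)
    show "invariant_prob K \<pi>" using assms(1) by (simp add: geom_ergodic_def)
    show "wnorm W (kiter K n x) \<pi> \<le> ereal (A' * \<rho>' powr (\<gamma> * real n) * W x)" for n x
      by (rule order_trans[OF _ *]) (use assms(1,7) in \<open>auto simp: geom_ergodic_def\<close>)
    show "wnorm W (kiter K n x) (kiter K n y) \<le> ereal (A' * \<rho>' powr (\<gamma> * real n) * (W x + W y))" for n x y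
      by (rule order_trans[OF _ *]) (use assms(1,7) in \<open>auto simp: geom_ergodic_def\<close>)
  qed
qed

text \<open>With \<open>u\<close> and \<open>v\<close> the two integrals and
  \<open>g^2 \<le> g\<close>, the Harnack inequality reads \<open>u^2 \<le> C * v\<close>; here
  \<open>C = exp (2 * r^2)\<close> because \<open>norm (x - y) \<le> 2 * r\<close> and
  \<open>\<gamma> * n \<ge> 1\<close>. So a value \<open>u\<close> near 1 keeps \<open>v\<close>
  away from 0.\<close>

lemma gaussian_chain_small_set:
  fixes \<Phi> :: "'a::euclidean_space \<Rightarrow> 'a"
  assumes gam: "0 < \<gamma>" and ne: "\<And>x y. norm (\<Phi> x - \<Phi> y) \<le> norm (x - y)"
    and K: "K = (\<lambda>x. gaussian (\<Phi> x) (2 * \<gamma>))" "K \<in> borel \<rightarrow>\<^sub>M prob_algebra borel"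
    and n: "1 \<le> \<gamma> * real n" and xy: "norm x \<le> r" "norm y \<le> r"
    and g: "g \<in> borel_measurable borel" "\<And>u. 0 \<le> g u \<and> g u \<le> 1"
  shows "(\<integral>u. g u \<partial>kiter K n x) - (\<integral>u. g u \<partial>kiter K n y) \<le> 1 - 1 / (2 * exp (2 * r^2))"
proof -
  have "n \<noteq> 0"
  proof
    assume "n = 0"
    with n show False by simp
  qed
  then obtain k where k: "n = Suc k" using not0_implies_Suc by blast
  have gi: "integrable (kiter K n z) g" for z
    by (rule prob_space.integrable_bounded[OF prob_space_kiter(1)[OF K(2)], where C=1])
       (use g prob_space_kiter(2)[OF K(2)] in \<open>auto simp: abs_le_iff cong: measurable_cong_sets intro: order_trans[of _ 0]\<close>)
  define u v where "u = (\<integral>u. g u \<partial>kiter K n x)" and "v = (\<integral>u. g u \<partial>kiter K n y)"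
  have e: "(\<integral>\<^sup>+u. ennreal (g u) \<partial>kiter K n z) = ennreal (\<integral>u. g u \<partial>kiter K n z)" for z
    using gi g by (intro nn_integral_eq_integral) auto
  have u: "0 \<le> u" "u \<le> 1" and v: "0 \<le> v"
  proof -
    show "0 \<le> u" "0 \<le> v" unfolding u_def v_def using g by (auto intro!: integral_nonneg)
    have "\<bar>u\<bar> \<le> 1" unfolding u_def
      by (rule prob_space.abs_integral_le_const[OF prob_space_kiter(1)[OF K(2)]])
         (use g prob_space_kiter(2)[OF K(2)] in \<open>auto simp: abs_le_iff cong: measurable_cong_sets intro: order_trans[of _ 0]\<close>)
    then show "u \<le> 1" by simp
  qed
  define C where "C = exp (2 * r^2)"
  have C: "1 \<le> C" by (simp add: C_def)
  have "(ennreal u)^2 \<le> ennreal (exp ((norm (x - y))^2 / (2 * \<gamma> * real n))) * (\<integral>\<^sup>+u. (ennreal (g u))^2 \<partial>kiter K n y)"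
    using kiter_harnack[OF _ ne K, of "\<lambda>u. ennreal (g u)" k x y] gam g unfolding k[symmetric] e u_def by simp
  also have "\<dots> \<le> ennreal C * ennreal v"
  proof (rule mult_mono)
    have "(norm (x - y))^2 \<le> (2 * r)^2" using xy norm_triangle_ineq4[of x y] by (intro power_mono) auto
    then have "(norm (x - y))^2 / (2 * \<gamma> * real n) \<le> (2 * r)^2 / 2"
      using n by (intro frac_le) auto
    then show "ennreal (exp ((norm (x - y))^2 / (2 * \<gamma> * real n))) \<le> ennreal C"
      by (intro ennreal_leI) (simp add: C_def power_mult_distrib)
    have "(\<integral>\<^sup>+u. (ennreal (g u))^2 \<partial>kiter K n y) \<le> (\<integral>\<^sup>+u. ennreal (g u) \<partial>kiter K n y)"
    proof (rule nn_integral_mono)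
      fix w show "(ennreal (g w))^2 \<le> ennreal (g w)"
        using g(2)[of w] by (auto simp: ennreal_power power2_eq_square intro!: ennreal_leI mult_left_le)
    qed
    then show "(\<integral>\<^sup>+u. (ennreal (g u))^2 \<partial>kiter K n y) \<le> ennreal v" by (simp add: e v_def)
  qed auto
  also have "\<dots> = ennreal (C * v)" using C by (simp add: ennreal_mult')
  finally have "ennreal (u^2) \<le> ennreal (C * v)" using u by (simp add: ennreal_power)
  then have uv: "u^2 \<le> C * v" using C v by (simp add: ennreal_le_iff)
  \<comment> \<open>Giving away a factor 2 makes \<open>u - u^2 / (2 * C)\<close> nondecreasing on
    \<open>[0, 1]\<close> for every \<open>C \<ge> 1\<close>, with maximum at
    \<open>u = 1\<close>.\<close>
  have "u^2 / (2 * C) \<le> u^2 / C" using C by (intro divide_left_mono) auto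
  also have "\<dots> \<le> v" using uv C by (simp add: divide_le_eq mult.commute)
  finally have "u - v \<le> u - u^2 / (2 * C)" by simp
  also have "\<dots> \<le> 1 - 1 / (2 * C)"
  proof -
    have "(1 - u^2) \<le> (1 - u) * (2 * C)"
    proof -
      have "(1 - u) * (1 + u) \<le> (1 - u) * (2 * C)" using u C by (intro mult_left_mono) auto
      then show ?thesis by (simp add: power2_eq_square algebra_simps)
    qed
    then have "(1 - u^2) / (2 * C) \<le> 1 - u" using C by (simp add: pos_divide_le_eq)
    then show ?thesis by (simp add: diff_divide_distrib)
  qed
  finally show ?thesis unfolding u_def v_def C_def .
qed

text \<open>The order of the quantifiers is the point: \<open>A\<close> and \<rho> precede \<Phi>
  and \<gamma>. The level \<open>R\<close> depends on \<delta>, \<open>b\<close> and \<Gamma> only,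
  coercivity encloses its sublevel set in a ball, and the radius of this ball fixes
  \<epsilon>.\<close>

lemma gaussian_chain_ergodic:
  fixes W :: "'a::euclidean_space \<Rightarrow> real"
  assumes Wm: "W \<in> borel_measurable borel" and W1: "\<And>x. 1 \<le> W x"
    and coercive: "\<And>R. \<exists>r. \<forall>x. W x \<le> R \<longrightarrow> norm x \<le> r"
    and delta: "0 < \<delta>" and b: "0 \<le> b"
  shows "\<exists>A \<rho>. 0 \<le> A \<and> 0 < \<rho> \<and> \<rho> < 1 \<and> (\<forall>\<Phi> \<gamma>. 0 < \<gamma> \<and> \<gamma> \<le> \<Gamma>
      \<and> (\<forall>x y. norm (\<Phi> x - \<Phi> y) \<le> norm (x - y))
      \<and> (\<forall>x. (\<integral>\<^sup>+y. ennreal (W y) \<partial>gaussian (\<Phi> x) (2 * \<gamma>)) \<le> ennreal (exp (- \<delta> * \<gamma>) * W x + b * \<gamma>))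
    \<longrightarrow> (\<exists>\<pi>. geom_ergodic W (\<lambda>x. gaussian (\<Phi> x) (2 * \<gamma>)) \<gamma> A \<rho> \<pi>))"
proof -
  define R where "R = 4 * drift_level \<delta> b \<Gamma> / (1 - exp (- \<delta>)) + 1"
  obtain r where r: "\<And>x. W x \<le> R \<Longrightarrow> norm x \<le> r" using coercive by blast
  define \<epsilon> where "\<epsilon> = 1 / (2 * exp (2 * r^2))"
  have eps: "0 < \<epsilon>" "\<epsilon> \<le> 1"
  proof -
    have "1 \<le> exp (2 * r^2)" by simp
    then have "1 \<le> 2 * exp (2 * r^2)" by linarith
    then show "\<epsilon> \<le> 1" unfolding \<epsilon>_def by (subst divide_le_eq_1_pos) auto
  qed (simp add: \<epsilon>_def)
  define adm where "adm = (\<lambda>(\<Phi> :: 'a \<Rightarrow> 'a) \<gamma>. 0 < \<gamma> \<and> \<gamma> \<le> \<Gamma>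
      \<and> (\<forall>x y. norm (\<Phi> x - \<Phi> y) \<le> norm (x - y))
      \<and> (\<forall>x. (\<integral>\<^sup>+y. ennreal (W y) \<partial>gaussian (\<Phi> x) (2 * \<gamma>)) \<le> ennreal (exp (- \<delta> * \<gamma>) * W x + b * \<gamma>)))"
  have inst: "uniform_drift (\<lambda>x. gaussian (\<Phi> x) (2 * \<gamma>)) W \<gamma> \<Gamma> \<delta> b \<epsilon>" if adm: "adm \<Phi> \<gamma>" for \<Phi> \<gamma>
  proof -
    have g: "0 < \<gamma>" "\<gamma> \<le> \<Gamma>" and ne: "\<And>x y. norm (\<Phi> x - \<Phi> y) \<le> norm (x - y)"
      and dr: "\<And>x. (\<integral>\<^sup>+y. ennreal (W y) \<partial>gaussian (\<Phi> x) (2 * \<gamma>)) \<le> ennreal (exp (- \<delta> * \<gamma>) * W x + b * \<gamma>)"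
      using adm by (auto simp: adm_def)
    have "1-lipschitz_on UNIV \<Phi>" using ne by (intro lipschitz_onI) (auto simp: dist_norm)
    then have "\<Phi> \<in> borel_measurable borel" by (intro borel_measurable_continuous_onI lipschitz_on_continuous_on)
    then have K: "markov_kernel (\<lambda>x. gaussian (\<Phi> x) (2 * \<gamma>))"
      using g by (intro gaussian_kernel_measurable) auto
    show ?thesis
    proof (unfold_locales; (fact K Wm W1 g delta b dr eps)?)
      fix x y :: 'a and n :: nat and h :: "'a \<Rightarrow> real"
      assume n: "1 \<le> \<gamma> * real n" and WR: "W x + W y \<le> 4 * drift_level \<delta> b \<Gamma> / (1 - exp (- \<delta>)) + 1"
        and h: "h \<in> borel_measurable borel" "\<And>u. 0 \<le> h u \<and> h u \<le> 1"
      have "norm x \<le> r" "norm y \<le> r" using WR W1[of x] W1[of y] by (auto intro!: r simp: R_def)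
      from gaussian_chain_small_set[OF g(1) ne refl K n this h]
      show "(\<integral>u. h u \<partial>kiter (\<lambda>x. gaussian (\<Phi> x) (2 * \<gamma>)) n x) - (\<integral>u. h u \<partial>kiter (\<lambda>x. gaussian (\<Phi> x) (2 * \<gamma>)) n y) \<le> 1 - \<epsilon>"
        by (simp add: \<epsilon>_def)
    qed
  qed
  have "\<exists>A \<rho>. 0 \<le> A \<and> 0 < \<rho> \<and> \<rho> < 1 \<and> (\<forall>\<Phi> \<gamma>. adm \<Phi> \<gamma>
    \<longrightarrow> (\<exists>\<pi>. geom_ergodic W (\<lambda>x. gaussian (\<Phi> x) (2 * \<gamma>)) \<gamma> A \<rho> \<pi>))"
  \<comment> \<open>\<open>A0\<close> and \<open>\<rho>\<close> do not depend on the chain, but \<open>\<rho> < 1\<close> is only known once some admissible chain exists\<close>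
  proof (cases "\<exists>\<Phi> \<gamma>. adm \<Phi> \<gamma>")
    case False
    then show ?thesis by (intro exI[of _ 0] exI[of _ "1/2"]) simp
  next
    case True
    then obtain \<Phi>0 \<gamma>0 where a0: "adm \<Phi>0 \<gamma>0" by blast
    interpret u0: uniform_drift "\<lambda>x. gaussian (\<Phi>0 x) (2 * \<gamma>0)" W \<gamma>0 \<Gamma> \<delta> b \<epsilon> by (rule inst[OF a0])
    let ?A = "u0.A0 * (1 + W 0 + drift_level \<delta> b \<Gamma>)"
    have "\<exists>\<pi>. geom_ergodic W (\<lambda>x. gaussian (\<Phi> x) (2 * \<gamma>)) \<gamma> ?A u0.\<rho> \<pi>" if "adm \<Phi> \<gamma>" for \<Phi> \<gamma>
      using uniform_drift.ergodic[OF inst[OF that]] unfolding geom_ergodic_def .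
    moreover have "0 \<le> ?A" using u0.A0_nonneg u0.level_nonneg W1[of 0] by (intro mult_nonneg_nonneg) auto
    ultimately show ?thesis using u0.rho_bounds by (intro exI[of _ ?A] exI[of _ u0.\<rho>]) simp
  qed
  then show ?thesis unfolding adm_def .
qed

subsection \<open>Uniform ergodicity\<close>

text \<open>The descent estimate needs \<open>U\<close> at the minimiser of \<open>V\<close>,
  whereas H1 bounds it at some other point; Lipschitz continuity carries the bound over a distance
  of at most \<open>R1 + R2\<close>.\<close>

lemma H1_family_potential:
  fixes V U :: "'p \<Rightarrow> 'a::euclidean_space \<Rightarrow> real"
  assumes H1: "H1_family \<Theta> V gV U L M" and L: "0 < L" and gbar: "\<Gamma> * L < 2" and M: "0 \<le> M"
  shows "\<exists>R1 Us. 0 \<le> R1 \<and> 0 \<le> Us \<and>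
    (\<forall>\<theta>\<in>\<Theta>. \<exists>xs. pula_potential (V \<theta>) (U \<theta>) (gV \<theta>) L M \<Gamma> R1 xs \<and> U \<theta> xs \<le> Us)"
proof -
  obtain R1 where R1: "R1 \<ge> 0" "\<And>\<theta>. \<theta> \<in> \<Theta> \<Longrightarrow> \<exists>xs. (\<forall>z. V \<theta> xs \<le> V \<theta> z) \<and> norm xs \<le> R1"
    using H1 unfolding H1_family_def by metis
  obtain R2 R3 where R2: "R2 \<ge> 0" "R3 \<ge> 0" "\<And>\<theta>. \<theta> \<in> \<Theta> \<Longrightarrow> \<exists>xs. norm xs \<le> R2 \<and> \<bar>U \<theta> xs\<bar> \<le> R3"
    using H1 unfolding H1_family_def by metis
  have "\<exists>xs. pula_potential (V \<theta>) (U \<theta>) (gV \<theta>) L M \<Gamma> R1 xs \<and> U \<theta> xs \<le> R3 + M * (R1 + R2)" if \<theta>: "\<theta> \<in> \<Theta>" for \<theta>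
  proof -
    obtain xs where xs: "\<And>z. V \<theta> xs \<le> V \<theta> z" "norm xs \<le> R1" using R1(2)[OF \<theta>] by blast
    obtain ys where ys: "norm ys \<le> R2" "\<bar>U \<theta> ys\<bar> \<le> R3" using R2(3)[OF \<theta>] by blast
    have lip: "M-lipschitz_on UNIV (U \<theta>)" using H1 \<theta> by (simp add: H1_family_def)
    have "U \<theta> xs - U \<theta> ys \<le> M * norm (xs - ys)" using lipschitz_onD[OF lip, of xs ys] by (simp add: dist_norm)
    also have "\<dots> \<le> M * (R1 + R2)" using xs(2) ys(1) norm_triangle_ineq4[of xs ys] M by (intro mult_left_mono) auto
    finally have "U \<theta> xs \<le> R3 + M * (R1 + R2)" using ys(2) by linarith
    moreover have "pula_potential (V \<theta>) (U \<theta>) (gV \<theta>) L M \<Gamma> R1 xs"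
      using H1 \<theta> L gbar xs by unfold_locales (auto simp: H1_family_def)
    ultimately show ?thesis by blast
  qed
  moreover have "0 \<le> R3 + M * (R1 + R2)" using R1 R2 M by simp
  ultimately show ?thesis using R1(1) by blast
qed

lemma H1_family_lipschitz_nonneg:
  assumes "H1_family \<Theta> V gV U L M" "\<Theta> \<noteq> {}"
  shows "0 \<le> M" "0 \<le> L"
  using assms lipschitz_on_nonneg unfolding H1_family_def by blast+

lemma W_exp_coercive:
  assumes "0 < \<alpha>" "W_exp \<alpha> x \<le> R"
  shows "norm x \<le> R / \<alpha>"
proof -
  have "norm x = sqrt ((norm x)^2)" by simp
  also have "\<dots> \<le> sqrt (1 + (norm x)^2)" by (intro real_sqrt_le_mono) simp
  finally have "\<alpha> * norm x \<le> \<alpha> * sqrt (1 + (norm x)^2)" using assms by (intro mult_left_mono) auto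
  also have "\<dots> \<le> W_exp \<alpha> x" unfolding W_exp_def using exp_ge_add_one_self[of "\<alpha> * sqrt (1 + (norm x)^2)"] by linarith
  finally show ?thesis using assms by (simp add: pos_le_divide_eq mult.commute)
qed

lemma family_ergodic_exp:
  fixes V U :: "'p \<Rightarrow> 'a::euclidean_space \<Rightarrow> real"
  assumes H1: "H1_family \<Theta> V gV U L M" and ne: "\<Theta> \<noteq> {}"
    and kap: "0 < \<kappa>lo" "\<kappa>lo \<le> \<kappa>hi" and gpos: "0 < \<Gamma>" and gbar: "\<Gamma> < 2 / L"
    and eta: "0 < \<eta>" and c: "0 \<le> c" and growth: "\<And>\<theta> x. \<theta> \<in> \<Theta> \<Longrightarrow> \<eta> * norm x - c \<le> U \<theta> x"
    and alpha: "0 < \<alpha>" "\<alpha> < \<kappa>lo * \<eta> / 4"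
  shows "\<exists>A \<rho>. 0 \<le> A \<and> 0 < \<rho> \<and> \<rho> < 1 \<and> (\<forall>\<theta>\<in>\<Theta>. \<forall>\<kappa> \<gamma>. \<kappa>lo \<le> \<kappa> \<and> \<kappa> \<le> \<kappa>hi \<and> 0 < \<gamma> \<and> \<gamma> \<le> \<Gamma> \<longrightarrow>
     (\<exists>\<pi>. geom_ergodic (W_exp \<alpha>) (pula_kernel (gV \<theta>) (U \<theta>) \<kappa> \<gamma>) \<gamma> A \<rho> \<pi>))"
proof -
  note M = H1_family_lipschitz_nonneg(1)[OF H1 ne]
  \<comment> \<open>Division by 0 gives 0, so \<open>0 < \<Gamma>\<close> and
    \<open>\<Gamma> < 2 / L\<close> exclude \<open>L = 0\<close> as well.\<close>
  have L: "0 < L"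
  proof (rule ccontr)
    assume "\<not> 0 < L"
    then have "2 / L \<le> 0" by (simp add: divide_le_0_iff)
    then show False using less_le_trans[OF less_trans[OF gpos gbar]] by blast
  qed
  have gL: "\<Gamma> * L < 2" using gbar L by (simp add: pos_less_divide_eq)
  obtain R1 Us where R1: "0 \<le> R1" "0 \<le> Us"
    and pot: "\<And>\<theta>. \<theta> \<in> \<Theta> \<Longrightarrow> \<exists>xs. pula_potential (V \<theta>) (U \<theta>) (gV \<theta>) L M \<Gamma> R1 xs \<and> U \<theta> xs \<le> Us"
    using H1_family_potential[OF H1 L gL M] by blast
  define C0 where "C0 = 2 * \<kappa>hi * (\<eta> * (\<Gamma> * (\<kappa>hi * M)) + c + Us) + R1^2 / ((2 - \<Gamma> * L) / L) + 2 * R1 * (\<kappa>hi * M)"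
  \<comment> \<open>The extra term pays for
    \<open>sqrt (1 + (norm x)^2) \<le> 1 + norm x\<close>.\<close>
  define C where "C = C0 + 2 * \<kappa>hi * \<eta>"
  define k where "k = \<kappa>lo * \<eta>"
  define D where "D = \<alpha> * (k - 4 * \<alpha>)"
  define C' where "C' = 4 * \<alpha>^2 * \<Gamma> * k + \<alpha> * C + 2 * \<alpha>^2 * \<Gamma> * C + 2 * real DIM('a) * \<alpha>"
  define b where "b = exp (2 * \<alpha> * C' / D) * ((C' + D / 2) * exp (\<Gamma> * C'))"
  have C0: "0 \<le> C0" unfolding C0_def using kap M eta c R1 gpos gL L by (intro add_nonneg_nonneg mult_nonneg_nonneg divide_nonneg_nonneg) auto
  have C: "0 \<le> C" using C0 kap eta by (simp add: C_def)
  have k: "0 \<le> k" using kap eta by (simp add: k_def)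
  have D: "0 < D" using alpha by (simp add: D_def k_def)
  have C': "0 \<le> C'" using k C alpha gpos by (simp add: C'_def)
  have b: "0 \<le> b" using C' D by (simp add: b_def)
  have Wm: "W_exp \<alpha> \<in> borel_measurable (borel :: 'a measure)" unfolding W_exp_def by measurable
  have W1: "1 \<le> W_exp \<alpha> x" for x :: 'a using alpha by (simp add: W_exp_def)
  have co: "\<exists>r. \<forall>x::'a. W_exp \<alpha> x \<le> R \<longrightarrow> norm x \<le> r" for R
    using W_exp_coercive[OF alpha(1)] by blast
  obtain A \<rho> where A: "0 \<le> A" "0 < \<rho>" "\<rho> < 1"
    and erg: "\<And>(\<Phi> :: 'a \<Rightarrow> 'a) \<gamma>. 0 < \<gamma> \<Longrightarrow> \<gamma> \<le> \<Gamma> \<Longrightarrow> (\<And>x y. norm (\<Phi> x - \<Phi> y) \<le> norm (x - y))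
      \<Longrightarrow> (\<And>x. (\<integral>\<^sup>+y. ennreal (W_exp \<alpha> y) \<partial>gaussian (\<Phi> x) (2 * \<gamma>)) \<le> ennreal (exp (- (D / 2) * \<gamma>) * W_exp \<alpha> x + b * \<gamma>))
      \<Longrightarrow> \<exists>\<pi>. geom_ergodic (W_exp \<alpha>) (\<lambda>x. gaussian (\<Phi> x) (2 * \<gamma>)) \<gamma> A \<rho> \<pi>"
    using gaussian_chain_ergodic[OF Wm W1 co half_gt_zero[OF D] b, of \<Gamma>] by blast
  have "\<exists>\<pi>. geom_ergodic (W_exp \<alpha>) (pula_kernel (gV \<theta>) (U \<theta>) \<kappa> \<gamma>) \<gamma> A \<rho> \<pi>"
    if \<theta>: "\<theta> \<in> \<Theta>" and kg: "\<kappa>lo \<le> \<kappa>" "\<kappa> \<le> \<kappa>hi" "0 < \<gamma>" "\<gamma> \<le> \<Gamma>" for \<theta> \<kappa> \<gamma>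
  proof -
    obtain xs where pp: "pula_potential (V \<theta>) (U \<theta>) (gV \<theta>) L M \<Gamma> R1 xs" and Uxs: "U \<theta> xs \<le> Us"
      using pot[OF \<theta>] by blast
    interpret pula_potential "V \<theta>" "U \<theta>" "gV \<theta>" L M \<Gamma> \<kappa>hi R1 xs by (rule pp)
    have k0: "0 < \<kappa>" using kap kg by linarith
    show ?thesis unfolding pula_kernel_eq
    proof (rule erg[OF kg(3,4)])
      show "norm (pula_map (gV \<theta>) (U \<theta>) \<kappa> \<gamma> x - pula_map (gV \<theta>) (U \<theta>) \<kappa> \<gamma> y) \<le> norm (x - y)" for x y
        by (rule pula_map_nonexpansive[OF kg(3,4) k0 kg(2)])
      fix x
      let ?u = "pula_map (gV \<theta>) (U \<theta>) \<kappa> \<gamma> x" and ?\<phi> = "sqrt (1 + (norm x)^2)"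
      have "(norm ?u)^2 \<le> (norm x)^2 - 2 * \<gamma> * \<kappa> * \<eta> * norm x + \<gamma> * C0"
        unfolding C0_def by (rule pula_map_norm_sq[OF kg(3,4) k0 kg(2) eta c growth[OF \<theta>] Uxs R1(2)])
      moreover have "2 * k * \<gamma> * ?\<phi> \<le> 2 * \<gamma> * \<kappa> * \<eta> * norm x + \<gamma> * (2 * \<kappa>hi * \<eta>)"
      proof -
        have "?\<phi> \<le> 1 + norm x" by (rule real_le_lsqrt) (auto simp: power2_eq_square algebra_simps)
        then have "2 * \<gamma> * (k * ?\<phi>) \<le> 2 * \<gamma> * (k * (1 + norm x))" using k kg by (intro mult_left_mono) auto
        also have "\<dots> \<le> 2 * \<gamma> * (\<kappa> * \<eta> * (1 + norm x))" using kg eta by (intro mult_left_mono mult_right_mono) (auto simp: k_def)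
        also have "\<dots> = 2 * \<gamma> * \<kappa> * \<eta> * norm x + \<gamma> * (2 * \<kappa> * \<eta>)" by (simp add: algebra_simps)
        also have "\<gamma> * (2 * \<kappa> * \<eta>) \<le> \<gamma> * (2 * \<kappa>hi * \<eta>)" using kg eta by (intro mult_left_mono mult_right_mono) auto
        finally show ?thesis by (simp add: mult_ac)
      qed
      ultimately have "1 + (norm ?u)^2 \<le> 1 + (norm x)^2 - 2 * k * \<gamma> * ?\<phi> + \<gamma> * C"
        unfolding C_def distrib_left[of \<gamma>] by linarith
      from gaussian_exp_growth[OF kg(3,4) alpha(1) k C this]
      have "(\<integral>\<^sup>+y. ennreal (W_exp \<alpha> y) \<partial>gaussian ?u (2 * \<gamma>)) \<le> ennreal (exp (\<alpha> * ?\<phi> + \<gamma> * (- D + C' / ?\<phi>)))"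
        unfolding C'_def D_def by simp
      also have "\<dots> \<le> ennreal (exp (- (D / 2) * \<gamma>) * W_exp \<alpha> x + b * \<gamma>)"
        using exponential_drift[OF kg(3,4) alpha(1) D C', of ?\<phi>] unfolding W_exp_def b_def by (intro ennreal_leI) simp
      finally show "(\<integral>\<^sup>+y. ennreal (W_exp \<alpha> y) \<partial>gaussian ?u (2 * \<gamma>)) \<le> ennreal (exp (- (D / 2) * \<gamma>) * W_exp \<alpha> x + b * \<gamma>)" .
    qed
  qed
  then show ?thesis using A by (intro exI[of _ A] exI[of _ \<rho>]) simp
qed

text \<open>Concavity of \<open>y \<mapsto> y powr a\<close>, in a form whose coefficients are nonnegative, so that it can be
integrated over \<open>ennreal\<close>.\<close>

lemma powr_le_tangent:
  fixes s y a :: real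
  assumes "0 < s" "0 < y" "0 < a" "a \<le> 1"
  shows "y powr a \<le> (1 - a) * s powr a + a * s powr (a - 1) * y"
proof -
  have "y powr a * s powr (1 - a) \<le> a * y + (1 - a) * s"
    using assms by (intro Youngs_inequality_0) auto
  then have "(y powr a * s powr (1 - a)) * s powr (a - 1) \<le> (a * y + (1 - a) * s) * s powr (a - 1)"
    by (rule mult_right_mono) simp
  moreover have "(y powr a * s powr (1 - a)) * s powr (a - 1) = y powr a"
    using assms by (simp add: mult.assoc powr_add[symmetric])
  moreover have "s * s powr (a - 1) = s powr a"
    using assms by (simp add: powr_mult_base)
  moreover have "(a * y + (1 - a) * s) * s powr (a - 1) = (1 - a) * (s * s powr (a - 1)) + a * s powr (a - 1) * y"
    by (simp add: algebra_simps)
  ultimately show ?thesis by (simp only:)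
qed

text \<open>The tangent at \<open>s\<close> gives Jensen's inequality; the tangent at
  \<open>u\<close> then expands \<open>(u + b * \<gamma>) powr a\<close> to first order, with an
  error O(\<gamma>). Its slope is bounded because \<open>w \<ge> 1\<close> keeps \<open>u\<close>
  above \<open>exp (- (\<delta> * \<Gamma>))\<close>.\<close>

lemma powr_drift:
  assumes \<mu>: "prob_space \<mu>" and Wm: "W \<in> borel_measurable \<mu>" and W1: "\<And>x. 1 \<le> W x" and w: "1 \<le> w"
    and dr: "(\<integral>\<^sup>+y. ennreal (W y) \<partial>\<mu>) \<le> ennreal (exp (- \<delta> * \<gamma>) * w + b * \<gamma>)"
    and a: "0 < a" "a \<le> 1" and b: "0 \<le> b" and gam: "0 < \<gamma>" "\<gamma> \<le> \<Gamma>" and delta: "0 < \<delta>"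
  shows "(\<integral>\<^sup>+y. ennreal (W y powr a) \<partial>\<mu>) \<le> ennreal (exp (- (a * \<delta>) * \<gamma>) * w powr a + (b * exp (\<delta> * \<Gamma>)) * \<gamma>)"
proof -
  interpret prob_space \<mu> by (rule \<mu>)
  note [measurable] = Wm
  define u where "u = exp (- \<delta> * \<gamma>) * w"
  define s where "s = u + b * \<gamma>"
  have u: "0 < u" using w by (simp add: u_def)
  have bg: "0 \<le> b * \<gamma>" using b gam by simp
  have s: "0 < s" using u bg by (simp add: s_def)
  have W0: "0 < W x" "0 \<le> W x" for x using W1[of x] by auto
  have "(\<integral>\<^sup>+y. ennreal (W y powr a) \<partial>\<mu>) \<le> (\<integral>\<^sup>+y. ennreal ((1 - a) * s powr a) + ennreal (a * s powr (a - 1)) * ennreal (W y) \<partial>\<mu>)"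
  proof (rule nn_integral_mono)
    fix y
    show "ennreal (W y powr a) \<le> ennreal ((1 - a) * s powr a) + ennreal (a * s powr (a - 1)) * ennreal (W y)"
      using powr_le_tangent[OF s W0(1)[of y] a] a W0(2)[of y]
      by (simp add: ennreal_mult'[symmetric] ennreal_plus[symmetric] ennreal_leI del: ennreal_plus)
  qed
  also have "\<dots> = ennreal ((1 - a) * s powr a) + ennreal (a * s powr (a - 1)) * (\<integral>\<^sup>+y. ennreal (W y) \<partial>\<mu>)"
    by (simp add: nn_integral_add nn_integral_cmult emeasure_space_1)
  also have "\<dots> \<le> ennreal ((1 - a) * s powr a) + ennreal (a * s powr (a - 1)) * ennreal s"
    using dr by (intro add_left_mono mult_left_mono) (auto simp: s_def u_def)
  also have "\<dots> = ennreal (s powr a)"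
  proof -
    have "s * s powr (a - 1) = s powr a" using s by (simp add: powr_mult_base)
    then have "(1 - a) * s powr a + a * s powr (a - 1) * s = s powr a" by (simp add: algebra_simps)
    then show ?thesis using a s by (simp add: ennreal_mult'[symmetric] ennreal_plus[symmetric] del: ennreal_plus)
  qed
  also have "\<dots> \<le> ennreal (exp (- (a * \<delta>) * \<gamma>) * w powr a + (b * exp (\<delta> * \<Gamma>)) * \<gamma>)"
  proof (rule ennreal_leI)
    have "s powr a \<le> (1 - a) * u powr a + a * u powr (a - 1) * s" by (rule powr_le_tangent[OF u s a])
    also have "\<dots> = u powr a + a * u powr (a - 1) * (b * \<gamma>)"
    proof -
      have "u * u powr (a - 1) = u powr a" using u by (simp add: powr_mult_base)
      then show ?thesis by (simp add: s_def algebra_simps)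
    qed
    also have "u powr a = exp (- (a * \<delta>) * \<gamma>) * w powr a"
      using w by (simp add: u_def powr_mult exp_powr_real mult_ac)
    also have "a * u powr (a - 1) * (b * \<gamma>) \<le> exp (\<delta> * \<Gamma>) * (b * \<gamma>)"
    proof (rule mult_right_mono[OF _ bg])
      have "exp (- (\<delta> * \<Gamma>)) \<le> exp (- \<delta> * \<gamma>) * 1" using delta gam by simp
      also have "\<dots> \<le> u" unfolding u_def using w by (intro mult_left_mono) auto
      finally have "u powr (a - 1) \<le> exp (- (\<delta> * \<Gamma>)) powr (a - 1)" using a by (intro powr_mono2') auto
      also have "\<dots> = exp (\<delta> * \<Gamma> * (1 - a))" by (simp add: exp_powr_real algebra_simps)
      also have "\<dots> \<le> exp (\<delta> * \<Gamma>)" using delta gam a by (simp add: mult_left_le)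
      finally have "a * u powr (a - 1) \<le> 1 * exp (\<delta> * \<Gamma>)" using a by (intro mult_mono) auto
      then show "a * u powr (a - 1) \<le> exp (\<delta> * \<Gamma>)" by simp
    qed
    finally show "s powr a \<le> exp (- (a * \<delta>) * \<gamma>) * w powr a + (b * exp (\<delta> * \<Gamma>)) * \<gamma>" by (simp add: mult_ac)
  qed
  finally show ?thesis .
qed

lemma W_poly_powr_coercive:
  assumes q: "1 \<le> q" and a: "0 < a" and R: "W_poly q x powr a \<le> R"
  shows "norm x \<le> R powr (1 / a)"
proof -
  have W1: "1 \<le> W_poly q x" by (simp add: W_poly_def)
  have "norm x \<le> W_poly q x"
  proof (cases "norm x \<le> 1")
    case False
    then have "norm x ^ 1 \<le> norm x ^ (2 * q)" using q by (intro power_increasing) auto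
    then show ?thesis by (simp add: W_poly_def)
  qed (use W1 in linarith)
  also have "\<dots> = (W_poly q x powr a) powr (1 / a)" using W1 a by (simp add: powr_powr)
  also have "\<dots> \<le> R powr (1 / a)" using R a by (intro powr_mono2) auto
  finally show ?thesis .
qed

text \<open>\<open>u\<close> is below the convex combination of \<open>r\<close> and
  \<open>K\<close> with weight \<open>t = c * \<gamma> / 2\<close> on \<open>K\<close>, so convexity
  of the even power gives decay at rate \<open>c / 2\<close>. Half of it absorbs the noise term of
  degree \<open>2 * q\<close>, and \<open>c / 4\<close> remains. The summand \<open>c / 4\<close>
  next to \<open>F\<close> corrects for the 1 in the weight.\<close>

lemma polynomial_drift:
  fixes r K c C \<gamma> \<Gamma> :: real and q :: nat
  assumes r: "0 \<le> r" and K: "0 \<le> K" and c: "0 < c" and C: "0 \<le> C" and gam: "0 < \<gamma>" "\<gamma> \<le> \<Gamma>" "\<gamma> * c \<le> 1"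
    and u: "0 \<le> u" "u \<le> (1 - c * \<gamma> / 2) * r + c * \<gamma> / 2 * K"
  defines "F \<equiv> c / 2 * K ^ (2 * Suc q) + 2 * C * (8 * C / c) ^ q + 2 * C * K ^ (2 * q) + 2 * C * (2 * \<Gamma>) ^ q"
  shows "1 + (u ^ (2 * Suc q) + C * (u ^ (2 * q) * (2 * \<gamma>) + (2 * \<gamma>) ^ Suc q))
     \<le> exp (- (c / 4) * \<gamma>) * (1 + r ^ (2 * Suc q)) + (F + c / 4) * \<gamma>"
proof -
  define t where "t = c * \<gamma> / 2"
  have t: "0 \<le> t" "t \<le> 1" using c gam by (auto simp: t_def mult.commute)
  have u': "u \<le> (1 - t) * r + t * K" using u(2) by (simp add: t_def)
  have "u ^ (2 * Suc q) \<le> ((1 - t) *\<^sub>R r + t *\<^sub>R K) ^ (2 * Suc q)"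
    using u' u(1) by (intro power_mono) auto
  also have "\<dots> \<le> (1 - t) * r ^ (2 * Suc q) + t * K ^ (2 * Suc q)"
    using convex_onD[OF convex_power_even[of "2 * Suc q"], of t r K] t by simp
  finally have 1: "u ^ (2 * Suc q) \<le> (1 - t) * r ^ (2 * Suc q) + t * K ^ (2 * Suc q)" .
  have 2: "u ^ (2 * q) \<le> r ^ (2 * q) + K ^ (2 * q)"
  proof -
    have "(1 - t) * r + t * K \<le> (1 - t) * max r K + t * max r K" using t by (intro add_mono mult_left_mono) auto
    then have "u \<le> max r K" using u' by (simp add: algebra_simps)
    then have "u ^ (2 * q) \<le> (max r K) ^ (2 * q)" using u by (intro power_mono) auto
    also have "\<dots> \<le> r ^ (2 * q) + K ^ (2 * q)" using r K by (auto simp: max_def)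
    finally show ?thesis .
  qed
  \<comment> \<open>The threshold \<open>8 * C / c\<close> for \<open>r^2\<close> is where the
    leading power takes over; below it the noise term is bounded by a constant.\<close>
  have 3: "2 * C * r ^ (2 * q) \<le> c / 4 * r ^ (2 * Suc q) + 2 * C * (8 * C / c) ^ q"
  proof (cases "8 * C / c \<le> r^2")
    case True
    then have "2 * C \<le> c / 4 * r^2" using c by (simp add: field_simps)
    then have "2 * C * r ^ (2 * q) \<le> c / 4 * r^2 * r ^ (2 * q)" using r by (intro mult_right_mono) auto
    moreover have "c / 4 * r^2 * r ^ (2 * q) = c / 4 * r ^ (2 * Suc q)" by (simp add: power2_eq_square)
    moreover have "0 \<le> 2 * C * (8 * C / c) ^ q" using C c by simp
    ultimately show ?thesis by linarith
  next
    case False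
    then have "(r^2) ^ q \<le> (8 * C / c) ^ q" by (intro power_mono) auto
    then have "2 * C * r ^ (2 * q) \<le> 2 * C * (8 * C / c) ^ q" using C by (simp add: power_mult mult_left_mono)
    moreover have "0 \<le> c / 4 * r ^ (2 * Suc q)" using c r by simp
    ultimately show ?thesis by linarith
  qed
  have 4: "(2 * \<gamma>) ^ q \<le> (2 * \<Gamma>) ^ q" using gam by (intro power_mono) auto
  let ?X = "r ^ (2 * Suc q)"
  have "u ^ (2 * q) * (2 * \<gamma>) + (2 * \<gamma>) ^ Suc q = 2 * \<gamma> * (u ^ (2 * q) + (2 * \<gamma>) ^ q)" by (simp add: algebra_simps)
  also have "\<dots> \<le> 2 * \<gamma> * (r ^ (2 * q) + K ^ (2 * q) + (2 * \<Gamma>) ^ q)" using gam by (intro mult_left_mono add_mono 2 4) auto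
  finally have "C * (u ^ (2 * q) * (2 * \<gamma>) + (2 * \<gamma>) ^ Suc q) \<le> C * (2 * \<gamma> * (r ^ (2 * q) + K ^ (2 * q) + (2 * \<Gamma>) ^ q))"
    using C by (intro mult_left_mono) auto
  also have "\<dots> = \<gamma> * (2 * C * r ^ (2 * q)) + \<gamma> * (2 * C * K ^ (2 * q) + 2 * C * (2 * \<Gamma>) ^ q)" by (simp add: algebra_simps)
  also have "\<gamma> * (2 * C * r ^ (2 * q)) \<le> \<gamma> * (c / 4 * ?X + 2 * C * (8 * C / c) ^ q)" using 3 gam by (intro mult_left_mono) auto
  finally have "1 + (u ^ (2 * Suc q) + C * (u ^ (2 * q) * (2 * \<gamma>) + (2 * \<gamma>) ^ Suc q))
     \<le> 1 + (((1 - t) * ?X + t * K ^ (2 * Suc q)) + (\<gamma> * (c / 4 * ?X + 2 * C * (8 * C / c) ^ q) + \<gamma> * (2 * C * K ^ (2 * q) + 2 * C * (2 * \<Gamma>) ^ q)))"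
    using 1 by (intro add_left_mono add_mono) auto
  also have "\<dots> = (1 - c / 4 * \<gamma>) * (1 + ?X) + (F + c / 4) * \<gamma>"
    unfolding F_def t_def by (simp add: algebra_simps del: power_Suc mult_Suc_right)
  also have "(1 - c / 4 * \<gamma>) * (1 + ?X) \<le> exp (- (c / 4) * \<gamma>) * (1 + ?X)"
    using exp_ge_add_one_self[of "- (c / 4) * \<gamma>"] r by (intro mult_right_mono add_nonneg_nonneg) auto
  finally show ?thesis by simp
qed

lemma family_ergodic_poly:
  fixes V U :: "'p \<Rightarrow> 'a::euclidean_space \<Rightarrow> real"
  assumes H1: "H1_family \<Theta> V gV U L M" and ne: "\<Theta> \<noteq> {}"
    and kap: "0 < \<kappa>lo" "\<kappa>lo \<le> \<kappa>hi" and gpos: "0 < \<Gamma>" and gbar: "\<Gamma> < 2 / (m + L)"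
    and m: "0 < m" and mV: "\<And>\<theta>. \<theta> \<in> \<Theta> \<Longrightarrow> m_convex m (V \<theta>)" and a: "0 < a" "a \<le> 1" and q1: "1 \<le> q"
  shows "\<exists>A \<rho>. 0 \<le> A \<and> 0 < \<rho> \<and> \<rho> < 1 \<and> (\<forall>\<theta>\<in>\<Theta>. \<forall>\<kappa> \<gamma>. \<kappa>lo \<le> \<kappa> \<and> \<kappa> \<le> \<kappa>hi \<and> 0 < \<gamma> \<and> \<gamma> \<le> \<Gamma> \<longrightarrow>
     (\<exists>\<pi>. geom_ergodic (\<lambda>x. W_poly q x powr a) (pula_kernel (gV \<theta>) (U \<theta>) \<kappa> \<gamma>) \<gamma> A \<rho> \<pi>))"
proof -
  note M = H1_family_lipschitz_nonneg(1)[OF H1 ne] and L0 = H1_family_lipschitz_nonneg(2)[OF H1 ne]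
  obtain \<theta>0 where \<theta>0: "\<theta>0 \<in> \<Theta>" using ne by blast
  \<comment> \<open>in fact \<open>m \<le> L\<close>; this turns the step size bound into \<open>\<Gamma> L < 2\<close>\<close>
  have L: "0 < L"
  proof -
    have der: "(V \<theta>0 has_derivative (\<lambda>h. gV \<theta>0 x \<bullet> h)) (at x)" for x
      using H1 \<theta>0 unfolding H1_family_def by blast
    have lip: "L-lipschitz_on UNIV (gV \<theta>0)" using H1 \<theta>0 unfolding H1_family_def by blast
    obtain e :: 'a where "e \<in> Basis" using nonempty_Basis by blast
    then have e: "norm e = 1" by simp
    have "m \<le> (gV \<theta>0 e - gV \<theta>0 0) \<bullet> e"
      using gradient_strongly_monotone[OF mV[OF \<theta>0] der, of e 0] e by simp
    also have "\<dots> \<le> norm (gV \<theta>0 e - gV \<theta>0 0) * norm e" by (rule norm_cauchy_schwarz)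
    also have "\<dots> \<le> L" using lipschitz_onD[OF lip, of e 0] e by (simp add: dist_norm)
    finally show ?thesis using m by linarith
  qed
  have gL: "\<Gamma> * L < 2"
  proof -
    have "\<Gamma> * (m + L) < 2" using gbar m L by (simp add: pos_less_divide_eq)
    moreover have "\<Gamma> * L \<le> \<Gamma> * (m + L)" using gpos m by (intro mult_left_mono) auto
    ultimately show ?thesis by linarith
  qed
  obtain R1 Us where R1: "0 \<le> R1" "0 \<le> Us"
    and pot: "\<And>\<theta>. \<theta> \<in> \<Theta> \<Longrightarrow> \<exists>xs. pula_potential (V \<theta>) (U \<theta>) (gV \<theta>) L M \<Gamma> R1 xs \<and> U \<theta> xs \<le> Us"
    using H1_family_potential[OF H1 L gL M] by blast
  obtain p where q: "q = Suc p" using q1 by (cases q) auto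
  obtain C where C: "0 \<le> C" and growth: "\<And>(u :: 'a) s. s > 0 \<Longrightarrow>
     (\<integral>\<^sup>+y. ennreal (norm y ^ (2 * Suc p)) \<partial>gaussian u s)
       \<le> ennreal (norm u ^ (2 * Suc p) + C * (norm u ^ (2 * p) * s + s ^ Suc p))"
    using gaussian_power_growth by blast
  define c where "c = m * (2 - \<Gamma> * L)"
  \<comment> \<open>Scaled so that the error \<open>\<gamma> * (\<kappa>hi * M + L * R1)\<close>
    becomes \<open>c * \<gamma> / 2 * K\<close>, the second part of a convex combination.\<close>
  define K where "K = 2 / c * (\<kappa>hi * M + L * R1)"
  define F where "F = c / 2 * K ^ (2 * Suc p) + 2 * C * (8 * C / c) ^ p + 2 * C * K ^ (2 * p) + 2 * C * (2 * \<Gamma>) ^ p"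
  define b where "b = (F + c / 4) * exp (c / 4 * \<Gamma>)"
  have c: "0 < c" using m gL by (simp add: c_def)
  have K: "0 \<le> K" using c kap M L R1 by (simp add: K_def)
  have F: "0 \<le> F + c / 4" using c K C gpos by (simp add: F_def)
  have b: "0 \<le> b" using F by (simp add: b_def)
  let ?W = "\<lambda>x::'a. W_poly q x powr a"
  have Wpm: "(W_poly q :: 'a \<Rightarrow> real) \<in> borel_measurable borel" unfolding W_poly_def by measurable
  have Wp1: "1 \<le> W_poly q x" for x :: 'a by (simp add: W_poly_def)
  have Wm: "?W \<in> borel_measurable borel" using Wpm by measurable
  have W1: "1 \<le> ?W x" for x using Wp1[of x] a by (simp add: ge_one_powr_ge_zero)
  have co: "\<exists>r. \<forall>x. ?W x \<le> R \<longrightarrow> norm x \<le> r" for R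
    using W_poly_powr_coercive[OF q1 a(1)] by blast
  have delta: "0 < a * (c / 4)" using a c by simp
  obtain A \<rho> where A: "0 \<le> A" "0 < \<rho>" "\<rho> < 1"
    and erg: "\<And>(\<Phi> :: 'a \<Rightarrow> 'a) \<gamma>. 0 < \<gamma> \<Longrightarrow> \<gamma> \<le> \<Gamma> \<Longrightarrow> (\<And>x y. norm (\<Phi> x - \<Phi> y) \<le> norm (x - y))
      \<Longrightarrow> (\<And>x. (\<integral>\<^sup>+y. ennreal (?W y) \<partial>gaussian (\<Phi> x) (2 * \<gamma>)) \<le> ennreal (exp (- (a * (c / 4)) * \<gamma>) * ?W x + b * \<gamma>))
      \<Longrightarrow> \<exists>\<pi>. geom_ergodic ?W (\<lambda>x. gaussian (\<Phi> x) (2 * \<gamma>)) \<gamma> A \<rho> \<pi>"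
    using gaussian_chain_ergodic[OF Wm W1 co delta b, of \<Gamma>] by blast
  have "\<exists>\<pi>. geom_ergodic ?W (pula_kernel (gV \<theta>) (U \<theta>) \<kappa> \<gamma>) \<gamma> A \<rho> \<pi>"
    if \<theta>: "\<theta> \<in> \<Theta>" and kg: "\<kappa>lo \<le> \<kappa>" "\<kappa> \<le> \<kappa>hi" "0 < \<gamma>" "\<gamma> \<le> \<Gamma>" for \<theta> \<kappa> \<gamma>
  proof -
    obtain xs where xs: "pula_potential (V \<theta>) (U \<theta>) (gV \<theta>) L M \<Gamma> R1 xs" using pot[OF \<theta>] by blast
    interpret pula_potential "V \<theta>" "U \<theta>" "gV \<theta>" L M \<Gamma> \<kappa>hi R1 xs by (rule xs)
    have k0: "0 < \<kappa>" using kap kg by linarith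
    show ?thesis unfolding pula_kernel_eq
    proof (rule erg[OF kg(3,4)])
      show "norm (pula_map (gV \<theta>) (U \<theta>) \<kappa> \<gamma> x - pula_map (gV \<theta>) (U \<theta>) \<kappa> \<gamma> y) \<le> norm (x - y)" for x y
        by (rule pula_map_nonexpansive[OF kg(3,4) k0 kg(2)])
      fix x
      let ?u = "pula_map (gV \<theta>) (U \<theta>) \<kappa> \<gamma> x"
      interpret G: prob_space "gaussian ?u (2 * \<gamma>)" using kg by (intro prob_space_gaussian) simp
      have gc: "\<gamma> * c \<le> 1" and u: "norm ?u \<le> (1 - c * \<gamma> / 2) * norm x + \<gamma> * (\<kappa>hi * M + L * R1)"
        using pula_map_norm_strong[OF kg(3,4) k0 kg(2) m mV[OF \<theta>]] unfolding c_def by blast+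
      have "\<gamma> * (\<kappa>hi * M + L * R1) = c * \<gamma> / 2 * K" using c by (simp add: K_def)
      then have u': "norm ?u \<le> (1 - c * \<gamma> / 2) * norm x + c * \<gamma> / 2 * K" using u by (simp only:)
      have "(\<integral>\<^sup>+y. ennreal (W_poly q y) \<partial>gaussian ?u (2 * \<gamma>)) = (\<integral>\<^sup>+y. 1 + ennreal (norm y ^ (2 * Suc p)) \<partial>gaussian ?u (2 * \<gamma>))"
        unfolding W_poly_def q by (intro nn_integral_cong) (subst ennreal_plus, auto)
      also have "\<dots> = 1 + (\<integral>\<^sup>+y. ennreal (norm y ^ (2 * Suc p)) \<partial>gaussian ?u (2 * \<gamma>))"
        by (subst nn_integral_add) (auto simp: G.emeasure_space_1)
      also have "\<dots> \<le> 1 + ennreal (norm ?u ^ (2 * Suc p) + C * (norm ?u ^ (2 * p) * (2 * \<gamma>) + (2 * \<gamma>) ^ Suc p))"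
        using kg by (intro add_left_mono growth) simp
      also have "\<dots> = ennreal (1 + (norm ?u ^ (2 * Suc p) + C * (norm ?u ^ (2 * p) * (2 * \<gamma>) + (2 * \<gamma>) ^ Suc p)))"
        using C kg by (subst ennreal_plus) auto
      also have "\<dots> \<le> ennreal (exp (- (c / 4) * \<gamma>) * W_poly q x + (F + c / 4) * \<gamma>)"
        unfolding W_poly_def q F_def
        by (intro ennreal_leI polynomial_drift norm_ge_zero K c C kg(3,4) gc u')
      finally have "(\<integral>\<^sup>+y. ennreal (W_poly q y) \<partial>gaussian ?u (2 * \<gamma>)) \<le> ennreal (exp (- (c / 4) * \<gamma>) * W_poly q x + (F + c / 4) * \<gamma>)" .
      from powr_drift[OF G.prob_space_axioms _ Wp1 Wp1 this a F kg(3,4)]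
      show "(\<integral>\<^sup>+y. ennreal (?W y) \<partial>gaussian ?u (2 * \<gamma>)) \<le> ennreal (exp (- (a * (c / 4)) * \<gamma>) * ?W x + b * \<gamma>)"
        using c Wpm by (simp add: b_def cong: measurable_cong_sets)
    qed
  qed
  then show ?thesis using A by (intro exI[of _ A] exI[of _ \<rho>]) simp
qed

text \<open>Exponential weights are closed under powers, and
  \<open>\<alpha> * a \<le> \<alpha>\<close> preserves the bound on \<alpha>, so the drift estimate
  applies directly.\<close>

lemma W_exp_powr: "W_exp \<alpha> x powr a = W_exp (\<alpha> * a) x"
  by (simp add: W_exp_def exp_powr_real mult_ac)

theorem theorem5:
  fixes \<Theta> :: "'p::euclidean_space set"
    and V Vb U Ub :: "'p \<Rightarrow> 'a::euclidean_space \<Rightarrow> real"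
    and gV gVb :: "'p \<Rightarrow> 'a \<Rightarrow> 'a"
    and L M \<kappa>lo \<kappa>hi \<gamma>bar :: real
    and W :: "'a \<Rightarrow> real"
  assumes "\<Theta> \<noteq> {}"
    and H1: "H1_family \<Theta> V gV U L M" "H1_family \<Theta> Vb gVb Ub L M"
    and kappa: "\<kappa>hi > 1" "1 \<ge> \<kappa>lo" "\<kappa>lo > 1/2"
    and gpos: "\<gamma>bar > 0"
    and cases:
      "(\<exists>m>0. (\<forall>\<theta>\<in>\<Theta>. m_convex m (V \<theta>) \<and> m_convex m (Vb \<theta>))
             \<and> \<gamma>bar < 2 / (m + L) \<and> (\<exists>q::nat. q \<ge> 1 \<and> W = W_poly q))
       \<or> (\<exists>\<eta>>0. \<exists>c\<ge>0. (\<forall>\<theta>\<in>\<Theta>. \<forall>x. min (U \<theta> x) (Ub \<theta> x) \<ge> \<eta> * norm x - c)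
             \<and> \<gamma>bar < 2 / L \<and> (\<exists>\<alpha>. 0 < \<alpha> \<and> \<alpha> < \<kappa>lo * \<eta> / 4 \<and> W = W_exp \<alpha>))"
  shows "\<forall>a. 0 < a \<and> a \<le> 1 \<longrightarrow>
    (\<exists>A \<rho>. A \<ge> 0 \<and> 0 < \<rho> \<and> \<rho> < 1 \<and>
      (\<forall>\<theta>\<in>\<Theta>. \<forall>\<kappa>. \<kappa>lo \<le> \<kappa> \<and> \<kappa> \<le> \<kappa>hi \<longrightarrow> (\<forall>\<gamma>. 0 < \<gamma> \<and> \<gamma> \<le> \<gamma>bar \<longrightarrow>
        (let S = pula_kernel (gV \<theta>) (U \<theta>) \<kappa> \<gamma>; Sb = pula_kernel (gVb \<theta>) (Ub \<theta>) \<kappa> \<gamma>;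
             Wa = (\<lambda>x. W x powr a) in
         \<exists>\<pi> \<pi>b. invariant_prob S \<pi> \<and> invariant_prob Sb \<pi>b \<and>
           (\<forall>x y n.
              max (wnorm Wa (kiter S n x) \<pi>) (wnorm Wa (kiter Sb n x) \<pi>b)
                \<le> ereal (A * \<rho> powr (\<gamma> * real n) * Wa x)
            \<and> max (wnorm Wa (kiter S n x) (kiter S n y)) (wnorm Wa (kiter Sb n x) (kiter Sb n y))
                \<le> ereal (A * \<rho> powr (\<gamma> * real n) * (Wa x + Wa y)))))))"
proof (intro allI impI, goal_cases)
  case a: (1 a)
  have kap: "0 < \<kappa>lo" "\<kappa>lo \<le> \<kappa>hi" using kappa by linarith+
  let ?Wa = "\<lambda>x. W x powr a"
  \<comment> \<open>The two families satisfy the hypotheses separately and are treated one at a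
    time; only their constants are joined, by maxima.\<close>
  define erg where "erg = (\<lambda>(gV :: 'p \<Rightarrow> 'a \<Rightarrow> 'a) (U :: 'p \<Rightarrow> 'a \<Rightarrow> real) A \<rho>.
     \<forall>\<theta>\<in>\<Theta>. \<forall>\<kappa> \<gamma>. \<kappa>lo \<le> \<kappa> \<and> \<kappa> \<le> \<kappa>hi \<and> 0 < \<gamma> \<and> \<gamma> \<le> \<gamma>bar \<longrightarrow>
       (\<exists>\<pi>. geom_ergodic ?Wa (pula_kernel (gV \<theta>) (U \<theta>) \<kappa> \<gamma>) \<gamma> A \<rho> \<pi>))"
  have "\<exists>A \<rho>. 0 \<le> A \<and> 0 < \<rho> \<and> \<rho> < 1 \<and> erg gV U A \<rho>" and "\<exists>A \<rho>. 0 \<le> A \<and> 0 < \<rho> \<and> \<rho> < 1 \<and> erg gVb Ub A \<rho>"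
  proof -
    consider (strong) m q where "0 < m" "\<And>\<theta>. \<theta> \<in> \<Theta> \<Longrightarrow> m_convex m (V \<theta>)" "\<And>\<theta>. \<theta> \<in> \<Theta> \<Longrightarrow> m_convex m (Vb \<theta>)"
        "\<gamma>bar < 2 / (m + L)" "1 \<le> q" "W = W_poly q"
      | (growth) \<eta> c \<alpha> where "0 < \<eta>" "0 \<le> c" "\<And>\<theta> x. \<theta> \<in> \<Theta> \<Longrightarrow> \<eta> * norm x - c \<le> U \<theta> x"
        "\<And>\<theta> x. \<theta> \<in> \<Theta> \<Longrightarrow> \<eta> * norm x - c \<le> Ub \<theta> x" "\<gamma>bar < 2 / L" "0 < \<alpha>" "\<alpha> < \<kappa>lo * \<eta> / 4" "W = W_exp \<alpha>"
      using cases by (elim disjE exE conjE) auto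
    then have "(\<exists>A \<rho>. 0 \<le> A \<and> 0 < \<rho> \<and> \<rho> < 1 \<and> erg gV U A \<rho>) \<and> (\<exists>A \<rho>. 0 \<le> A \<and> 0 < \<rho> \<and> \<rho> < 1 \<and> erg gVb Ub A \<rho>)"
    proof cases
      case strong
      show ?thesis unfolding erg_def strong(6)
        using family_ergodic_poly[OF H1(1) assms(1) kap gpos strong(4,1,2) conjunct1[OF a] conjunct2[OF a] strong(5)]
          family_ergodic_poly[OF H1(2) assms(1) kap gpos strong(4,1,3) conjunct1[OF a] conjunct2[OF a] strong(5)] by (intro conjI)
    next
      case growth
      have "\<alpha> * a \<le> \<alpha>" using growth(6) a by (simp add: mult_left_le)
      from le_less_trans[OF this growth(7)] have al: "0 < \<alpha> * a" "\<alpha> * a < \<kappa>lo * \<eta> / 4"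
        using growth(6) a by simp_all
      show ?thesis unfolding erg_def growth(8) W_exp_powr
        using family_ergodic_exp[OF H1(1) assms(1) kap gpos growth(5,1,2,3) al]
          family_ergodic_exp[OF H1(2) assms(1) kap gpos growth(5,1,2,4) al] by (intro conjI)
    qed
    then show "\<exists>A \<rho>. 0 \<le> A \<and> 0 < \<rho> \<and> \<rho> < 1 \<and> erg gV U A \<rho>" "\<exists>A \<rho>. 0 \<le> A \<and> 0 < \<rho> \<and> \<rho> < 1 \<and> erg gVb Ub A \<rho>" by auto
  qed
  then obtain A1 \<rho>1 A2 \<rho>2 where c1: "0 \<le> A1" "0 < \<rho>1" "\<rho>1 < 1" "erg gV U A1 \<rho>1"
    and c2: "0 \<le> A2" "0 < \<rho>2" "\<rho>2 < 1" "erg gVb Ub A2 \<rho>2" by blast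
  define A where "A = max A1 A2"
  define \<rho> where "\<rho> = max \<rho>1 \<rho>2"
  show ?case
  proof (rule exI[of _ A], rule exI[of _ \<rho>], intro conjI ballI allI impI, goal_cases)
    case (4 \<theta> \<kappa> \<gamma>)
    obtain \<pi>1 \<pi>2 where p1: "geom_ergodic ?Wa (pula_kernel (gV \<theta>) (U \<theta>) \<kappa> \<gamma>) \<gamma> A1 \<rho>1 \<pi>1"
      and p2: "geom_ergodic ?Wa (pula_kernel (gVb \<theta>) (Ub \<theta>) \<kappa> \<gamma>) \<gamma> A2 \<rho>2 \<pi>2"
      using c1(4) c2(4) 4 unfolding erg_def by blast
    have "geom_ergodic ?Wa (pula_kernel (gV \<theta>) (U \<theta>) \<kappa> \<gamma>) \<gamma> A \<rho> \<pi>1"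
      by (rule geom_ergodic_mono[OF p1]) (use c1 4 in \<open>auto simp: A_def \<rho>_def\<close>)
    moreover have "geom_ergodic ?Wa (pula_kernel (gVb \<theta>) (Ub \<theta>) \<kappa> \<gamma>) \<gamma> A \<rho> \<pi>2"
      by (rule geom_ergodic_mono[OF p2]) (use c2 4 in \<open>auto simp: A_def \<rho>_def\<close>)
    ultimately show ?case
      unfolding Let_def geom_ergodic_def by (intro exI[of _ \<pi>1] exI[of _ \<pi>2]) simp
  qed (use c1 c2 in \<open>auto simp: A_def \<rho>_def\<close>)
qed

end
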